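(* Let $1<\gamma<3$, $0<\lambda<1$, $\ell=\frac{2}{\gamma-1}$, $u_+\in\mathbb{R}$, $c_+>0$ and $\mathrm{Ma}=u_+/c_+$. Consider the isentropic Euler system $$u_t+uu_x+\ell cc_x=0,\qquad c_t+uc_x+\ell^{-1}cu_x=0,$$ with initial data $c(0,x)=0$ ($u(0,x)$ undefined; vacuum) for $x<0$, and $u(0,x)=u_+x^{1-\lambda}$, $c(0,x)=c_+x^{1-\lambda}$ for $x>0$. Then this initial value problem admits a self-similar solution $(u(t,x),c(t,x))$ of the form $$u(t,x)=-\tfrac1\lambda\tfrac xt V(\xi),\qquad c(t,x)=-\tfrac1\lambda\tfrac xt C(\xi),\qquad \xi=t^{-1/\lambda}x,$$ defined for all $t>0$, $x\in\mathbb{R}$. Furthermore, the following behaviors occur depending on $\mathrm{Ma}$: (a) For $\mathrm{Ma}>\ell$ the solution is continuous and has a stationary vacuum interface at $\{x=0\}$, along which the sound speed $c$ decays to vacuum in a $C^1$ manner at each time $t>0$. The same applies to the limiting case $\mathrm{Ma}=\ell$, except that $c$ then decays to vacuum in a Lipschitz manner at each time $t>0$. (b) For $-\ell\le \mathrm{Ma}<\ell$ the solution is continuous and has a non-stationary vacuum interface propagating to the left along $x=t^{1/\lambda}\xi_v$ for some $\xi_v<0$. Along the interface the sound speed $c$ exhibits a physical singularity at each time $t>0$. (c) For $\mathrm{Ma}<-\ell$ the solution is discontinuous and contains a single 2-shock, together with a non-stationary vacuum interface. The vacuum interface propagates to the left along $x=t^{1/\lambda}\xi_v$ for some $\xi_v<0$,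 while the 2-shock propagates to the left along $x=t^{1/\lambda}\xi_s$, where $\xi_v<\xi_s<0$. Along the interface the sound speed $c$ exhibits a physical singularity at each time $t>0$. In particular, in all cases except (b) and (c) with $\lambda=\frac12$, there is an abrupt change from $t=0$ to $t=0+$ in the decay of $c(t,\cdot)$ to vacuum.
   Context: The underlying conservation laws are $\rho_t+(\rho u)_x=0$, $(\rho u)_t+(\rho u^2)_x+p_x=0$ with $p=a^2\rho^\gamma$, $a>0$ constant, and sound speed $c=\sqrt{p'(\rho)}=a\sqrt\gamma\,\rho^{(\gamma-1)/2}\ge 0$, so that $\rho=(a\sqrt\gamma)^{-\ell}c^{\ell}$. The $(u,c)$-system is the form these take in smooth regions of the flow. Solution: the fluid occupies the region to the right of a vacuum interface; to the left of it there is vacuum ($c=0$, $u$ undefined) and $c$ tends to $0$ as the interface is approached from within the fluid. In the fluid region $c>0$, and $(u,c)$ satisfies the $(u,c)$-system wherever it is smooth (values at $x=0$ inside the fluid being understood as limits). Across any discontinuity $x=\mathcal X(t)$ inside the fluid, the Rankine-Hugoniot conditions $\dot{\mathcal X}[\rho]=[\rho u]$, $\dot{\mathcal X}[\rho u]=[\rho u^2+a^2\rho^\gamma]$ hold (where $[q]=q_+-q_-$, and subscripts $-$, $+$ denote limits from the left and right in $x$) together with the entropy condition $u_--c_->\dot{\mathcal X}>u_+-c_+$ (1-shock) or $u_-+c_->\dot{\mathcal X}>u_++c_+$ (2-shock). The initial data are attained in the sense that, for each fixed $x>0$, $u(t,x)\to u_+x^{1-\lambda}$ and $c(t,x)\to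 c_+x^{1-\lambda}$ as $t\downarrow0$. "Continuous" means that $u$ and $c$ are continuous in the fluid region (no shocks). Decay terminology: at a fixed time, if the leading order behavior of $c$ near the vacuum interface (from within the fluid) is $c\sim[\text{distance to interface}]^\alpha$, then $c$ is said to decay to vacuum in a $C^1$ manner if $\alpha>1$, in a Lipschitz manner if $\alpha=1$, and in a Hölder manner if $0<\alpha<1$. A physical singularity is the case $\alpha=\frac12$. At time $t=0$ the exponent is $\alpha=1-\lambda$; an "abrupt change" in the decay means that the exponent at times $t>0$ differs from $1-\lambda$. *)

theory Defs
  imports "HOL-Analysis.Analysis"
begin

text \<open>
  Isentropic Euler flow next to a vacuum, in the variables velocity \<open>u t x\<close> and sound
  speed \<open>c t x\<close>.  The functions \<open>u\<close>, \<open>c\<close> are total, but \<open>u\<close> carries information only in the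
  fluid region: in the vacuum the velocity is undefined, and no property of \<open>u\<close> is
  required there.
\<close>

definition ell :: "real \<Rightarrow> real" where
  "ell \<gamma> = 2 / (\<gamma> - 1)"

definition pressure :: "real \<Rightarrow> real \<Rightarrow> real \<Rightarrow> real" where
  "pressure a \<gamma> \<rho> = a\<^sup>2 * \<rho> powr \<gamma>"

definition density :: "real \<Rightarrow> real \<Rightarrow> real \<Rightarrow> real" where
  "density a \<gamma> c = (a * sqrt \<gamma>) powr (- ell \<gamma>) * c powr ell \<gamma>"

text \<open>The density is the one for which \<open>c\<close> is the sound speed, i.e.\ the square root of \<open>p'(\<rho>)\<close>.\<close>

lemma sound_speed_density:
  fixes a \<gamma> c :: real
  assumes "a > 0" "\<gamma> > 1" "c > 0"
  shows "sqrt (deriv (pressure a \<gamma>) (density a \<gamma> c)) = c"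
proof -
  define \<rho> where "\<rho> = density a \<gamma> c"
  have pos: "\<rho> > 0"
    using assms by (simp add: \<rho>_def density_def)
  have "(pressure a \<gamma> has_real_derivative a\<^sup>2 * (\<gamma> * \<rho> powr (\<gamma> - 1))) (at \<rho>)"
    unfolding pressure_def using pos by (auto intro!: derivative_eq_intros)
  hence d: "deriv (pressure a \<gamma>) \<rho> = a\<^sup>2 * \<gamma> * \<rho> powr (\<gamma> - 1)"
    by (simp add: DERIV_imp_deriv)
  have e: "ell \<gamma> * (\<gamma> - 1) = 2"
    unfolding ell_def using assms by (subst times_divide_eq_left, subst nonzero_divide_eq_eq) auto
  have "\<rho> powr (\<gamma> - 1) = (a * sqrt \<gamma>) powr (- ell \<gamma> * (\<gamma> - 1)) * c powr (ell \<gamma> * (\<gamma> - 1))"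
    using assms by (simp add: \<rho>_def density_def powr_mult powr_powr)
  also have "\<dots> = (a * sqrt \<gamma>) powr (- 2) * c powr 2"
    using e by simp
  also have "\<dots> = c\<^sup>2 / (a\<^sup>2 * \<gamma>)"
    using assms by (simp add: powr_minus divide_simps power_mult_distrib)
  finally show ?thesis
    using assms by (simp add: d flip: \<rho>_def)
qed

text \<open>
  The function \<open>X\<close> gives the position of the vacuum interface; the fluid is to its right.
\<close>

definition fluid :: "(real \<Rightarrow> real) \<Rightarrow> (real \<times> real) set" where
  "fluid X = {(t, x). t > 0 \<and> x > X t}"

definition continuous_flow ::
    "(real \<Rightarrow> real) \<Rightarrow> (real \<Rightarrow> real \<Rightarrow> real) \<Rightarrow> (real \<Rightarrow> real \<Rightarrow> real) \<Rightarrow> bool" where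
  "continuous_flow X u c \<longleftrightarrow>
     continuous_on (fluid X) (\<lambda>(t, x). u t x) \<and> continuous_on (fluid X) (\<lambda>(t, x). c t x)"

definition discontinuities ::
    "(real \<Rightarrow> real) \<Rightarrow> (real \<Rightarrow> real \<Rightarrow> real) \<Rightarrow> (real \<Rightarrow> real \<Rightarrow> real) \<Rightarrow> (real \<times> real) set" where
  "discontinuities X u c =
     {p \<in> fluid X. \<not> (isCont (\<lambda>(t, x). u t x) p \<and> isCont (\<lambda>(t, x). c t x) p)}"

definition C1_on :: "(real \<Rightarrow> real \<Rightarrow> real) \<Rightarrow> (real \<times> real) set \<Rightarrow> bool" where
  "C1_on f W \<longleftrightarrow>
     (\<exists>ft fx. continuous_on W ft \<and> continuous_on W fx \<and>
        (\<forall>p\<in>W. ((\<lambda>(t, x). f t x) has_derivative (\<lambda>(h, k). ft p * h + fx p * k)) (at p)))"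

definition uc_system ::
    "real \<Rightarrow> (real \<Rightarrow> real \<Rightarrow> real) \<Rightarrow> (real \<Rightarrow> real \<Rightarrow> real) \<Rightarrow> real \<Rightarrow> real \<Rightarrow> bool" where
  "uc_system \<gamma> u c t x \<longleftrightarrow>
     deriv (\<lambda>\<tau>. u \<tau> x) t + u t x * deriv (\<lambda>y. u t y) x
       + ell \<gamma> * c t x * deriv (\<lambda>y. c t y) x = 0 \<and>
     deriv (\<lambda>\<tau>. c \<tau> x) t + u t x * deriv (\<lambda>y. c t y) x
       + inverse (ell \<gamma>) * c t x * deriv (\<lambda>y. u t y) x = 0"

text \<open>
  Shock relations between a left state \<open>(um, cm)\<close> and a right state \<open>(up, cp)\<close> at speed \<open>s\<close>.
\<close>

definition rankine_hugoniot ::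
    "real \<Rightarrow> real \<Rightarrow> real \<Rightarrow> real \<Rightarrow> real \<Rightarrow> real \<Rightarrow> real \<Rightarrow> bool" where
  "rankine_hugoniot a \<gamma> s um cm up cp \<longleftrightarrow>
     (let \<rho>m = density a \<gamma> cm; \<rho>p = density a \<gamma> cp in
        s * (\<rho>p - \<rho>m) = \<rho>p * up - \<rho>m * um \<and>
        s * (\<rho>p * up - \<rho>m * um) =
          (\<rho>p * up\<^sup>2 + pressure a \<gamma> \<rho>p) - (\<rho>m * um\<^sup>2 + pressure a \<gamma> \<rho>m))"

definition entropy1 :: "real \<Rightarrow> real \<Rightarrow> real \<Rightarrow> real \<Rightarrow> real \<Rightarrow> bool" where
  "entropy1 s um cm up cp \<longleftrightarrow> um - cm > s \<and> s > up - cp"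

definition entropy2 :: "real \<Rightarrow> real \<Rightarrow> real \<Rightarrow> real \<Rightarrow> real \<Rightarrow> bool" where
  "entropy2 s um cm up cp \<longleftrightarrow> um + cm > s \<and> s > up + cp"

definition shock_with ::
    "(real \<Rightarrow> real \<Rightarrow> real \<Rightarrow> real \<Rightarrow> real \<Rightarrow> bool) \<Rightarrow> real \<Rightarrow> real \<Rightarrow>
     (real \<Rightarrow> real \<Rightarrow> real) \<Rightarrow> (real \<Rightarrow> real \<Rightarrow> real) \<Rightarrow> (real \<Rightarrow> real) \<Rightarrow> real \<Rightarrow> bool" where
  "shock_with E a \<gamma> u c \<sigma> t \<longleftrightarrow>
     (\<exists>s um cm up cp.
        (\<sigma> has_real_derivative s) (at t) \<and>
        (u t \<longlongrightarrow> um) (at_left (\<sigma> t)) \<and> (c t \<longlongrightarrow> cm) (at_left (\<sigma> t)) \<and>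
        (u t \<longlongrightarrow> up) (at_right (\<sigma> t)) \<and> (c t \<longlongrightarrow> cp) (at_right (\<sigma> t)) \<and>
        rankine_hugoniot a \<gamma> s um cm up cp \<and> E s um cm up cp)"

abbreviation "shock1 \<equiv> shock_with entropy1"
abbreviation "shock2 \<equiv> shock_with entropy2"

text \<open>
  The finite set \<open>\<Gamma>\<close> of curves contains the shocks and also the weak discontinuities, i.e.\
  curves across which \<open>u\<close> and \<open>c\<close> are continuous but their derivatives need not be.  The
  complement of the curves is dense in the fluid region, so the differential equations hold at
  every point having a neighbourhood in which \<open>u\<close> and \<open>c\<close> are of class \<open>C\<^sup>1\<close>.
  The values of \<open>u0\<close> on the negative half-axis are irrelevant.
\<close>

definition euler_solution ::
    "real \<Rightarrow> real \<Rightarrow> (real \<Rightarrow> real) \<Rightarrow> (real \<Rightarrow> real) \<Rightarrow>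
     (real \<Rightarrow> real) \<Rightarrow> (real \<Rightarrow> real \<Rightarrow> real) \<Rightarrow> (real \<Rightarrow> real \<Rightarrow> real) \<Rightarrow> bool" where
  "euler_solution a \<gamma> u0 c0 X u c \<longleftrightarrow>
     continuous_on {0<..} X \<and>
     (\<forall>t>0. \<forall>x. (x \<le> X t \<longrightarrow> c t x = 0) \<and> (x > X t \<longrightarrow> c t x > 0)) \<and>
     (\<forall>t>0. (c t \<longlongrightarrow> 0) (at_right (X t))) \<and>
     (\<exists>\<Gamma> :: (real \<Rightarrow> real) set.
        finite \<Gamma> \<and> (\<forall>\<sigma>\<in>\<Gamma>. \<forall>t>0. \<sigma> differentiable (at t)) \<and>
        (let W = fluid X - (\<Union>\<sigma>\<in>\<Gamma>. {(t, \<sigma> t) | t. t > 0}) in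
           C1_on u W \<and> C1_on c W \<and> (\<forall>(t, x)\<in>W. uc_system \<gamma> u c t x)) \<and>
        (\<forall>\<sigma>\<in>\<Gamma>. \<forall>t>0. (t, \<sigma> t) \<in> discontinuities X u c \<longrightarrow>
           shock1 a \<gamma> u c \<sigma> t \<or> shock2 a \<gamma> u c \<sigma> t)) \<and>
     (\<forall>x>0. ((\<lambda>t. u t x) \<longlongrightarrow> u0 x) (at_right 0)) \<and>
     (\<forall>x. x \<noteq> 0 \<longrightarrow> ((\<lambda>t. c t x) \<longlongrightarrow> c0 x) (at_right 0))"

text \<open>
  In the self-similar form the factor \<open>x / t\<close> vanishes at \<open>x = 0\<close>, where \<open>V\<close> and \<open>C\<close> may be
  unbounded; if that point lies inside the fluid, the values there are the limits.
\<close>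

definition self_similar ::
    "real \<Rightarrow> (real \<Rightarrow> real) \<Rightarrow> (real \<Rightarrow> real \<Rightarrow> real) \<Rightarrow> (real \<Rightarrow> real \<Rightarrow> real) \<Rightarrow>
     (real \<Rightarrow> real) \<Rightarrow> (real \<Rightarrow> real) \<Rightarrow> bool" where
  "self_similar lam X u c V C \<longleftrightarrow>
     (\<forall>t>0. \<forall>x. x \<noteq> 0 \<longrightarrow>
        c t x = - (1 / lam) * (x / t) * C (t powr (- 1 / lam) * x) \<and>
        (x > X t \<longrightarrow> u t x = - (1 / lam) * (x / t) * V (t powr (- 1 / lam) * x))) \<and>
     (\<forall>t>0. X t < 0 \<longrightarrow> (u t \<longlongrightarrow> u t 0) (at 0) \<and> (c t \<longlongrightarrow> c t 0) (at 0))"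

text \<open>Decay to vacuum of a profile \<open>f\<close> (the sound speed at a fixed time) at an interface at \<open>x0\<close>.\<close>

definition decay_exponent :: "(real \<Rightarrow> real) \<Rightarrow> real \<Rightarrow> real \<Rightarrow> bool" where
  "decay_exponent f x0 \<alpha> \<longleftrightarrow>
     (\<exists>K>0. ((\<lambda>x. f x / (x - x0) powr \<alpha>) \<longlongrightarrow> K) (at_right x0))"

definition C1_decay :: "(real \<Rightarrow> real) \<Rightarrow> real \<Rightarrow> bool" where
  "C1_decay f x0 \<longleftrightarrow> (\<exists>\<alpha>>1. decay_exponent f x0 \<alpha>)"

definition Lipschitz_decay :: "(real \<Rightarrow> real) \<Rightarrow> real \<Rightarrow> bool" where
  "Lipschitz_decay f x0 \<longleftrightarrow> decay_exponent f x0 1"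

definition physical_singularity :: "(real \<Rightarrow> real) \<Rightarrow> real \<Rightarrow> bool" where
  "physical_singularity f x0 \<longleftrightarrow> decay_exponent f x0 (1 / 2)"

text \<open>At time 0 the interface is at the origin.\<close>

definition abrupt_change ::
    "(real \<Rightarrow> real) \<Rightarrow> (real \<Rightarrow> real) \<Rightarrow> (real \<Rightarrow> real \<Rightarrow> real) \<Rightarrow> bool" where
  "abrupt_change c0 X c \<longleftrightarrow>
     (\<exists>\<alpha>0. decay_exponent c0 0 \<alpha>0 \<and>
        (\<forall>t>0. \<exists>\<alpha>. decay_exponent (c t) (X t) \<alpha> \<and> \<alpha> \<noteq> \<alpha>0))"

end

theory Submission
  imports Defs
begin

text \<open>
  Put \<open>k = 1 / \<lambda>\<close>, \<open>n = 1 / (1 - \<lambda>)\<close> and \<open>l = \<ell>\<close>, so that \<open>(k - 1) (n - 1) = 1\<close>.  A self-similar flow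
  is written as \<open>u = t\<^sup>k\<^sup>-\<^sup>1 U(\<xi>)\<close>, \<open>c = t\<^sup>k\<^sup>-\<^sup>1 S(\<xi>)\<close> with \<open>\<xi> = x / t\<^sup>k\<close>; unlike \<open>V\<close> and \<open>C\<close>, the
  profiles \<open>U\<close> and \<open>S\<close> are regular at \<open>\<xi> = 0\<close>.  Their Riemann invariants \<open>P = U + l S\<close> and
  \<open>Q = U - l S\<close> satisfy the diagonal system
    \<open>(U + S - k \<xi>) P' = - (k - 1) P\<close>,  \<open>(U - S - k \<xi>) Q' = - (k - 1) Q\<close>,
  and the initial data prescribe the ratio of \<open>P\<close> and \<open>Q\<close> at \<open>\<xi> = \<infinity>\<close>.

  The system becomes linear in the hodograph plane.  Take the ratio \<open>r\<close> of the two invariants as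
  parameter (the one of larger modulus in the denominator, so \<open>r < 1\<close>), and write the modulus of
  that larger one as \<open>T(r)\<^sup>-\<^sup>(\<^sup>k\<^sup>-\<^sup>1\<^sup>)\<close>.  Then \<open>T\<close> solves a hypergeometric equation, which is used as the
  first order system
    \<open>r T' = N + (n - 1) T\<close>,  \<open>(1 - r) N' = M (N + T')\<close>,  \<open>M = (l + 1) / 2\<close>,
  and \<open>\<xi>\<close> is an explicit expression in \<open>T\<close> and \<open>N\<close> (\<open>hodograph_param\<close>).  In these terms the initial
  data sit at a zero of \<open>T\<close>, the vacuum at \<open>r = 1\<close>, and \<open>d\<xi>/dr\<close> is a multiple of \<open>N T'\<close>: one
  characteristic speed equals \<open>k \<xi>\<close> where \<open>T'\<close> vanishes, the other where \<open>N\<close> vanishes.  So the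
  qualitative behaviour of the flow is read off from the signs of \<open>T'\<close> and \<open>N\<close>.  One positive
  solution \<open>regT\<close>, an Euler integral, is regular at the vacuum; a truncated integral \<open>truncT\<close> serves
  for \<open>r < 0\<close>; and reduction of order gives the solution with a prescribed zero \<open>r\<^sub>0\<close>.

  For \<open>Ma > l\<close> the parameter \<open>r = Q / P\<close> runs from \<open>r\<^sub>0 > 0\<close> up to \<open>1\<close> along a solution that grows
  like \<open>(1 - r)\<^sup>-\<^sup>l\<close>; hence \<open>\<xi>\<close> and \<open>S\<close> tend to \<open>0\<close> together and \<open>S\<close> decays with exponent
  \<open>1 + 1 / ((k - 1) l)\<close> (\<open>expansion_wave\<close>).  For \<open>Ma = \<plusminus>l\<close> one invariant vanishes and the wave is
  elementary (\<open>simple_wave_right\<close>, \<open>simple_wave_left\<close>).  For \<open>- l < Ma < l\<close> the parameter \<open>r = P / Q\<close>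
  increases from \<open>r\<^sub>0 < 0\<close> to \<open>0\<close> (\<open>rarefaction_wave\<close>).  There \<open>P\<close> vanishes and, at the same point, the
  fast characteristic speed equals \<open>k \<xi>\<close>, whichever wave one came along; so the wave of \<open>regT\<close> on
  \<open>0 < r < 1\<close> can be attached continuously (\<open>vacuum_wave\<close>).  As \<open>r\<close> tends to \<open>1\<close> it has
  \<open>\<xi> - \<xi>\<^sub>v \<sim> (1 - r)\<^sup>2\<close> and \<open>S \<sim> 1 - r\<close>, which is the physical singularity.

  For \<open>Ma < - l\<close> the parameter \<open>r = P / Q\<close> starts at \<open>r\<^sub>0\<close> in \<open>(0, 1)\<close> and decreases, and \<open>T'\<close> vanishes
  before \<open>r\<close> reaches \<open>0\<close>: the wave would break there.  Consider all 2-shocks whose right state lies on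
  the wave to the right of the breaking point.  At the breaking point the shock has strength zero and
  its left state lies on one side of the vacuum wave; when the shock approaches \<open>\<xi> = 0\<close> its left
  state has crossed to the other side.  The intermediate value theorem selects a shock whose left
  state is on the vacuum wave (\<open>shock_onto_vacuum_wave\<close>, \<open>compression_wave\<close>).
\<close>

section \<open>Beta integrals with a parameter\<close>

text \<open>
  Euler's integral for the hypergeometric function, without its normalising constant and with the
  exponents themselves as parameters.
\<close>
definition beta_kernel :: "real \<Rightarrow> real \<Rightarrow> real \<Rightarrow> real \<Rightarrow> real" where
  "beta_kernel a b e v = integral {0..1} (\<lambda>s. s powr a * (1 - s) powr b * (1 - v * s) powr e)"

lemma one_minus_mult_pos:
  fixes v s :: real
  assumes "v < 1" "0 \<le> s" "s \<le> 1"
  shows "1 - v * s > 0"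
proof (cases "v \<le> 0")
  case True
  have "v * s \<le> 0" using True assms by (simp add: mult_nonpos_nonneg)
  then show ?thesis by simp
next
  case False
  have "v * s \<le> v * 1" using False assms by (intro mult_left_mono) auto
  then show ?thesis using assms by simp
qed

lemma continuous_on_powr_const:
  fixes f :: "'a::topological_space \<Rightarrow> real"
  assumes "continuous_on S f" "\<And>x. x \<in> S \<Longrightarrow> f x \<ge> 0 \<and> (f x = 0 \<longrightarrow> e > 0)"
  shows "continuous_on S (\<lambda>x. f x powr e)"
  using assms by (intro continuous_on_powr' continuous_on_const) auto

lemma beta_kernel_continuous_integrand:
  fixes a b e :: real
  assumes "a > 0" "b > 0"
  shows "continuous_on ({..<1} \<times> {0..1}) (\<lambda>(v, s). s powr a * (1 - s) powr b * (1 - v * s) powr e)"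
proof -
  have pp: "1 - v * s \<ge> 0 \<and> (1 - v * s = 0 \<longrightarrow> e > 0)" if "0 \<le> s" "s \<le> 1" "v < 1" for s v :: real
    using one_minus_mult_pos[of v s] that by auto
  show ?thesis
    unfolding case_prod_unfold
    by (intro continuous_on_mult continuous_on_powr_const continuous_on_diff continuous_on_const
          continuous_on_fst continuous_on_snd continuous_on_id) (use assms pp in auto)
qed

lemma beta_kernel_section_continuous:
  fixes a b v e :: real
  assumes "a > 0" "b > 0" "v < 1"
  shows "continuous_on {0..1} (\<lambda>s. s powr a * (1 - s) powr b * (1 - v * s) powr e)"
proof -
  have pp: "1 - v * s \<ge> 0 \<and> (1 - v * s = 0 \<longrightarrow> e > 0)" if "0 \<le> s" "s \<le> 1" for s :: real
    using one_minus_mult_pos[of v s] that assms by auto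
  show ?thesis
    by (intro continuous_on_mult continuous_on_powr_const continuous_on_diff continuous_on_const
          continuous_on_id) (use assms pp in auto)
qed

lemma beta_kernel_integrable:
  fixes a b v e :: real
  assumes "a > 0" "b > 0" "v < 1"
  shows "(\<lambda>s. s powr a * (1 - s) powr b * (1 - v * s) powr e) integrable_on {0..1}"
  by (intro integrable_continuous_real beta_kernel_section_continuous assms)

lemma beta_kernel_deriv:
  assumes "a > 0" "b > 0" "v < 1"
  shows "(beta_kernel a b e has_real_derivative - e * beta_kernel (a + 1) b (e - 1) v) (at v)"
proof -
  let ?f = "\<lambda>v s. s powr a * (1 - s) powr b * (1 - v * s) powr e"
  let ?fx = "\<lambda>v s. - e * (s powr (a + 1) * (1 - s) powr b * (1 - v * s) powr (e - 1))"
  have "((\<lambda>v. integral (cbox 0 1) (?f v)) has_real_derivative integral (cbox 0 1) (?fx v))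
      (at v within {..<1})"
  proof (rule leibniz_rule_field_derivative)
    show "((\<lambda>x. ?f x t) has_real_derivative ?fx x t) (at x within {..<1})"
      if "x \<in> {..<1}" "t \<in> cbox 0 1" for x t
    proof -
      have p: "1 - x * t > 0" using that one_minus_mult_pos[of x t] by auto
      have "((\<lambda>x. (1 - x * t) powr e) has_real_derivative e * (1 - x * t) powr (e - 1) * (- t))
          (at x within {..<1})"
        using p by (auto intro!: derivative_eq_intros simp: powr_diff)
      then have "((\<lambda>x. ?f x t) has_real_derivative
          t powr a * (1 - t) powr b * (e * (1 - x * t) powr (e - 1) * (- t))) (at x within {..<1})"
        by (intro DERIV_cmult)
      moreover have "t powr (a + 1) = t powr a * t"
        using that assms by (cases "t = 0") (auto simp: powr_add)
      ultimately show ?thesis by (simp add: algebra_simps)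
    qed
    show "?f x integrable_on cbox 0 1" if "x \<in> {..<1}" for x
      using beta_kernel_integrable[OF assms(1,2), of x e] that by simp
    have "continuous_on ({..<1} \<times> {0..1})
        (\<lambda>p. - e * (case p of (v, s) \<Rightarrow> s powr (a + 1) * (1 - s) powr b * (1 - v * s) powr (e - 1)))"
      by (intro continuous_intros beta_kernel_continuous_integrand) (use assms in auto)
    then show "continuous_on ({..<1} \<times> cbox 0 1) (\<lambda>(v, s). ?fx v s)"
      by (simp add: case_prod_unfold)
    show "v \<in> {..<1}" using assms by simp
  qed simp
  moreover have "at v within {..<1} = at v"
    using assms by (intro at_within_open) auto
  moreover have "integral (cbox 0 1) (?fx v) = - e * beta_kernel (a + 1) b (e - 1) v"
    unfolding beta_kernel_def
    by (simp only: integral_mult_right cbox_interval)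
  ultimately show ?thesis unfolding beta_kernel_def by simp
qed

text \<open>
  The left-hand side integrates the derivative of \<open>s\<^sup>a\<^sup>+\<^sup>1 (1 - s)\<^sup>b\<^sup>+\<^sup>1 (1 - v s)\<^sup>e\<close>.  Together with the two
  splitting rules below this contains every differential equation for the integrals.
\<close>
lemma beta_kernel_by_parts:
  assumes "a > 0" "b > 0" "v < 1"
  shows "(a + 1) * beta_kernel a (b + 1) e v - (b + 1) * beta_kernel (a + 1) b e v
      - e * v * beta_kernel (a + 1) (b + 1) (e - 1) v = 0"
proof -
  let ?g = "\<lambda>a b e s. s powr a * (1 - s) powr b * (1 - v * s) powr e"
  let ?h = "\<lambda>s. (a + 1) * ?g a (b + 1) e s - (b + 1) * ?g (a + 1) b e s - e * v * ?g (a + 1) (b + 1)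
      (e - 1) s"
  have 1: "(?h has_integral (?g (a + 1) (b + 1) e 1 - ?g (a + 1) (b + 1) e 0)) {0..1}"
  proof (rule fundamental_theorem_of_calculus_interior)
    show "continuous_on {0..1} (?g (a + 1) (b + 1) e)"
      by (rule beta_kernel_section_continuous) (use assms in auto)
    show "(?g (a + 1) (b + 1) e has_vector_derivative ?h s) (at s)" if "s \<in> {0<..<1}" for s
    proof -
      have p: "1 - v * s > 0" using that one_minus_mult_pos[of v s] assms by auto
      have "(?g (a + 1) (b + 1) e has_real_derivative ?h s) (at s)"
      proof -
        define A B E where "A = s powr a" and "B = (1 - s) powr b" and "E = (1 - v * s) powr (e - 1)"
        have e: "s powr a = A" "s powr (a + 1) = A * s" "(1 - s) powr b = B" "(1 - s) powr (b + 1) =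
            B * (1 - s)"
          "(1 - v * s) powr (e - 1) = E" "(1 - v * s) powr e = E * (1 - v * s)"
          using that p by (auto simp: A_def B_def E_def powr_add powr_diff)
        have d1: "((\<lambda>s. s powr (a + 1)) has_real_derivative (a + 1) * A) (at s)"
          using that by (auto intro!: derivative_eq_intros simp: A_def)
        have d2: "((\<lambda>s. (1 - s) powr (b + 1)) has_real_derivative - (b + 1) * B) (at s)"
          using that by (auto intro!: derivative_eq_intros simp: B_def algebra_simps)
        have d3: "((\<lambda>s. (1 - v * s) powr e) has_real_derivative - e * v * E) (at s)"
          using that p by (auto intro!: derivative_eq_intros simp: E_def powr_diff)
        have "(?g (a + 1) (b + 1) e has_real_derivative
            ((a + 1) * A * (B * (1 - s)) + (- (b + 1) * B) * (A * s)) * (E * (1 - v * s))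
            + (- e * v * E) * (A * s * (B * (1 - s)))) (at s)"
          using DERIV_mult[OF DERIV_mult[OF d1 d2] d3] unfolding e .
        then show ?thesis by (simp only: e) (simp add: algebra_simps)
      qed
      then show ?thesis by (simp add: has_real_derivative_iff_has_vector_derivative)
    qed
  qed simp
  have 2: "(?h has_integral ((a + 1) * beta_kernel a (b + 1) e v - (b + 1) * beta_kernel (a + 1) b e v
      - e * v * beta_kernel (a + 1) (b + 1) (e - 1) v)) {0..1}"
    unfolding beta_kernel_def
    by (intro has_integral_diff has_integral_mult_right integrable_integral beta_kernel_integrable)
       (use assms in auto)
  show ?thesis using has_integral_unique[OF 2 1] assms by simp
qed

lemma beta_kernel_split_right:
  assumes "a > 0" "b > 0" "v < 1"
  shows "beta_kernel a (b + 1) e v = beta_kernel a b e v - beta_kernel (a + 1) b e v"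
proof -
  have "beta_kernel a b e v - beta_kernel (a + 1) b e v =
      integral {0..1} (\<lambda>s. s powr a * (1 - s) powr b * (1 - v * s) powr e
        - s powr (a + 1) * (1 - s) powr b * (1 - v * s) powr e)"
    unfolding beta_kernel_def
    by (intro integral_diff[symmetric] beta_kernel_integrable) (use assms in auto)
  also have "\<dots> = beta_kernel a (b + 1) e v"
    unfolding beta_kernel_def
  proof (intro integral_cong)
    fix s :: real assume s: "s \<in> {0..1}"
    have "(1 - s) powr (b + 1) = (1 - s) powr b * (1 - s)" "s powr (a + 1) = s powr a * s"
      using s assms by (auto simp: powr_add)
    then show "s powr a * (1 - s) powr b * (1 - v * s) powr e - s powr (a + 1) * (1 - s)
        powr b * (1 - v * s) powr e
        = s powr a * (1 - s) powr (b + 1) * (1 - v * s) powr e"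
      by (simp only:) (simp add: field_simps)
  qed
  finally show ?thesis by simp
qed

lemma beta_kernel_split_third:
  assumes "a > 0" "b > 0" "v < 1"
  shows "beta_kernel a b (e + 1) v = beta_kernel a b e v - v * beta_kernel (a + 1) b e v"
proof -
  have "beta_kernel a b e v - v * beta_kernel (a + 1) b e v =
      integral {0..1} (\<lambda>s. s powr a * (1 - s) powr b * (1 - v * s) powr e
        - v * (s powr (a + 1) * (1 - s) powr b * (1 - v * s) powr e))"
    unfolding beta_kernel_def integral_mult_right[symmetric]
    by (intro integral_diff[symmetric] integrable_on_mult_right beta_kernel_integrable)
        (use assms in auto)
  also have "\<dots> = beta_kernel a b (e + 1) v"
    unfolding beta_kernel_def
  proof (intro integral_cong)
    fix s :: real assume s: "s \<in> {0..1}"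
    have "1 - v * s > 0" using s one_minus_mult_pos[of v s] assms by auto
    then have "(1 - v * s) powr (e + 1) = (1 - v * s) powr e * (1 - v * s)" "s powr (a + 1) =
        s powr a * s"
      using s assms by (auto simp: powr_add)
    then show "s powr a * (1 - s) powr b * (1 - v * s) powr e - v * (s powr (a + 1) * (1 - s)
        powr b * (1 - v * s) powr e)
        = s powr a * (1 - s) powr b * (1 - v * s) powr (e + 1)"
      by (simp only:) (simp add: field_simps)
  qed
  finally show ?thesis by simp
qed

lemma beta_kernel_continuous:
  assumes "a > 0" "b > 0" "e > 0"
  shows "continuous_on {..1} (beta_kernel a b e)"
proof -
  have ge: "v * s \<le> 1" if "v \<le> 1" "0 \<le> s" "s \<le> 1" for v s :: real
  proof -
    have "v * s \<le> 1 * s" using that by (intro mult_right_mono) auto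
    then show ?thesis using that by simp
  qed
  have "continuous_on {..1} (\<lambda>v. integral (cbox 0 1) (\<lambda>s. s powr a * (1 - s) powr b * (1 - v * s)
      powr e))"
  proof (rule integral_continuous_on_param)
    show "continuous_on ({..1} \<times> cbox 0 1) (\<lambda>(v, s). s powr a * (1 - s) powr b * (1 - v * s) powr e)"
      unfolding case_prod_unfold
      by (intro continuous_on_mult continuous_on_powr_const continuous_on_diff continuous_on_const
        continuous_on_fst continuous_on_snd continuous_on_id) (use assms ge in auto)
  qed
  then show ?thesis unfolding beta_kernel_def by simp
qed

lemma beta_kernel_pos:
  assumes "a > 0" "b > 0" "v < 1 \<or> v = 1 \<and> e > 0"
  shows "beta_kernel a b e v > 0"
proof -
  let ?g = "\<lambda>s. s powr a * (1 - s) powr b * (1 - v * s) powr e"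
  have pp: "1 - v * s \<ge> 0 \<and> (1 - v * s = 0 \<longrightarrow> e > 0)" if "0 \<le> s" "s \<le> 1" for s :: real
    using that assms(3) one_minus_mult_pos[of v s] by force
  have p: "1 - v * s > 0" if "0 \<le> s" "s < 1" for s :: real
    using that assms(3) one_minus_mult_pos[of v s] by force
  have c: "continuous_on {0..1} ?g"
    by (intro continuous_on_mult continuous_on_powr_const continuous_on_diff continuous_on_const
        continuous_on_id) (use assms pp in auto)
  have "integral {0..1} ?g > 0"
  proof (rule ccontr)
    assume n: "\<not> integral {0..1} ?g > 0"
    moreover have "integral {0..1} ?g \<ge> 0"
      by (intro integral_nonneg integrable_continuous_real c) auto
    ultimately have "integral {0..1} ?g = 0" by simp
    then have "(?g has_integral 0) (cbox 0 1)"
      using integrable_integral[OF integrable_continuous_real[OF c]] by simp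
    then have "?g (1/2) = 0"
      using has_integral_0_cbox_imp_0[of 0 1 ?g "1/2"] c by auto
    then show False using p[of "1/2"] by auto
  qed
  then show ?thesis unfolding beta_kernel_def by simp
qed

text \<open>
  For \<open>v\<close> near \<open>1\<close> the last factor is singular when \<open>e < 1\<close>, but never smaller than \<open>1 - v\<close>; this
  crude estimate is all that is needed for the behaviour of the derivatives at \<open>r = 0\<close>.
\<close>
lemma beta_kernel_weighted_bound:
  assumes "a > 0" "b > 0" "0 \<le> v" "v < 1"
  shows "(1 - v) * beta_kernel a b (e - 1) v \<le> (1 - v) + (1 - v) powr e"
proof -
  let ?g = "\<lambda>s. s powr a * (1 - s) powr b * (1 - v * s) powr (e - 1)"
  have "beta_kernel a b (e - 1) v \<le> integral {0..1} (\<lambda>s::real. 1 + (1 - v) powr (e - 1))"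
    unfolding beta_kernel_def
  proof (rule integral_le)
    show "?g integrable_on {0..1}" by (rule beta_kernel_integrable) (use assms in auto)
    fix s :: real assume s: "s \<in> {0..1}"
    have p: "1 - v * s \<ge> 1 - v" "1 - v * s > 0" "1 - v * s \<le> 1"
      using s assms one_minus_mult_pos[of v s] mult_left_mono[of s 1 v] by auto
    have "(1 - v * s) powr (e - 1) \<le> 1 + (1 - v) powr (e - 1)"
    proof (cases "e \<ge> 1")
      case True
      then have "(1 - v * s) powr (e - 1) \<le> 1 powr (e - 1)" using p by (intro powr_mono2) auto
      then show ?thesis by (simp add: add_increasing2)
    next
      case False
      then have "(1 - v * s) powr (e - 1) \<le> (1 - v) powr (e - 1)"
        using p assms by (intro powr_mono2') auto
      then show ?thesis by simp
    qed
    moreover have "s powr a * (1 - s) powr b \<le> 1 * 1"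
      using s assms by (intro mult_mono powr_le1) auto
    ultimately have "?g s \<le> 1 * (1 + (1 - v) powr (e - 1))"
      by (intro mult_mono) auto
    then show "?g s \<le> 1 + (1 - v) powr (e - 1)" by simp
  qed auto
  also have "\<dots> = 1 + (1 - v) powr (e - 1)" by simp
  finally have "(1 - v) * beta_kernel a b (e - 1) v \<le> (1 - v) * (1 + (1 - v) powr (e - 1))"
    using assms by (intro mult_left_mono) auto
  also have "\<dots> = (1 - v) + (1 - v) powr e"
    using assms by (simp add: powr_diff field_simps)
  finally show ?thesis .
qed

lemma beta_kernel_weighted_tendsto:
  assumes "a > 0" "b > 0" "e > 0"
  shows "((\<lambda>v. (1 - v) * beta_kernel a b (e - 1) v) \<longlongrightarrow> 0) (at_left 1)"
proof (rule tendsto_sandwich)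
  have ev: "eventually (\<lambda>v::real. v \<in> {0<..<1}) (at_left 1)"
    by (rule eventually_at_leftI[of 0]) auto
  show "eventually (\<lambda>v. 0 \<le> (1 - v) * beta_kernel a b (e - 1) v) (at_left 1)"
    using ev
  proof eventually_elim
    case (elim v)
    then have "beta_kernel a b (e - 1) v > 0" using assms by (intro beta_kernel_pos) auto
    then show ?case using elim by simp
  qed
  show "eventually (\<lambda>v. (1 - v) * beta_kernel a b (e - 1) v \<le> (1 - v) + (1 - v) powr e) (at_left 1)"
    using ev
  proof eventually_elim
    case (elim v)
    then show ?case using beta_kernel_weighted_bound[OF assms(1,2), of v e] by simp
  qed
  have "((\<lambda>v::real. (1 - v) + (1 - v) powr e) \<longlongrightarrow> (1 - 1) + (1 - 1) powr e) (at_left 1)"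
  proof (intro tendsto_add tendsto_diff tendsto_const tendsto_ident_at tendsto_powr')
    show "1 - 1 \<noteq> (0::real) \<or> 0 < e \<and> (\<forall>\<^sub>F v in at_left 1. 0 \<le> 1 - (v::real))"
      using assms ev by (auto elim: eventually_mono)
  qed
  then show "((\<lambda>v::real. (1 - v) + (1 - v) powr e) \<longlongrightarrow> 0) (at_left 1)" using assms by simp
qed auto

section \<open>The hodograph equation\<close>

text \<open>
  The exponents of the problem.  The relation between \<open>n\<close> and \<open>k\<close> is \<open>1 / n + 1 / k = 1\<close>, cleared of
  denominators.
\<close>
locale self_similar_exponents =
  fixes l n k :: real
  assumes l_gt_1: "l > 1" and n_gt_1: "n > 1" and k_gt_1: "k > 1" and conj_exp: "(k - 1) * (n - 1) = 1"
begin

definition M :: real where "M = (l + 1) / 2"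

lemma M_gt_1: "M > 1"
  using l_gt_1 by (simp add: M_def)

text \<open>
  Eliminating \<open>N\<close> gives the hypergeometric equation with parameters \<open>M\<close>, \<open>1 - n\<close> and \<open>2 - n - M\<close>,
  whose singular points are \<open>0\<close>, \<open>1\<close> and \<open>\<infinity>\<close>.  The derivative \<open>T1\<close> of \<open>T\<close> and the function \<open>N\<close> are kept
  as separate arguments because their zeros are the sonic points of the flow.
\<close>
definition hodograph_sol :: "real set \<Rightarrow> (real \<Rightarrow> real) \<Rightarrow> (real \<Rightarrow> real) \<Rightarrow> (real \<Rightarrow> real) \<Rightarrow> bool" where
  "hodograph_sol J T T1 N \<longleftrightarrow> (\<forall>r\<in>J.
     (T has_real_derivative T1 r) (at r) \<and>
     (N has_real_derivative M * (N r + T1 r) / (1 - r)) (at r) \<and>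
     r * T1 r = N r + (n - 1) * T r)"

text \<open>The Wronskian of two solutions of the hodograph equation, up to a constant factor.\<close>
definition wronskian :: "real \<Rightarrow> real" where
  "wronskian r = \<bar>r\<bar> powr (n + M - 2) * (1 - r) powr (- 2 * M)"

lemma wronskian_pos: "r < 1 \<Longrightarrow> r \<noteq> 0 \<Longrightarrow> wronskian r > 0"
  by (simp add: wronskian_def)

lemma abs_powr_deriv:
  fixes r e :: real
  assumes "r \<noteq> 0"
  shows "((\<lambda>r. \<bar>r\<bar> powr e) has_real_derivative \<bar>r\<bar> powr e * (e / r)) (at r)"
proof (cases "r > 0")
  case True
  have "((\<lambda>r. r powr e) has_real_derivative r powr e * (e / r)) (at r)"
    using True by (auto intro!: derivative_eq_intros simp: powr_diff field_simps)
  then show ?thesis using True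
    by (rule_tac has_field_derivative_transform_within_open[where S="{0<..}" and f="\<lambda>r. r powr e"]) auto
next
  case False
  then have r: "r < 0" using assms by simp
  have "((\<lambda>r. (- r) powr e) has_real_derivative (- r) powr e * (e / r)) (at r)"
    using r by (auto intro!: derivative_eq_intros simp: powr_diff field_simps)
  then show ?thesis using r
    by (rule_tac has_field_derivative_transform_within_open[where S="{..<0}" and f="\<lambda>r. (- r)
        powr e"]) auto
qed

lemma wronskian_deriv:
  assumes "r < 1" "r \<noteq> 0"
  shows "(wronskian has_real_derivative wronskian r * ((n + M - 2) / r + 2 * M / (1 - r))) (at r)"
proof -
  note a = abs_powr_deriv[OF assms(2), of "n + M - 2"]
  have b: "((\<lambda>r. (1 - r) powr (- 2 * M)) has_real_derivative (1 - r) powr (- 2 * M)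
      * (2 * M / (1 - r))) (at r)"
    using assms by (auto intro!: derivative_eq_intros simp: powr_diff powr_minus field_simps)
  show ?thesis
    unfolding wronskian_def using DERIV_mult[OF a b] by (simp add: algebra_simps)
qed

text \<open>
  If \<open>H\<close> vanishes at \<open>r\<^sub>0\<close>, the new solution is the one with a zero at \<open>r\<^sub>0\<close>, and it has the sign of
  \<open>H\<close>, hence of \<open>r - r\<^sub>0\<close>.
\<close>
lemma hodograph_reduction_of_order:
  assumes J: "\<And>r. r \<in> J \<Longrightarrow> r < 1 \<and> r \<noteq> 0" and sol: "hodograph_sol J T T1 N"
    and pos: "\<And>r. r \<in> J \<Longrightarrow> T r > 0"
    and dH: "\<And>r. r \<in> J \<Longrightarrow> (H has_real_derivative wronskian r / (T r)\<^sup>2) (at r)"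
  shows "hodograph_sol J (\<lambda>r. T r * H r) (\<lambda>r. T1 r * H r + wronskian r / T r)
       (\<lambda>r. N r * H r + r * wronskian r / T r)"
  unfolding hodograph_sol_def
proof (intro ballI conjI)
  fix r assume r: "r \<in> J"
  have d: "(T has_real_derivative T1 r) (at r)"
    "(N has_real_derivative M * (N r + T1 r) / (1 - r)) (at r)"
    and e: "r * T1 r = N r + (n - 1) * T r" using sol r unfolding hodograph_sol_def by blast+
  have nz: "T r > 0" "r < 1" "r \<noteq> 0" using pos J r by auto
  show "((\<lambda>r. T r * H r) has_real_derivative T1 r * H r + wronskian r / T r) (at r)"
    using DERIV_mult[OF d(1) dH[OF r]] nz by (simp add: field_simps power2_eq_square)
  show "r * (T1 r * H r + wronskian r / T r) = N r * H r + r * wronskian r / T r + (n - 1)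
      * (T r * H r)"
  proof -
    have N: "N r = r * T1 r - (n - 1) * T r" using e by simp
    show ?thesis unfolding N using nz by (simp add: field_simps)
  qed
  let ?w = "wronskian r" let ?w' = "wronskian r * ((n + M - 2) / r + 2 * M / (1 - r))"
  have "((\<lambda>r. N r * H r + r * wronskian r / T r) has_real_derivative
      (M * (N r + T1 r) / (1 - r) * H r + ?w / (T r)\<^sup>2 * N r)
      + ((1 * ?w + ?w' * r) * T r - r * ?w * T1 r) / (T r * T r)) (at r)"
    by (intro DERIV_add DERIV_mult DERIV_divide d dH r wronskian_deriv nz DERIV_ident)
       (use nz in auto)
  moreover have "(M * (N r + T1 r) / (1 - r) * H r + ?w / (T r)\<^sup>2 * N r)
      + ((1 * ?w + ?w' * r) * T r - r * ?w * T1 r) / (T r * T r)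
     = M * (N r * H r + r * ?w / T r + (T1 r * H r + ?w / T r)) / (1 - r)"
  proof -
    have N: "N r = r * T1 r - (n - 1) * T r" using e by simp
    have "?w / (T r)\<^sup>2 * N r + ((1 * ?w + ?w' * r) * T r - r * ?w * T1 r) / (T r * T r)
        = ?w / T r * (1 + (n + M - 2) + 2 * M * r / (1 - r) - (n - 1))"
      unfolding N using nz by (simp add: field_simps power2_eq_square)
    also have "\<dots> = M * (r * ?w / T r + ?w / T r) / (1 - r)"
      using nz by (simp add: field_simps)
    finally have "?w / (T r)\<^sup>2 * N r + ((1 * ?w + ?w' * r) * T r - r * ?w * T1 r) / (T r * T r)
        = M * (r * ?w / T r + ?w / T r) / (1 - r)" .
    moreover have "M * (N r * H r + r * ?w / T r + (T1 r * H r + ?w / T r)) / (1 - r)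
        = M * (N r + T1 r) / (1 - r) * H r + M * (r * ?w / T r + ?w / T r) / (1 - r)"
      by (simp add: algebra_simps add_divide_distrib)
    ultimately show ?thesis by linarith
  qed
  ultimately show "((\<lambda>r. N r * H r + r * wronskian r / T r) has_real_derivative
     M * (N r * H r + r * ?w / T r + (T1 r * H r + ?w / T r)) / (1 - r)) (at r)" by simp
qed

lemma hodograph_reduction_multiplier:
  assumes J: "J = {a<..<b}" and b: "b \<le> 1" "0 \<notin> J" and sol: "hodograph_sol J T T1 N"
    and pos: "\<And>r. r \<in> J \<Longrightarrow> T r > 0" and r0: "r0 \<in> J"
  shows "\<exists>H. H r0 = 0 \<and> (\<forall>r\<in>J. (H has_real_derivative wronskian r / (T r)\<^sup>2) (at r))"
proof -
  define H :: "real \<Rightarrow> real" where "H = (\<lambda>u. LBINT y=r0..u. wronskian y / (T y)\<^sup>2)"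
  have JI: "r < 1" "r \<noteq> 0" if "r \<in> J" for r using that J b by auto
  have dH: "(H has_real_derivative wronskian r / (T r)\<^sup>2) (at r)" if r: "r \<in> J" for r
  proof -
    define p q where "p = min ((a + r0) / 2) ((a + r) / 2)" and "q = max ((b + r0) / 2) ((b + r) / 2)"
    have pq: "p < r0" "p < r" "r0 < q" "r < q" "p > a" "q < b"
      using r r0 J by (auto simp: p_def q_def min_def max_def)
    have "(wronskian y / (T y)\<^sup>2) = wronskian y / (T y)\<^sup>2 \<and> isCont (\<lambda>y. wronskian y / (T y)\<^sup>2) y"
      if "y \<in> {p..q}" for y
    proof -
      have "y \<in> J" using that pq J by auto
      then have "isCont wronskian y" "isCont T y" "T y > 0"
        using wronskian_deriv[OF JI] sol pos DERIV_isCont unfolding hodograph_sol_def by blast+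
      then show ?thesis by (auto intro!: continuous_intros)
    qed
    then have c: "continuous_on {p..q} (\<lambda>y. wronskian y / (T y)\<^sup>2)"
      by (intro continuous_at_imp_continuous_on) auto
    have "(H has_vector_derivative wronskian r / (T r)\<^sup>2) (at r within {p..q})"
      unfolding H_def by (rule interval_integral_FTC2[OF _ _ c]) (use pq in auto)
    moreover have "at r within {p..q} = at r"
      using pq by (intro at_within_Icc_at) auto
    ultimately show ?thesis by (simp add: has_real_derivative_iff_has_vector_derivative)
  qed
  moreover have "H r0 = 0" unfolding H_def by simp
  ultimately show ?thesis by blast
qed

text \<open>
  The self-adjoint form of the equation.  Where \<open>T > 0\<close> it makes \<open>T'\<close> divided by the Wronskian
  increasing for \<open>r < 0\<close> and decreasing for \<open>0 < r < 1\<close>, which controls the sign of \<open>T'\<close>.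
\<close>
lemma hodograph_slope_over_wronskian:
  assumes J: "J = {a<..<b}" and b: "b \<le> 1" "0 \<notin> J" and sol: "hodograph_sol J T T1 N" and r: "r \<in> J"
  shows "((\<lambda>r. T1 r / wronskian r) has_real_derivative
     - M * (n - 1) * T r / (r * (1 - r) * wronskian r)) (at r)"
proof -
  have JI: "r < 1" "r \<noteq> 0" if "r \<in> J" for r using that J b by auto
  have d: "(T has_real_derivative T1 r) (at r)"
      "(N has_real_derivative M * (N r + T1 r) / (1 - r)) (at r)"
      and e: "r * T1 r = N r + (n - 1) * T r" using sol r unfolding hodograph_sol_def by blast+
  have nz: "r < 1" "r \<noteq> 0" "wronskian r > 0" using JI r wronskian_pos by auto
  let ?w = "wronskian r" let ?w' = "wronskian r * ((n + M - 2) / r + 2 * M / (1 - r))"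
  let ?d = "(M * (N r + T1 r) / (1 - r) + (n - 1) * T1 r)"
  have "((\<lambda>r. (N r + (n - 1) * T r) / r) has_real_derivative
      (?d * r - (N r + (n - 1) * T r) * 1) / (r * r)) (at r)"
    by (intro DERIV_add DERIV_divide d DERIV_ident DERIV_cmult) (use nz in auto)
  then have dT1: "(T1 has_real_derivative (?d * r - r * T1 r) / (r * r)) (at r)"
    unfolding e[symmetric]
    using r sol JI by (rule_tac has_field_derivative_transform_within_open[where S=J and f="\<lambda>r. (N r
        + (n - 1) * T r) / r"])
     (auto simp: J hodograph_sol_def field_simps)
  have D: "((\<lambda>r. T1 r / wronskian r) has_real_derivative
      ((?d * r - r * T1 r) / (r * r) * ?w - T1 r * ?w') / (?w * ?w)) (at r)"
    by (intro DERIV_divide dT1 wronskian_deriv) (use nz in auto)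
  have "((d * r - r * t) / (r * r) * w - t * (w * z)) / (w * w) = ((d - t) / r - t * z) / w"
    if "w > 0" for d t w z
    using nz that by (simp add: field_simps)
  from this[OF nz(3)] have q1: "((?d * r - r * T1 r) / (r * r) * ?w - T1 r * ?w') / (?w * ?w)
     = ((?d - T1 r) / r - T1 r * ((n + M - 2) / r + 2 * M / (1 - r))) / ?w" .
  have q2: "(?d - T1 r) / r - T1 r * ((n + M - 2) / r + 2 * M / (1 - r))
      = - M * (n - 1) * T r / (r * (1 - r))"
  proof -
    have N: "N r = r * T1 r - (n - 1) * T r" using e by simp
    show ?thesis unfolding N using nz by (simp add: divide_simps) (simp add: algebra_simps)?
  qed
  show ?thesis using D unfolding q1 q2 by (simp add: divide_divide_eq_left)
qed

text \<open>Propagates positivity of \<open>N\<close> along an interval on which \<open>T\<close> increases.\<close>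
lemma hodograph_N_weighted:
  assumes "hodograph_sol J T T1 N" "r \<in> J" "r < 1"
  shows "((\<lambda>r. (1 - r) powr M * N r) has_real_derivative M * (1 - r) powr (M - 1) * T1 r) (at r)"
proof -
  have d: "(N has_real_derivative M * (N r + T1 r) / (1 - r)) (at r)"
    using assms unfolding hodograph_sol_def by blast
  have "((\<lambda>r. (1 - r) powr M) has_real_derivative - M * (1 - r) powr (M - 1)) (at r)"
    using assms by (auto intro!: derivative_eq_intros)
  from DERIV_mult[OF this d] have "((\<lambda>r. (1 - r) powr M * N r) has_real_derivative
     - M * (1 - r) powr (M - 1) * N r + M * (N r + T1 r) / (1 - r) * (1 - r) powr M) (at r)" .
  moreover have p: "(1 - r) powr M = (1 - r) powr (M - 1) * (1 - r)" using assms by (simp add: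
      powr_diff)
  have "- M * (1 - r) powr (M - 1) * N r + M * (N r + T1 r) / (1 - r) * (1 - r) powr M
      = M * (1 - r) powr (M - 1) * T1 r"
    unfolding p using assms by (simp add: field_simps)
  ultimately show ?thesis by simp
qed

text \<open>
  The solution that is regular at the vacuum \<open>r = 1\<close>: the average of \<open>(1 - s + s r)\<^sup>n\<^sup>-\<^sup>1\<close> over the
  Beta distribution with both parameters equal to \<open>M\<close>.  This is the classical mean value formula for
  the Euler--Poisson--Darboux equation satisfied by the time in the hodograph plane.
\<close>
definition regT :: "real \<Rightarrow> real" where
  "regT r = beta_kernel (M - 1) (M - 1) (n - 1) (1 - r)"
definition regT1 :: "real \<Rightarrow> real" where
  "regT1 r = (n - 1) * beta_kernel M (M - 1) (n - 2) (1 - r)"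
definition regN :: "real \<Rightarrow> real" where
  "regN r = - (n - 1) * beta_kernel (M - 1) M (n - 2) (1 - r)"

lemma regT_sum: "r > 0 \<Longrightarrow> r * regT1 r = regN r + (n - 1) * regT r"
proof -
  assume r: "r > 0"
  have m: "M - 1 > 0" using M_gt_1 by simp
  have 1: "beta_kernel (M - 1) M (n - 2) (1 - r) = beta_kernel (M - 1) (M - 1) (n - 2) (1 - r)
      - beta_kernel M (M - 1) (n - 2) (1 - r)"
    using beta_kernel_split_right[OF m m, of "1 - r" "n - 2"] r by simp
  have 2: "beta_kernel (M - 1) (M - 1) (n - 1) (1 - r) = beta_kernel (M - 1) (M - 1) (n - 2) (1 - r)
      - (1 - r) * beta_kernel M (M - 1) (n - 2) (1 - r)"
    using beta_kernel_split_third[OF m m, of "1 - r" "n - 2"] r by simp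
  show ?thesis unfolding regT_def regT1_def regN_def 1 2 by (simp add: algebra_simps)
qed

lemma regT_deriv: "r > 0 \<Longrightarrow> (regT has_real_derivative regT1 r) (at r)"
proof -
  assume r: "r > 0"
  have "(beta_kernel (M - 1) (M - 1) (n - 1) has_real_derivative - (n - 1) * beta_kernel M (M - 1)
      (n - 2) (1 - r)) (at (1 - r))"
    using beta_kernel_deriv[of "M - 1" "M - 1" "1 - r" "n - 1"] M_gt_1 r by simp
  then have "((\<lambda>r. beta_kernel (M - 1) (M - 1) (n - 1) (1 - r)) has_real_derivative - (n - 1)
      * beta_kernel M (M - 1) (n - 2) (1 - r) * (- 1)) (at r)"
    by (rule DERIV_chain2) (auto intro!: derivative_eq_intros)
  then show ?thesis unfolding regT_def[abs_def] regT1_def by (simp add: algebra_simps)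
qed

lemma regN_deriv: "r > 0 \<Longrightarrow> (regN has_real_derivative - (n - 1) * (n - 2) * beta_kernel M M (n - 3)
    (1 - r)) (at r)"
proof -
  assume r: "r > 0"
  have "(beta_kernel (M - 1) M (n - 2) has_real_derivative - (n - 2) * beta_kernel M M (n - 3)
      (1 - r)) (at (1 - r))"
    using beta_kernel_deriv[of "M - 1" M "1 - r" "n - 2"] M_gt_1 r by simp
  then have "((\<lambda>r. beta_kernel (M - 1) M (n - 2) (1 - r)) has_real_derivative - (n - 2)
      * beta_kernel M M (n - 3) (1 - r) * (- 1)) (at r)"
    by (rule DERIV_chain2) (auto intro!: derivative_eq_intros)
  then have "((\<lambda>r. - (n - 1) * beta_kernel (M - 1) M (n - 2) (1 - r)) has_real_derivative
      - (n - 1) * (- (n - 2) * beta_kernel M M (n - 3) (1 - r) * (- 1))) (at r)"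
    by (rule DERIV_cmult)
  then show ?thesis unfolding regN_def[abs_def] by (simp add: algebra_simps)
qed

lemma regT_hodograph: "hodograph_sol {0<..<1} regT regT1 regN"
  unfolding hodograph_sol_def
proof (intro ballI conjI)
  fix r :: real assume r: "r \<in> {0<..<1}"
  show "(regT has_real_derivative regT1 r) (at r)" "r * regT1 r = regN r + (n - 1) * regT r"
    using regT_deriv regT_sum r by auto
  have "M * beta_kernel (M - 1) M (n - 2) (1 - r) - M * beta_kernel M (M - 1) (n - 2) (1 - r)
      - (n - 2) * (1 - r) * beta_kernel M M (n - 3) (1 - r) = 0"
    using beta_kernel_by_parts[of "M - 1" "M - 1" "1 - r" "n - 2"] M_gt_1 r by simp
  then have "(n - 1) * (M * beta_kernel (M - 1) M (n - 2) (1 - r) - M * beta_kernel M (M - 1)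
      (n - 2) (1 - r)
      - (n - 2) * (1 - r) * beta_kernel M M (n - 3) (1 - r)) = 0" by simp
  then have "- (n - 1) * (n - 2) * beta_kernel M M (n - 3) (1 - r) = M * (regN r + regT1 r) / (1 - r)"
    unfolding regT1_def regN_def using r by (simp add: field_simps)
  with regN_deriv[of r] r show "(regN has_real_derivative M * (regN r + regT1 r) / (1 - r)) (at r)"
      by simp
qed

lemma regT_pos: "r \<ge> 0 \<Longrightarrow> regT r > 0"
  unfolding regT_def using M_gt_1 n_gt_1 by (intro beta_kernel_pos) auto

lemma regT1_pos: "r > 0 \<Longrightarrow> regT1 r > 0"
  unfolding regT1_def using M_gt_1 n_gt_1 by (intro mult_pos_pos beta_kernel_pos) auto

lemma regN_neg: "r > 0 \<Longrightarrow> regN r < 0"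
  unfolding regN_def using M_gt_1 n_gt_1 by (auto intro!: mult_pos_pos beta_kernel_pos simp:
      mult_less_0_iff)

lemma regT_continuous: "continuous_on {0..} regT"
proof -
  have "continuous_on {0..} (\<lambda>r. beta_kernel (M - 1) (M - 1) (n - 1) (1 - r))"
    by (rule continuous_on_compose2[OF beta_kernel_continuous]) (use M_gt_1 n_gt_1 in \<open>auto intro!:
        continuous_intros\<close>)
  then show ?thesis by (simp add: regT_def[abs_def])
qed

lemma regT1_weighted_tendsto: "((\<lambda>r. r * regT1 r) \<longlongrightarrow> 0) (at_right 0)"
proof -
  have "((\<lambda>v. (1 - v) * beta_kernel M (M - 1) (n - 1 - 1) v) \<longlongrightarrow> 0) (at_left 1)"
    by (rule beta_kernel_weighted_tendsto) (use M_gt_1 n_gt_1 in auto)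
  moreover have "filterlim (\<lambda>r::real. 1 - r) (at_left 1) (at_right 0)"
    by (auto simp: filterlim_at eventually_at_right_field intro!: tendsto_eq_intros exI[of _ 1])
  ultimately have "((\<lambda>r. (1 - (1 - r)) * beta_kernel M (M - 1) (n - 1 - 1) (1 - r)) \<longlongrightarrow> 0) (at_right 0)"
    by (rule filterlim_compose)
  then have "((\<lambda>r. (n - 1) * (r * beta_kernel M (M - 1) (n - 2) (1 - r))) \<longlongrightarrow> (n - 1) * 0) (at_right 0)"
    by (intro tendsto_mult_left) simp
  then show ?thesis by (simp add: regT1_def mult.left_commute)
qed

lemma regT1_bounded_below: "\<exists>\<delta>>0. \<forall>r\<in>{0<..<1}. regT1 r \<ge> \<delta>"
proof -
  let ?\<delta> = "(n - 1) * beta_kernel M (M - 1 + n) 0 0"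
  have "regT1 r \<ge> ?\<delta>" if r: "r \<in> {0<..<1}" for r
  proof -
    have "beta_kernel M (M - 1 + n) 0 0 \<le> beta_kernel M (M - 1) (n - 2) (1 - r)"
      unfolding beta_kernel_def
    proof (rule integral_le)
      show "(\<lambda>s. s powr M * (1 - s) powr (M - 1 + n) * (1 - 0 * s) powr 0) integrable_on {0..1}"
        "(\<lambda>s. s powr M * (1 - s) powr (M - 1) * (1 - (1 - r) * s) powr (n - 2)) integrable_on {0..1}"
        by (rule beta_kernel_integrable; use M_gt_1 n_gt_1 r in simp)+
      fix s :: real assume s: "s \<in> {0..1}"
      have p: "1 - (1 - r) * s > 0" "1 - (1 - r) * s \<le> 1" "1 - (1 - r) * s \<ge> 1 - s"
        using r s one_minus_mult_pos[of "1 - r" s] mult_right_mono[of r 1 s] by (auto simp: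
            algebra_simps)
      have "(1 - s) powr n \<le> (1 - (1 - r) * s) powr n"
        using s p n_gt_1 by (intro powr_mono2) auto
      also have "\<dots> \<le> (1 - (1 - r) * s) powr (n - 2)"
        using p by (intro powr_mono') auto
      finally have "s powr M * (1 - s) powr (M - 1) * (1 - s) powr n
          \<le> s powr M * (1 - s) powr (M - 1) * (1 - (1 - r) * s) powr (n - 2)"
        by (intro mult_left_mono) auto
      then show "s powr M * (1 - s) powr (M - 1 + n) * (1 - 0 * s) powr 0
          \<le> s powr M * (1 - s) powr (M - 1) * (1 - (1 - r) * s) powr (n - 2)"
        by (simp add: powr_add mult.assoc)
    qed
    then show ?thesis unfolding regT1_def using n_gt_1 by (intro mult_left_mono) auto
  qed
  moreover have "?\<delta> > 0" using M_gt_1 n_gt_1 by (intro mult_pos_pos beta_kernel_pos) auto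
  ultimately show ?thesis by blast
qed

text \<open>
  For \<open>r < 0\<close> the integrand of \<open>regT\<close> changes sign inside the interval.  Keeping only the part on which
  \<open>1 - s + s r\<close> is positive again gives a solution.  The substitution that maps the remaining interval
  to \<open>[0, 1]\<close> turns it into \<open>v\<^sup>M\<close> times a Beta integral in the variable \<open>v = 1 / (1 - r)\<close>.
\<close>
definition truncK :: "real \<Rightarrow> real" where "truncK v = beta_kernel (M - 1) (n - 1) (M - 1) v"
definition truncK1 :: "real \<Rightarrow> real" where "truncK1 v = beta_kernel M (n - 1) (M - 2) v"
definition truncK2 :: "real \<Rightarrow> real" where "truncK2 v = beta_kernel (M + 1) (n - 1) (M - 3) v"

lemma truncK_deriv: "v < 1 \<Longrightarrow> (truncK has_real_derivative - (M - 1) * truncK1 v) (at v)"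
  using beta_kernel_deriv[of "M - 1" "n - 1" v "M - 1"] M_gt_1 n_gt_1
  unfolding truncK_def[abs_def] truncK1_def by simp

lemma truncK1_deriv: "v < 1 \<Longrightarrow> (truncK1 has_real_derivative - (M - 2) * truncK2 v) (at v)"
  using beta_kernel_deriv[of "M" "n - 1" v "M - 2"] M_gt_1 n_gt_1
  unfolding truncK1_def[abs_def] truncK2_def by simp

lemma truncK_ode: "v < 1 \<Longrightarrow> M * truncK v - (M + n - 2 * v) * truncK1 v + (M - 2) * v * (1 - v)
    * truncK2 v = 0"
proof -
  assume v: "v < 1"
  have p: "M - 1 > 0" "n - 1 > 0" "M > 0" using M_gt_1 n_gt_1 by auto
  have 1: "M * beta_kernel (M - 1) n (M - 2) v - n * truncK1 v - (M - 2)
      * v * beta_kernel M n (M - 3) v = 0"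
    using beta_kernel_by_parts[OF p(1,2) v, of "M - 2"] unfolding truncK1_def by simp
  have 2: "beta_kernel (M - 1) n (M - 2) v = beta_kernel (M - 1) (n - 1) (M - 2) v - truncK1 v"
    using beta_kernel_split_right[OF p(1,2) v, of "M - 2"] unfolding truncK1_def by simp
  have 3: "truncK v = beta_kernel (M - 1) (n - 1) (M - 2) v - v * truncK1 v"
    using beta_kernel_split_third[OF p(1,2) v, of "M - 2"] unfolding truncK1_def truncK_def by simp
  have 4: "beta_kernel M n (M - 3) v = beta_kernel M (n - 1) (M - 3) v - truncK2 v"
    using beta_kernel_split_right[OF p(3,2) v, of "M - 3"] unfolding truncK2_def by simp
  have 5: "truncK1 v = beta_kernel M (n - 1) (M - 3) v - v * truncK2 v"
    using beta_kernel_split_third[OF p(3,2) v, of "M - 3"] unfolding truncK1_def truncK2_def by simp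
  have 6: "beta_kernel (M - 1) n (M - 2) v = truncK v + v * truncK1 v - truncK1 v" using 2 3 by simp
  have 7: "beta_kernel M n (M - 3) v = truncK1 v + v * truncK2 v - truncK2 v" using 4 5 by simp
  show ?thesis using 1 unfolding 6 7 by (simp add: algebra_simps)
qed

definition truncT :: "real \<Rightarrow> real" where
  "truncT r = (1 / (1 - r)) powr M * truncK (1 / (1 - r))"
definition truncT1 :: "real \<Rightarrow> real" where
  "truncT1 r = (1 / (1 - r)) powr (M + 1) * (M * truncK (1 / (1 - r)) - (M - 1) * (1 / (1 - r))
      * truncK1 (1 / (1 - r)))"
definition truncN :: "real \<Rightarrow> real" where
  "truncN r = r * truncT1 r - (n - 1) * truncT r"

lemma truncT_hodograph: "hodograph_sol {..<0} truncT truncT1 truncN"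
  unfolding hodograph_sol_def
proof (intro ballI conjI)
  fix r :: real assume "r \<in> {..<0}"
  then have r: "r < 0" by simp
  define v where "v = 1 / (1 - r)"
  have v: "0 < v" "v < 1" "1 - r = 1 / v" using r by (auto simp: v_def field_simps)
  have rv: "r = 1 - 1 / v" using v by (simp add: field_simps)
  have dv: "((\<lambda>r. 1 / (1 - r)) has_real_derivative v\<^sup>2) (at r)"
    using r by (auto intro!: derivative_eq_intros simp: v_def power2_eq_square)
  let ?K = "truncK v" let ?K1 = "truncK1 v" let ?K2 = "truncK2 v"
  let ?p = "v powr (M - 1)"
  have pw: "v powr M = ?p * v" "v powr (M + 1) = ?p * v\<^sup>2" using v by (simp_all add:
      powr_diff powr_add power2_eq_square)
  have dp: "((\<lambda>v. v powr e) has_real_derivative e * v powr (e - 1)) (at v)" for e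
    using v by (auto intro!: derivative_eq_intros)
  have "((\<lambda>v. v powr M * truncK v) has_real_derivative
      M * ?p * ?K + - (M - 1) * ?K1 * v powr M) (at v)"
    by (rule DERIV_mult[OF dp truncK_deriv[OF v(2)]])
  then have "((\<lambda>v. v powr M * truncK v) has_real_derivative
      ?p * (M * ?K - (M - 1) * v * ?K1)) (at (1 / (1 - r)))"
    unfolding pw v_def[symmetric] by (simp add: algebra_simps)
  from DERIV_chain2[OF this dv] show dT: "(truncT has_real_derivative truncT1 r) (at r)"
    unfolding truncT_def[abs_def] truncT1_def v_def[symmetric] pw by (simp add: algebra_simps)
  show "r * truncT1 r = truncN r + (n - 1) * truncT r" by (simp add: truncN_def)
  define G where "G = (\<lambda>v. v powr (M + 1) * (M * truncK v - (M - 1) * v * truncK1 v))"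
  have "((\<lambda>v. M * truncK v - (M - 1) * v * truncK1 v) has_real_derivative
      M * (- (M - 1) * ?K1) - ((M - 1) * 1 * ?K1 + - (M - 2) * ?K2 * ((M - 1) * v))) (at v)"
    by (intro DERIV_diff DERIV_cmult truncK_deriv v DERIV_mult truncK1_deriv DERIV_ident)
  from DERIV_mult[OF dp[of "M + 1"] this]
  have "(G has_real_derivative (M + 1) * (?p * v) * (M * ?K - (M - 1) * v * ?K1)
      + (M * (- (M - 1) * ?K1) - ((M - 1) * 1 * ?K1 + - (M - 2) * ?K2 * ((M - 1) * v)))
          * (?p * v\<^sup>2)) (at (1 / (1 - r)))"
    unfolding G_def v_def[symmetric] pw[symmetric] by simp
  from DERIV_chain2[OF this dv]
  have dT1: "(truncT1 has_real_derivative ((M + 1) * (?p * v) * (M * ?K - (M - 1) * v * ?K1)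
      + (M * (- (M - 1) * ?K1) - ((M - 1) * 1 * ?K1 + - (M - 2) * ?K2 * ((M - 1) * v)))
          * (?p * v\<^sup>2)) * v\<^sup>2) (at r)" (is "(_ has_real_derivative ?D) _")
    unfolding truncT1_def[abs_def] G_def v_def[symmetric] by simp
  have "(truncN has_real_derivative (1 * truncT1 r + ?D * r) - (n - 1) * truncT1 r) (at r)"
    unfolding truncN_def[abs_def]
    by (intro DERIV_diff DERIV_cmult DERIV_mult dT dT1 DERIV_ident)
  moreover have "(1 * truncT1 r + ?D * r) - (n - 1) * truncT1 r = M * (truncN r + truncT1 r) / (1 - r)"
  proof -
    have T: "truncT r = ?p * v * ?K" "truncT1 r = ?p * v\<^sup>2 * (M * ?K - (M - 1) * v * ?K1)"
      unfolding truncT_def truncT1_def v_def[symmetric] pw by auto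
    have "(1 * truncT1 r + ?D * r) - (n - 1) * truncT1 r - M * (truncN r + truncT1 r) / (1 - r) =
       - ?p * v\<^sup>2 * v * (M - 1) * (M * ?K - (M + n - 2 * v) * ?K1 + (M - 2) * v * (1 - v) * ?K2)"
      unfolding truncN_def T v(3) unfolding rv using v
      by (simp add: field_simps power2_eq_square)
    then show ?thesis using truncK_ode[OF v(2)] by simp
  qed
  ultimately show "(truncN has_real_derivative M * (truncN r + truncT1 r) / (1 - r)) (at r)" by simp
qed

lemma truncT_pos: "r \<le> 0 \<Longrightarrow> truncT r > 0"
  unfolding truncT_def truncK_def using M_gt_1 n_gt_1 by (auto intro!: mult_pos_pos beta_kernel_pos)

lemma truncT_continuous: "continuous_on {..0} truncT"
proof -
  have "continuous_on {..0} (\<lambda>r. truncK (1 / (1 - r)))" unfolding truncK_def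
    by (rule continuous_on_compose2[OF beta_kernel_continuous]) (use M_gt_1 n_gt_1 in \<open>auto intro!:
        continuous_intros\<close>)
  then show ?thesis unfolding truncT_def[abs_def] by (auto intro!: continuous_intros)
qed

lemma truncT1_weighted_tendsto: "((\<lambda>r. r * truncT1 r) \<longlongrightarrow> 0) (at_left 0)"
proof -
  have f: "filterlim (\<lambda>r::real. 1 / (1 - r)) (at_left 1) (at_left 0)"
    by (auto simp: filterlim_at eventually_at_left_field field_simps intro!:
        tendsto_eq_intros exI[of _ "-1"])
  have "((\<lambda>v. (1 - v) * truncK1 v) \<longlongrightarrow> 0) (at_left 1)"
    unfolding truncK1_def using beta_kernel_weighted_tendsto[of M "n - 1" "M - 1"] M_gt_1 n_gt_1 by simp
  moreover have "(truncK \<longlongrightarrow> truncK 1) (at_left 1)"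
  proof -
    have "continuous_on {..1} truncK" unfolding truncK_def[abs_def]
      by (rule beta_kernel_continuous) (use M_gt_1 n_gt_1 in auto)
    then have "(truncK \<longlongrightarrow> truncK 1) (at 1 within {..1})" by (auto simp: continuous_on_def)
    then show ?thesis by (rule tendsto_within_subset) auto
  qed
  moreover have "((\<lambda>v::real. v) \<longlongrightarrow> 1) (at_left 1)" by (rule tendsto_ident_at)
  ultimately have "((\<lambda>v. - (v powr M * (M * (1 - v) * truncK v - (M - 1) * v * ((1 - v)
      * truncK1 v)))) \<longlongrightarrow>
     - (1 powr M * (M * (1 - 1) * truncK 1 - (M - 1) * 1 * 0))) (at_left 1)"
    by (intro tendsto_intros) auto
  then have "((\<lambda>v. - (v powr M * (M * (1 - v) * truncK v - (M - 1) * v * ((1 - v) * truncK1 v))))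
      \<longlongrightarrow> 0) (at_left 1)" by simp
  from filterlim_compose[OF this f] show ?thesis
  proof (rule Lim_transform_eventually)
    have "eventually (\<lambda>r::real. r \<in> {-1<..<0}) (at_left 0)" by (rule eventually_at_leftI[of "-1"]) auto
    then show "eventually (\<lambda>r. - ((1 / (1 - r)) powr M * (M * (1 - 1 / (1 - r))
        * truncK (1 / (1 - r)) - (M - 1) * (1 / (1 - r)) * ((1 - 1 / (1 - r))
        * truncK1 (1 / (1 - r))))) = r * truncT1 r) (at_left 0)"
    proof eventually_elim
      case (elim r)
      define v where "v = 1 / (1 - r)"
      have v: "0 < v" "r = - (1 - v) / v" using elim by (auto simp: v_def field_simps)
      show ?case unfolding truncT1_def v_def[symmetric] using v(1) by (simp add: v(2)
          powr_add field_simps)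
    qed
  qed
qed

end

section \<open>Parametrised characteristic curves\<close>

text \<open>
  \<open>\<iota>\<close> inverts the decreasing function \<open>X\<close>, whose limit at the right end \<open>s2\<close> is \<open>a\<close>.  Surjectivity
  is stated only up to values that \<open>X\<close> takes, so that nothing is said about the left end, where \<open>X\<close> may
  be bounded or not.
\<close>
definition param_inverse :: "real \<Rightarrow> real \<Rightarrow> (real \<Rightarrow> real) \<Rightarrow> real \<Rightarrow> (real \<Rightarrow> real) \<Rightarrow> bool" where
  "param_inverse s1 s2 X a \<iota> \<longleftrightarrow>
     (\<forall>s. s1 < s \<longrightarrow> s < s2 \<longrightarrow> a < X s \<and> \<iota> (X s) = s) \<and>
     (\<forall>s t. s1 < s \<longrightarrow> s < t \<longrightarrow> t < s2 \<longrightarrow> X t < X s) \<and>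
     (\<forall>s \<xi>. s1 < s \<longrightarrow> s < s2 \<longrightarrow> a < \<xi> \<longrightarrow> \<xi> \<le> X s \<longrightarrow>
        s1 < \<iota> \<xi> \<and> \<iota> \<xi> < s2 \<and> X (\<iota> \<xi>) = \<xi>) \<and>
     filterlim \<iota> (at_left s2) (at_right a)"

lemma decreasing_inverse:
  fixes X D :: "real \<Rightarrow> real"
  assumes s12: "s1 < s2" and d: "\<And>s. s1 < s \<Longrightarrow> s < s2 \<Longrightarrow> (X has_real_derivative D s) (at s)"
    and neg: "\<And>s. s1 < s \<Longrightarrow> s < s2 \<Longrightarrow> D s < 0"
    and lim: "(X \<longlongrightarrow> a) (at_left s2)"
  shows "\<exists>\<iota>. param_inverse s1 s2 X a \<iota> \<and>
    (\<forall>s. s1 < s \<longrightarrow> s < s2 \<longrightarrow> (\<iota> has_real_derivative inverse (D s)) (at (X s)))"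
proof -
  let ?I = "{s1<..<s2}"
  have dec: "X t < X s" if "s1 < s" "s < t" "t < s2" for s t
  proof (rule DERIV_neg_imp_decreasing[OF \<open>s < t\<close>])
    fix x assume "s \<le> x" "x \<le> t"
    then have "s1 < x" "x < s2" using that by auto
    then show "\<exists>y. (X has_real_derivative y) (at x) \<and> y < 0" using d neg by blast
  qed
  have inj: "inj_on X ?I"
  proof (rule inj_onI)
    fix x y assume "x \<in> ?I" "y \<in> ?I" "X x = X y"
    then show "x = y" using dec[of x y] dec[of y x] by (cases x y rule: linorder_cases) auto
  qed
  define \<iota> where "\<iota> = the_inv_into ?I X"
  have inv: "\<iota> (X s) = s" if "s1 < s" "s < s2" for s
    unfolding \<iota>_def by (rule the_inv_into_f_f[OF inj]) (use that in auto)
  have gt: "a < X s" if s: "s1 < s" "s < s2" for s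
  proof -
    define m where "m = (s + s2) / 2"
    have m: "s < m" "m < s2" using s by (auto simp: m_def)
    have "a \<le> X m"
    proof (rule tendsto_upperbound[OF lim])
      have "eventually (\<lambda>x. x \<in> {m<..<s2}) (at_left s2)" by (rule eventually_at_leftI[OF _ m(2)]) auto
      then show "eventually (\<lambda>x. X x \<le> X m) (at_left s2)"
      proof eventually_elim
        case (elim x)
        then show ?case using dec[of m x] m s by auto
      qed
    qed simp
    also have "X m < X s" using dec m s by auto
    finally show ?thesis .
  qed
  have surj: "\<exists>x. s \<le> x \<and> x < s2 \<and> X x = \<xi>" if s: "s1 < s" "s < s2" and \<xi>: "a < \<xi>" "\<xi> \<le> X s" for s \<xi>
  proof -
    have "eventually (\<lambda>x. X x < \<xi>) (at_left s2)" using lim \<xi>(1) by (rule order_tendstoD)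
    moreover have "eventually (\<lambda>x. x \<in> {s<..<s2}) (at_left s2)"
        by (rule eventually_at_leftI[OF _ s(2)]) auto
    ultimately have "eventually (\<lambda>x. X x < \<xi> \<and> x \<in> {s<..<s2}) (at_left s2)" by (rule eventually_conj)
    then obtain x where x: "X x < \<xi>" "s < x" "x < s2"
      using eventually_happens[of _ "at_left s2"] by auto
    have "\<exists>z\<ge>s. z \<le> x \<and> X z = \<xi>"
    proof (rule IVT2')
      show "continuous_on {s..x} X"
      proof (intro continuous_at_imp_continuous_on ballI)
        fix z assume "z \<in> {s..x}"
        then have "s1 < z" "z < s2" using x s by auto
        then show "isCont X z" using d DERIV_isCont by blast
      qed
    qed (use x \<xi> in auto)
    then show ?thesis using x by force
  qed
  have img: "s \<le> \<iota> \<xi> \<and> \<iota> \<xi> < s2 \<and> X (\<iota> \<xi>) = \<xi>"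
    if "s1 < s" "s < s2" "a < \<xi>" "\<xi> \<le> X s" for s \<xi>
  proof -
    obtain x where "s \<le> x" "x < s2" "X x = \<xi>" using surj[OF \<open>s1 < s\<close> \<open>s < s2\<close> \<open>a < \<xi>\<close> \<open>\<xi> \<le> X s\<close>] by
        blast
    then show ?thesis using inv[of x] that by auto
  qed
  have di: "(\<iota> has_real_derivative inverse (D s)) (at (X s))" if s: "s1 < s" "s < s2" for s
  proof -
    have "(\<iota> has_derivative (\<lambda>x. inverse (D s) * x)) (at (X s))"
    proof (rule has_derivative_inverse_strong[where S="?I" and f=X and x=s and f'="\<lambda>x. D s * x"])
      show "continuous_on ?I X"
      proof (intro continuous_at_imp_continuous_on ballI)
        fix z assume "z \<in> ?I"
        then show "isCont X z" using d[of z] DERIV_isCont by auto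
      qed
      show "(X has_derivative (*) (D s)) (at s)" using d s by (auto simp: has_field_derivative_def)
      show "(*) (D s) \<circ> (*) (inverse (D s)) = id" using neg[OF s] by auto
    qed (use s inv in auto)
    then show ?thesis by (simp add: has_field_derivative_def)
  qed
  have "filterlim \<iota> (at_left s2) (at_right a)"
    unfolding filterlim_at
  proof (intro conjI order_tendstoI)
    define m where "m = (s1 + s2) / 2"
    have m: "s1 < m" "m < s2" using s12 by (auto simp: m_def)
    have ev: "eventually (\<lambda>\<xi>. \<iota> \<xi> \<in> {s<..<s2}) (at_right a)" if s: "s1 < s" "s < s2" for s
    proof (rule eventually_at_rightI)
      show "a < X s" using gt s by auto
      show "\<iota> \<xi> \<in> {s<..<s2}" if "\<xi> \<in> {a<..<X s}" for \<xi>
        using img[OF s, of \<xi>] that by (cases "\<iota> \<xi> = s") auto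
    qed
    show "\<forall>\<^sub>F x in at_right a. \<iota> x \<in> {..<s2} \<and> \<iota> x \<noteq> s2"
      using ev[OF m] by eventually_elim auto
    show "\<forall>\<^sub>F x in at_right a. y < \<iota> x" if "y < s2" for y
    proof -
      have "eventually (\<lambda>\<xi>. \<iota> \<xi> \<in> {max y m<..<s2}) (at_right a)" by (rule ev) (use that m in auto)
      then show ?thesis by eventually_elim auto
    qed
    show "\<forall>\<^sub>F x in at_right a. \<iota> x < y" if "s2 < y" for y
      using ev[OF m] by eventually_elim (use that in auto)
  qed
  moreover have "s1 < \<iota> \<xi> \<and> \<iota> \<xi> < s2 \<and> X (\<iota> \<xi>) = \<xi>"
    if "s1 < s" "s < s2" "a < \<xi>" "\<xi> \<le> X s" for s \<xi>
    using img[OF that] that by auto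
  ultimately show ?thesis
    unfolding param_inverse_def using inv gt dec di by blast
qed

context self_similar_exponents
begin

text \<open>The weights that express the characteristic speeds \<open>U \<plusminus> S\<close> through the Riemann invariants.\<close>
definition alpha :: real where "alpha = (l + 1) / (2 * l)"
definition beta :: real where "beta = (l - 1) / (2 * l)"
definition fast :: "real \<Rightarrow> real \<Rightarrow> real" where "fast P Q = alpha * P + beta * Q"
definition slow :: "real \<Rightarrow> real \<Rightarrow> real" where "slow P Q = beta * P + alpha * Q"

text \<open>
  The diagonal system, solved for the derivatives.  The two inequations say that no point of \<open>I\<close> is
  sonic, and \<open>Q < P\<close> says that the sound speed is positive.
\<close>
definition char_wave :: "real set \<Rightarrow> (real \<Rightarrow> real) \<Rightarrow> (real \<Rightarrow> real) \<Rightarrow> bool" where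
  "char_wave I P Q \<longleftrightarrow> (\<forall>\<xi>\<in>I. Q \<xi> < P \<xi> \<and>
     fast (P \<xi>) (Q \<xi>) \<noteq> k * \<xi> \<and> slow (P \<xi>) (Q \<xi>) \<noteq> k * \<xi> \<and>
     (P has_real_derivative - (k - 1) * P \<xi> / (fast (P \<xi>) (Q \<xi>) - k * \<xi>)) (at \<xi>) \<and>
     (Q has_real_derivative - (k - 1) * Q \<xi> / (slow (P \<xi>) (Q \<xi>) - k * \<xi>)) (at \<xi>))"

text \<open>
  A solution of the same system given by a parameter instead of \<open>\<xi>\<close>.  The parameter decreases \<open>\<xi>\<close>:
  every wave is followed from the initial data at \<open>\<xi> = \<infinity>\<close> towards the vacuum.
\<close>
definition char_curve :: "real \<Rightarrow> real \<Rightarrow> (real \<Rightarrow> real) \<Rightarrow> (real \<Rightarrow> real) \<Rightarrow> (real \<Rightarrow> real) \<Rightarrow> bool" where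
  "char_curve s1 s2 X P Q \<longleftrightarrow> s1 < s2 \<and> (\<forall>s. s1 < s \<longrightarrow> s < s2 \<longrightarrow> Q s < P s \<and>
     fast (P s) (Q s) \<noteq> k * X s \<and> slow (P s) (Q s) \<noteq> k * X s \<and>
     (\<exists>dX dP dQ. dX < 0 \<and> (X has_real_derivative dX) (at s) \<and>
        (P has_real_derivative dP) (at s) \<and> (Q has_real_derivative dQ) (at s) \<and>
        (fast (P s) (Q s) - k * X s) * dP = - (k - 1) * P s * dX \<and>
        (slow (P s) (Q s) - k * X s) * dQ = - (k - 1) * Q s * dX))"

lemma char_curve_scale:
  assumes "char_curve s1 s2 X P Q" "h > 0"
  shows "char_curve s1 s2 (\<lambda>s. h * X s) (\<lambda>s. h * P s) (\<lambda>s. h * Q s)"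
  unfolding char_curve_def
proof (intro conjI allI impI)
  fix s assume s: "s1 < s" "s < s2"
  obtain dX dP dQ where d: "dX < 0" "(X has_real_derivative dX) (at s)"
    "(P has_real_derivative dP) (at s)" "(Q has_real_derivative dQ) (at s)"
    "(fast (P s) (Q s) - k * X s) * dP = - (k - 1) * P s * dX"
    "(slow (P s) (Q s) - k * X s) * dQ = - (k - 1) * Q s * dX" "Q s < P s"
    "fast (P s) (Q s) \<noteq> k * X s" "slow (P s) (Q s) \<noteq> k * X s"
    using assms s unfolding char_curve_def by blast
  have f: "fast (h * P s) (h * Q s) = h * fast (P s) (Q s)" "slow (h * P s) (h * Q s) =
      h * slow (P s) (Q s)"
    by (auto simp: fast_def slow_def algebra_simps)
  show "h * Q s < h * P s" "fast (h * P s) (h * Q s) \<noteq> k * (h * X s)" "slow (h * P s) (h * Q s)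
      \<noteq> k * (h * X s)"
    using d assms by (auto simp: f mult.left_commute)
  have e1: "(h * fast (P s) (Q s) - k * (h * X s)) * (h * dP) = h * h * ((fast (P s) (Q s)
      - k * X s) * dP)"
   and e2: "(h * slow (P s) (Q s) - k * (h * X s)) * (h * dQ) = h * h * ((slow (P s) (Q s)
       - k * X s) * dQ)"
    by (simp_all add: algebra_simps)
  show "\<exists>dX dP dQ. dX < 0 \<and> ((\<lambda>s. h * X s) has_real_derivative dX) (at s) \<and>
        ((\<lambda>s. h * P s) has_real_derivative dP) (at s) \<and> ((\<lambda>s. h * Q s) has_real_derivative dQ) (at s) \<and>
        (fast (h * P s) (h * Q s) - k * (h * X s)) * dP = - (k - 1) * (h * P s) * dX \<and>
        (slow (h * P s) (h * Q s) - k * (h * X s)) * dQ = - (k - 1) * (h * Q s) * dX"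
    by (intro exI[of _ "h * dX"] exI[of _ "h * dP"] exI[of _ "h * dQ"])
       (use d assms in \<open>auto intro!: DERIV_cmult simp: f e1 e2 mult_pos_neg\<close>)
qed (use assms in \<open>simp add: char_curve_def\<close>)

lemma char_curve_inverse:
  assumes curve: "char_curve s1 s2 X P Q" and lim: "(X \<longlongrightarrow> a) (at_left s2)"
  shows "\<exists>\<iota>. param_inverse s1 s2 X a \<iota> \<and> char_wave (X ` {s1<..<s2}) (\<lambda>\<xi>. P (\<iota> \<xi>)) (\<lambda>\<xi>. Q (\<iota> \<xi>))"
proof -
  have s12: "s1 < s2" using curve by (simp add: char_curve_def)
  have "\<forall>s. \<exists>d. s1 < s \<longrightarrow> s < s2 \<longrightarrow> (X has_real_derivative d) (at s) \<and> d < 0"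
    using curve unfolding char_curve_def by blast
  then obtain D where D: "\<And>s. s1 < s \<Longrightarrow> s < s2 \<Longrightarrow> (X has_real_derivative D s) (at s) \<and> D s < 0"
    by metis
  obtain \<iota> where pinv: "param_inverse s1 s2 X a \<iota>"
    and i5: "\<And>s. s1 < s \<Longrightarrow> s < s2 \<Longrightarrow> (\<iota> has_real_derivative inverse (D s)) (at (X s))"
    using decreasing_inverse[OF s12 _ _ lim, of D] D by blast
  have "char_wave (X ` {s1<..<s2}) (\<lambda>\<xi>. P (\<iota> \<xi>)) (\<lambda>\<xi>. Q (\<iota> \<xi>))"
    unfolding char_wave_def
  proof (intro ballI)
    fix \<xi> assume "\<xi> \<in> X ` {s1<..<s2}"
    then obtain s where s: "s1 < s" "s < s2" "\<xi> = X s" by auto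
    obtain dX dP dQ where d: "dX < 0" "(X has_real_derivative dX) (at s)"
      "(P has_real_derivative dP) (at s)" "(Q has_real_derivative dQ) (at s)"
      "(fast (P s) (Q s) - k * X s) * dP = - (k - 1) * P s * dX"
      "(slow (P s) (Q s) - k * X s) * dQ = - (k - 1) * Q s * dX" "Q s < P s"
      "fast (P s) (Q s) \<noteq> k * X s" "slow (P s) (Q s) \<noteq> k * X s"
      using curve s unfolding char_curve_def by blast
    have "D s = dX" using D s d(2) DERIV_unique by blast
    then have di: "(\<iota> has_real_derivative inverse dX) (at \<xi>)" using i5 s by auto
    have ieq: "\<iota> \<xi> = s" using pinv s by (simp add: param_inverse_def)
    have "((\<lambda>\<xi>. P (\<iota> \<xi>)) has_real_derivative dP * inverse dX) (at \<xi>)"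
      "((\<lambda>\<xi>. Q (\<iota> \<xi>)) has_real_derivative dQ * inverse dX) (at \<xi>)"
      by (rule DERIV_chain2[OF _ di]; use d ieq in simp)+
    moreover have "dP * inverse dX = - (k - 1) * P s / (fast (P s) (Q s) - k * X s)"
      "dQ * inverse dX = - (k - 1) * Q s / (slow (P s) (Q s) - k * X s)"
      using d by (simp_all add: field_simps)
    ultimately show "Q (\<iota> \<xi>) < P (\<iota> \<xi>) \<and> fast (P (\<iota> \<xi>)) (Q (\<iota> \<xi>)) \<noteq> k * \<xi> \<and> slow (P (\<iota> \<xi>)) (Q (\<iota> \<xi>))
        \<noteq> k * \<xi> \<and>
       ((\<lambda>\<xi>. P (\<iota> \<xi>)) has_real_derivative - (k - 1) * P (\<iota> \<xi>) / (fast (P (\<iota> \<xi>)) (Q (\<iota> \<xi>)) - k * \<xi>))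
           (at \<xi>) \<and>
       ((\<lambda>\<xi>. Q (\<iota> \<xi>)) has_real_derivative - (k - 1) * Q (\<iota> \<xi>) / (slow (P (\<iota> \<xi>)) (Q (\<iota> \<xi>)) - k * \<xi>))
           (at \<xi>)"
      using d s unfolding ieq by simp
  qed
  with pinv show ?thesis by blast
qed

lemma wave_of_curve_unbounded:
  assumes curve: "char_curve s1 s2 X P Q" and lim: "(X \<longlongrightarrow> a) (at_left s2)"
    and top: "filterlim X at_top (at_right s1)"
  shows "\<exists>\<iota>. char_wave {a<..} (\<lambda>\<xi>. P (\<iota> \<xi>)) (\<lambda>\<xi>. Q (\<iota> \<xi>)) \<and> (\<forall>\<xi>>a. X (\<iota> \<xi>) = \<xi>) \<and>
    filterlim \<iota> (at_left s2) (at_right a) \<and> filterlim \<iota> (at_right s1) at_top"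
proof -
  have s12: "s1 < s2" using curve by (simp add: char_curve_def)
  obtain \<iota> where pinv: "param_inverse s1 s2 X a \<iota>"
    and wave: "char_wave (X ` {s1<..<s2}) (\<lambda>\<xi>. P (\<iota> \<xi>)) (\<lambda>\<xi>. Q (\<iota> \<xi>))"
    using char_curve_inverse[OF curve lim] by blast
  have i: "\<And>s. s1 < s \<Longrightarrow> s < s2 \<Longrightarrow> a < X s"
    "\<And>s. s1 < s \<Longrightarrow> s < s2 \<Longrightarrow> \<iota> (X s) = s"
    "\<And>s t. s1 < s \<Longrightarrow> s < t \<Longrightarrow> t < s2 \<Longrightarrow> X t < X s"
    "\<And>s \<xi>. s1 < s \<Longrightarrow> s < s2 \<Longrightarrow> a < \<xi> \<Longrightarrow> \<xi> \<le> X s \<Longrightarrow> s1 < \<iota> \<xi> \<and> \<iota> \<xi> < s2 \<and> X (\<iota> \<xi>) = \<xi>"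
    "filterlim \<iota> (at_left s2) (at_right a)"
    using pinv unfolding param_inverse_def by blast+
  have ev1: "eventually (\<lambda>s. s \<in> {s1<..<s2}) (at_right s1)" using s12 by (rule
      eventually_at_rightI[rotated]) auto
  have all: "s1 < \<iota> \<xi> \<and> \<iota> \<xi> < s2 \<and> X (\<iota> \<xi>) = \<xi>" if \<xi>: "a < \<xi>" for \<xi>
  proof -
    have "eventually (\<lambda>s. \<xi> \<le> X s) (at_right s1)" using top by (simp add: filterlim_at_top)
    from eventually_happens[OF eventually_conj[OF this ev1]]
    obtain s where "\<xi> \<le> X s" "s1 < s" "s < s2" by (auto simp: trivial_limit_at_right_real)
    then show ?thesis using i(4) \<xi> by blast
  qed
  have im: "X ` {s1<..<s2} = {a<..}"
  proof
    show "X ` {s1<..<s2} \<subseteq> {a<..}" using i(1) by auto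
    show "{a<..} \<subseteq> X ` {s1<..<s2}" using all by (metis greaterThanLessThan_iff greaterThan_iff
        image_eqI subsetI)
  qed
  have lo: "eventually (\<lambda>\<xi>. \<iota> \<xi> \<in> {s1<..<s}) at_top" if s: "s1 < s" "s < s2" for s
    unfolding eventually_at_top_dense
  proof (intro exI[of _ "X s"] allI impI)
    fix \<xi> assume \<xi>: "X s < \<xi>"
    then have b: "s1 < \<iota> \<xi>" "\<iota> \<xi> < s2" "X (\<iota> \<xi>) = \<xi>" using all i(1)[OF s] by auto
    have "\<not> s \<le> \<iota> \<xi>"
    proof
      assume "s \<le> \<iota> \<xi>"
      then have "X (\<iota> \<xi>) \<le> X s" using i(3)[of s "\<iota> \<xi>"] s b by (cases "s = \<iota> \<xi>") auto
      then show False using b \<xi> by simp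
    qed
    then show "\<iota> \<xi> \<in> {s1<..<s}" using b by simp
  qed
  have "filterlim \<iota> (at_right s1) at_top"
    unfolding filterlim_at
  proof (intro conjI order_tendstoI)
    define m where "m = (s1 + s2) / 2"
    have m: "s1 < m" "m < s2" using s12 by (auto simp: m_def)
    show "\<forall>\<^sub>F x in at_top. \<iota> x \<in> {s1<..} \<and> \<iota> x \<noteq> s1" using lo[OF m] by eventually_elim auto
    show "\<forall>\<^sub>F x in at_top. y < \<iota> x" if "y < s1" for y
      using lo[OF m] by eventually_elim (use that in auto)
    show "\<forall>\<^sub>F x in at_top. \<iota> x < y" if "s1 < y" for y
    proof -
      have "eventually (\<lambda>\<xi>. \<iota> \<xi> \<in> {s1<..<min y m}) at_top" by (rule lo) (use that m in auto)
      then show ?thesis by eventually_elim auto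
    qed
  qed
  then show ?thesis using i(5) all wave unfolding im by blast
qed

lemma wave_of_curve_bounded:
  assumes curve: "char_curve s1 s2 X P Q" and lim: "(X \<longlongrightarrow> a) (at_left s2)"
    and lim1: "(X \<longlongrightarrow> b) (at_right s1)"
  shows "\<exists>\<iota>. char_wave {a<..<b} (\<lambda>\<xi>. P (\<iota> \<xi>)) (\<lambda>\<xi>. Q (\<iota> \<xi>)) \<and> a < b \<and>
    (\<forall>\<xi>. a < \<xi> \<longrightarrow> \<xi> < b \<longrightarrow> X (\<iota> \<xi>) = \<xi>) \<and>
    filterlim \<iota> (at_left s2) (at_right a) \<and> filterlim \<iota> (at_right s1) (at_left b)"
proof -
  have s12: "s1 < s2" using curve by (simp add: char_curve_def)
  obtain \<iota> where pinv: "param_inverse s1 s2 X a \<iota>"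
    and wave: "char_wave (X ` {s1<..<s2}) (\<lambda>\<xi>. P (\<iota> \<xi>)) (\<lambda>\<xi>. Q (\<iota> \<xi>))"
    using char_curve_inverse[OF curve lim] by blast
  have i: "\<And>s. s1 < s \<Longrightarrow> s < s2 \<Longrightarrow> a < X s"
    "\<And>s. s1 < s \<Longrightarrow> s < s2 \<Longrightarrow> \<iota> (X s) = s"
    "\<And>s t. s1 < s \<Longrightarrow> s < t \<Longrightarrow> t < s2 \<Longrightarrow> X t < X s"
    "\<And>s \<xi>. s1 < s \<Longrightarrow> s < s2 \<Longrightarrow> a < \<xi> \<Longrightarrow> \<xi> \<le> X s \<Longrightarrow> s1 < \<iota> \<xi> \<and> \<iota> \<xi> < s2 \<and> X (\<iota> \<xi>) = \<xi>"
    "filterlim \<iota> (at_left s2) (at_right a)"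
    using pinv unfolding param_inverse_def by blast+
  have ev1: "eventually (\<lambda>s. s \<in> {s1<..<s2}) (at_right s1)" using s12 by (rule
      eventually_at_rightI[rotated]) auto
  have lt: "X s < b" if s: "s1 < s" "s < s2" for s
  proof -
    define m where "m = (s + s1) / 2"
    have m: "m < s" "s1 < m" using s by (auto simp: m_def)
    have "X m \<le> b"
    proof (rule tendsto_lowerbound[OF lim1])
      have "eventually (\<lambda>x. x \<in> {s1<..<m}) (at_right s1)" by (rule eventually_at_rightI[OF _ m(2)]) auto
      then show "eventually (\<lambda>x. X m \<le> X x) (at_right s1)"
      proof eventually_elim
        case (elim x)
        then show ?case using i(3)[of x m] m s by auto
      qed
    qed simp
    moreover have "X s < X m" using i(3) m s by auto
    ultimately show ?thesis by simp
  qed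
  have all: "s1 < \<iota> \<xi> \<and> \<iota> \<xi> < s2 \<and> X (\<iota> \<xi>) = \<xi>" if \<xi>: "a < \<xi>" "\<xi> < b" for \<xi>
  proof -
    have "eventually (\<lambda>s. \<xi> < X s) (at_right s1)" using lim1 \<xi>(2) by (rule order_tendstoD)
    from eventually_happens[OF eventually_conj[OF this ev1]]
    obtain s where "\<xi> < X s" "s1 < s" "s < s2" by (auto simp: trivial_limit_at_right_real)
    then show ?thesis using i(4)[of s \<xi>] \<xi> by simp
  qed
  have im: "X ` {s1<..<s2} = {a<..<b}"
  proof
    show "X ` {s1<..<s2} \<subseteq> {a<..<b}" using i(1) lt by auto
    show "{a<..<b} \<subseteq> X ` {s1<..<s2}" using all by (metis greaterThanLessThan_iff image_eqI subsetI)
  qed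
  define m where "m = (s1 + s2) / 2"
  have m: "s1 < m" "m < s2" using s12 by (auto simp: m_def)
  have ab: "a < b" using i(1)[OF m] lt[OF m] by simp
  have lo: "eventually (\<lambda>\<xi>. \<iota> \<xi> \<in> {s1<..<s}) (at_left b)" if s: "s1 < s" "s < s2" for s
  proof (rule eventually_at_leftI)
    show "X s < b" using lt s by auto
    fix \<xi> assume \<xi>: "\<xi> \<in> {X s<..<b}"
    then have b: "s1 < \<iota> \<xi>" "\<iota> \<xi> < s2" "X (\<iota> \<xi>) = \<xi>" using all i(1)[OF s] by auto
    have "\<not> s \<le> \<iota> \<xi>"
    proof
      assume "s \<le> \<iota> \<xi>"
      then have "X (\<iota> \<xi>) \<le> X s" using i(3)[of s "\<iota> \<xi>"] s b by (cases "s = \<iota> \<xi>") auto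
      then show False using b \<xi> by simp
    qed
    then show "\<iota> \<xi> \<in> {s1<..<s}" using b by simp
  qed
  have "filterlim \<iota> (at_right s1) (at_left b)"
    unfolding filterlim_at
  proof (intro conjI order_tendstoI)
    show "\<forall>\<^sub>F x in at_left b. \<iota> x \<in> {s1<..} \<and> \<iota> x \<noteq> s1" using lo[OF m] by eventually_elim auto
    show "\<forall>\<^sub>F x in at_left b. y < \<iota> x" if "y < s1" for y
      using lo[OF m] by eventually_elim (use that in auto)
    show "\<forall>\<^sub>F x in at_left b. \<iota> x < y" if "s1 < y" for y
    proof -
      have "eventually (\<lambda>\<xi>. \<iota> \<xi> \<in> {s1<..<min y m}) (at_left b)" by (rule lo) (use that m in auto)
      then show ?thesis by eventually_elim auto
    qed
  qed
  then show ?thesis using i(5) all wave ab unfolding im by blast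
qed

end

section \<open>Characteristic curves from solutions of the hodograph equation\<close>

context self_similar_exponents
begin

lemma alpha_M: "alpha = M / l" and beta_M: "beta = (M - 1) / l"
  using l_gt_1 by (auto simp: alpha_def beta_def M_def field_simps)

lemma alpha_beta_diff: "alpha - beta = 1 / l" and alpha_beta_sum: "alpha + beta = 1"
  using l_gt_1 by (auto simp: alpha_def beta_def field_simps)

lemma beta_pos: "beta > 0" and alpha_gt_beta: "alpha > beta" and alpha_pos: "alpha > 0"
  using l_gt_1 by (auto simp: alpha_def beta_def divide_strict_right_mono)

lemma k_n: "n = k * (n - 1)" "k = n * (k - 1)"
  using conj_exp by (auto simp: algebra_simps)

text \<open>
  \<open>amp\<close> is the modulus of the invariant in the denominator of \<open>r\<close>, and \<open>pos_ratio\<close> is \<open>k \<xi>\<close>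
  divided by that invariant.
\<close>
definition amp :: "(real \<Rightarrow> real) \<Rightarrow> real \<Rightarrow> real" where
  "amp T r = T r powr (- (k - 1))"
definition pos_ratio :: "(real \<Rightarrow> real) \<Rightarrow> (real \<Rightarrow> real) \<Rightarrow> real \<Rightarrow> real" where
  "pos_ratio T N r = alpha + beta * r + (1 - r) * N r / (l * (n - 1) * T r)"

text \<open>
  Comparing \<open>pos_ratio\<close> with \<open>alpha + beta r\<close> detects zeros of \<open>N\<close>, comparing it with
  \<open>beta + alpha r\<close> detects zeros of \<open>T'\<close>.  These are the two sonic lines.
\<close>
lemma pos_ratio_alt:
  assumes "r * T1 r = N r + (n - 1) * T r" "T r > 0"
  shows "pos_ratio T N r - (beta + alpha * r) = r * (1 - r) * T1 r / (l * (n - 1) * T r)"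
proof -
  have N: "N r = r * T1 r - (n - 1) * T r" using assms by simp
  have "(1 - r) * N r / (l * (n - 1) * T r) = r * (1 - r) * T1 r / (l * (n - 1) * T r) - (1 - r) / l"
    unfolding N using assms(2) n_gt_1 l_gt_1 by (simp add: field_simps)
  moreover have "alpha + beta * r - (beta + alpha * r) = (alpha - beta) * (1 - r)" by (simp add:
      algebra_simps)
  ultimately show ?thesis unfolding pos_ratio_def alpha_beta_diff by simp
qed

text \<open>
  The hodograph equation is equivalent to the diagonal system.  The derivatives of the two invariants
  are multiples of \<open>T'\<close> and \<open>N\<close>, and that of \<open>\<xi>\<close> is a multiple of their product, so each equation
  of the system reduces to an identity between products of the sonic factors.
\<close>
lemma hodograph_param:
  assumes sol: "hodograph_sol J T T1 N" and r: "r \<in> J" "r < 1" and T: "T r > 0"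
  defines "dX \<equiv> - amp T r * ((1 - r) / (l * (n - 1))) * (N r * T1 r / (T r)\<^sup>2)"
  shows "((\<lambda>r. amp T r) has_real_derivative - (k - 1) * amp T r * T1 r / T r) (at r)"
    and "((\<lambda>r. r * amp T r) has_real_derivative - (k - 1) * amp T r * N r / T r) (at r)"
    and "((\<lambda>r. amp T r * pos_ratio T N r / k) has_real_derivative dX) (at r)"
    and "(alpha + beta * r - pos_ratio T N r) * amp T r * (- (k - 1) * amp T r * T1 r / T r)
       = - (k - 1) * amp T r * dX"
    and "(beta + alpha * r - pos_ratio T N r) * amp T r * (- (k - 1) * amp T r * N r / T r)
       = - (k - 1) * (r * amp T r) * dX"
proof -
  let ?G = "amp T r"
  have d: "(T has_real_derivative T1 r) (at r)"
      "(N has_real_derivative M * (N r + T1 r) / (1 - r)) (at r)"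
      and e: "r * T1 r = N r + (n - 1) * T r" using sol r unfolding hodograph_sol_def by blast+
  have N: "N r = r * T1 r - (n - 1) * T r" using e by simp
  have nz: "l > 0" "n - 1 > 0" "1 - r > 0" using l_gt_1 n_gt_1 r by auto
  have kn: "(k - 1) = 1 / (n - 1)" using conj_exp nz by (simp add: field_simps)
  show dG: "((\<lambda>r. amp T r) has_real_derivative - (k - 1) * ?G * T1 r / T r) (at r)"
  proof -
    have "T r powr (- (k - 1) - of_nat 1) = T r powr (- (k - 1)) / T r"
      using T by (simp only: of_nat_1 powr_diff powr_one)
    then show ?thesis
      using DERIV_fun_powr[OF d(1) T, of "- (k - 1)"] unfolding amp_def[abs_def] by simp
  qed
  have "((\<lambda>r. r * amp T r) has_real_derivative 1 * ?G + - (k - 1) * ?G * T1 r / T r * r) (at r)"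
    by (intro DERIV_mult DERIV_ident dG)
  moreover have "1 * ?G + - (k - 1) * ?G * T1 r / T r * r = - (k - 1) * ?G * N r / T r"
    unfolding N kn using T nz by (simp add: field_simps)
  ultimately show "((\<lambda>r. r * amp T r) has_real_derivative - (k - 1) * ?G * N r / T r) (at r)" by simp
  let ?Y = "pos_ratio T N r"
  let ?dY = "beta + ((- 1 * N r + M * (N r + T1 r) / (1 - r) * (1 - r)) * (l * (n - 1) * T r)
      - (1 - r) * N r * (l * (n - 1) * T1 r)) / ((l * (n - 1) * T r) * (l * (n - 1) * T r))"
  have "((\<lambda>r. alpha + beta * r + (1 - r) * N r / (l * (n - 1) * T r)) has_real_derivative
     0 + beta * 1 + ((- 1 * N r + M * (N r + T1 r) / (1 - r) * (1 - r)) * (l * (n - 1) * T r)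
      - (1 - r) * N r * (l * (n - 1) * T1 r)) / ((l * (n - 1) * T r) * (l * (n - 1) * T r))) (at r)"
  proof (intro DERIV_add DERIV_const DERIV_cmult DERIV_ident DERIV_divide DERIV_mult d)
    show "((\<lambda>x. 1 - x) has_real_derivative - 1) (at r)" by (auto intro!: derivative_eq_intros)
  qed (use T nz in auto)
  then have dY: "(pos_ratio T N has_real_derivative ?dY) (at r)"
    unfolding pos_ratio_def[abs_def] by simp
  have "((\<lambda>r. amp T r * pos_ratio T N r / k) has_real_derivative
     (- (k - 1) * ?G * T1 r / T r * ?Y + ?dY * ?G) / k) (at r)"
    by (intro DERIV_cdivide DERIV_mult dG dY)
  moreover have "(- (k - 1) * ?G * T1 r / T r * ?Y + ?dY * ?G) / k = dX"
  proof -
    have Y: "?Y = (M + (M - 1) * r) / l + (1 - r) * N r / (l * (n - 1) * T r)"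
      unfolding pos_ratio_def alpha_M beta_M by (simp add: add_divide_distrib)
    define c where "c = l * (n - 1)"
    have c: "c > 0" using nz by (simp add: c_def)
    have frac: "(p * (c * q) - w * (c * z)) / ((c * q) * (c * q)) = p / (c * q) - w * z / (c * q\<^sup>2)"
      if "q > 0" for p q w z
      using that c by (simp add: field_simps power2_eq_square)
    have "M * (N r + T1 r) / (1 - r) * (1 - r) = M * (N r + T1 r)" using nz by simp
    then have dYs: "?dY = (M - 1) / l + (- N r + M * (N r + T1 r)) / (c * T r) - (1 - r)
        * N r * T1 r / (c * (T r)\<^sup>2)"
      unfolding beta_M c_def[symmetric] frac[OF T] by simp
    have lc: "1 / l = (n - 1) / c" "(k - 1) * (n - 1) = 1" using nz conj_exp by (simp_all add: c_def)
    have Yc: "(k - 1) * T1 r / T r * ?Y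
        = (T1 r * T r * (M + (M - 1) * r) + (k - 1) * T1 r * (1 - r) * N r) / (c * (T r)\<^sup>2)"
    proof -
      have "(k - 1) * T1 r / T r * ((M + (M - 1) * r) / l) = (k - 1) * T1 r / T r * (M + (M - 1)
          * r) * (1 / l)"
        by simp
      also have "\<dots> = ((k - 1) * (n - 1)) * (T1 r / T r * (M + (M - 1) * r) / c)"
      proof -
        have "(p * u / w) * b * (q / c) = (p * q) * (u / w * b / c)" for p q u w b
          by (simp add: mult_ac)
        then show ?thesis unfolding lc(1) .
      qed
      also have "\<dots> = T1 r * T r * (M + (M - 1) * r) / (c * (T r)\<^sup>2)"
        unfolding lc(2) using c T by (simp add: field_simps power2_eq_square)
      finally have "(k - 1) * T1 r / T r * ((M + (M - 1) * r) / l) = T1 r * T r * (M + (M - 1) * r)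
          / (c * (T r)\<^sup>2)" .
      moreover have "(k - 1) * T1 r / T r * ((1 - r) * N r / (c * T r)) = (k - 1) * T1 r * (1 - r)
          * N r / (c * (T r)\<^sup>2)"
        using c T by (simp add: power2_eq_square mult_ac)
      ultimately show ?thesis unfolding Y c_def[symmetric] by (simp only:
          distrib_left add_divide_distrib)
    qed
    have dYc: "?dY = ((M - 1) * (n - 1) * (T r)\<^sup>2 + (- N r + M * (N r + T1 r)) * T r - (1 - r)
        * N r * T1 r) / (c * (T r)\<^sup>2)"
    proof -
      have 1: "(M - 1) / l = (M - 1) * (n - 1) * (T r)\<^sup>2 / (c * (T r)\<^sup>2)"
        using T nz by (simp add: c_def)
      have 2: "(- N r + M * (N r + T1 r)) / (c * T r) = (- N r + M * (N r + T1 r))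
          * T r / (c * (T r)\<^sup>2)"
        using T c by (simp add: power2_eq_square)
      show ?thesis unfolding dYs 1 2 by (simp only: add_divide_distrib diff_divide_distrib)
    qed
    have key: "(M - 1) * (n - 1) * (T r)\<^sup>2 + (- N r + M * (N r + T1 r))
        * T r - T1 r * T r * (M + (M - 1) * r) = 0"
      unfolding N by (simp add: algebra_simps power2_eq_square)
    have "- (k - 1) * t / w * y + d = d - (k - 1) * t / w * y" for t w y d :: real
      by (simp add: algebra_simps diff_divide_distrib)
    then have "- (k - 1) * T1 r / T r * ?Y + ?dY = ?dY - (k - 1) * T1 r / T r * ?Y" .
    also have "\<dots> = ((M - 1) * (n - 1) * (T r)\<^sup>2 + (- N r + M * (N r + T1 r))
        * T r - T1 r * T r * (M + (M - 1) * r)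
        - k * (1 - r) * N r * T1 r) / (c * (T r)\<^sup>2)"
      unfolding Yc dYc diff_divide_distrib[symmetric] by (rule arg_cong[where f="\<lambda>x. x / (c * (T
          r)\<^sup>2)"]) (simp add: algebra_simps)
    finally have "- (k - 1) * T1 r / T r * ?Y + ?dY = - k * (1 - r) * N r * T1 r / (l * (n - 1)
        * (T r)\<^sup>2)"
      unfolding key c_def by simp
    then have "?G * (- (k - 1) * T1 r / T r * ?Y + ?dY) = ?G * (- k * (1 - r)
        * N r * T1 r / (l * (n - 1) * (T r)\<^sup>2))"
      by simp
    moreover have "- (k - 1) * ?G * T1 r / T r * ?Y + ?dY * ?G = ?G * (- (k - 1)
        * T1 r / T r * ?Y + ?dY)"
      by (simp add: algebra_simps)
    ultimately show ?thesis unfolding dX_def using k_gt_1 nz T by (simp add: field_simps)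
  qed
  ultimately show "((\<lambda>r. amp T r * pos_ratio T N r / k) has_real_derivative dX) (at r)" by simp
  have A: "alpha + beta * r - ?Y = - ((1 - r) * N r / (l * (n - 1) * T r))" by (simp add: pos_ratio_def)
  show "(alpha + beta * r - ?Y) * ?G * (- (k - 1) * ?G * T1 r / T r) = - (k - 1) * ?G * dX"
    unfolding A dX_def using T nz by (simp add: field_simps power2_eq_square)
  have B: "beta + alpha * r - ?Y = - (r * (1 - r) * T1 r / (l * (n - 1) * T r))"
    using pos_ratio_alt[of r T1 N T, OF e T] by simp
  show "(beta + alpha * r - ?Y) * ?G * (- (k - 1) * ?G * N r / T r) = - (k - 1) * (r * ?G) * dX"
    unfolding B dX_def using T nz by (simp add: field_simps power2_eq_square)
qed

lemma pos_ratio_vs_slow: 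
  assumes "r < 1" "T r > 0"
  shows "pos_ratio T N r < alpha + beta * r \<longleftrightarrow> N r < 0" "pos_ratio T N r = alpha + beta * r \<longleftrightarrow> N r = 0"
proof -
  define c where "c = (1 - r) / (l * (n - 1) * T r)"
  have c: "c > 0" using assms l_gt_1 n_gt_1 by (simp add: c_def)
  have p: "pos_ratio T N r = alpha + beta * r + c * N r" by (simp add: pos_ratio_def c_def)
  show "pos_ratio T N r < alpha + beta * r \<longleftrightarrow> N r < 0"
    unfolding p using c by (simp add: mult_less_0_iff)
  show "pos_ratio T N r = alpha + beta * r \<longleftrightarrow> N r = 0"
    unfolding p using c assms by auto
qed

lemma amp_pos: "T r > 0 \<Longrightarrow> amp T r > 0"
  by (simp add: amp_def)

text \<open>
  The three sign patterns that occur.  Here \<open>Q < 0\<close> is the invariant of larger modulus and \<open>r = P / Q\<close>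
  increases along the flow.
\<close>
lemma curve_left_moving:
  assumes sol: "hodograph_sol {s1<..<s2} T T1 N" and s: "s1 < s2" "s2 \<le> 1" "0 \<notin> {s1<..<s2}"
    and sgn: "\<And>r. s1 < r \<Longrightarrow> r < s2 \<Longrightarrow> T r > 0 \<and> T1 r > 0 \<and> N r < 0"
  shows "char_curve s1 s2 (\<lambda>r. - (amp T r * pos_ratio T N r / k)) (\<lambda>r. - (r * amp T r)) (\<lambda>r. - amp T r)"
  unfolding char_curve_def
proof (intro conjI allI impI)
  fix r assume r: "s1 < r" "r < s2"
  have J: "r \<in> {s1<..<s2}" "r < 1" "r \<noteq> 0" using r s by auto
  have T: "T r > 0" "T1 r > 0" "N r < 0" using sgn r by auto
  have e: "r * T1 r = N r + (n - 1) * T r" using sol J unfolding hodograph_sol_def by blast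
  note P = hodograph_param[OF sol J(1,2) T(1)]
  let ?dX = "- amp T r * ((1 - r) / (l * (n - 1))) * (N r * T1 r / (T r)\<^sup>2)"
  have G: "amp T r > 0" using T by (rule_tac amp_pos)
  have k0: "k \<noteq> 0" using k_gt_1 by simp
  have f: "fast (- (r * amp T r)) (- amp T r) - k * - (amp T r * pos_ratio T N r / k) =
      - ((beta + alpha * r - pos_ratio T N r) * amp T r)"
    "slow (- (r * amp T r)) (- amp T r) - k * - (amp T r * pos_ratio T N r / k) =
        - ((alpha + beta * r - pos_ratio T N r) * amp T r)"
    using k0 by (simp_all add: fast_def slow_def algebra_simps)
  show "- amp T r < - (r * amp T r)" using G J by simp
  have A: "alpha + beta * r - pos_ratio T N r \<noteq> 0" using pos_ratio_vs_slow[of r T N] J T by force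
  have "pos_ratio T N r - (beta + alpha * r) \<noteq> 0"
    unfolding pos_ratio_alt[of r T1 N T, OF e T(1)] using J T l_gt_1 n_gt_1 by simp
  then have B: "beta + alpha * r - pos_ratio T N r \<noteq> 0" by argo
  show "fast (- (r * amp T r)) (- amp T r) \<noteq> k * - (amp T r * pos_ratio T N r / k)"
    using f(1) B G by force
  show "slow (- (r * amp T r)) (- amp T r) \<noteq> k * - (amp T r * pos_ratio T N r / k)"
    using f(2) A G by force
  have "amp T r * ((1 - r) / (l * (n - 1))) > 0" using G J l_gt_1 n_gt_1 by simp
  moreover have "N r * T1 r / (T r)\<^sup>2 < 0" using T by (simp add: divide_neg_pos mult_neg_pos)
  ultimately have "- ?dX < 0" by (simp only: mult_minus_left minus_minus mult_pos_neg)
  then show "\<exists>dX dP dQ. dX < 0 \<and> ((\<lambda>r. - (amp T r * pos_ratio T N r / k)) has_real_derivative dX)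
      (at r) \<and>
        ((\<lambda>r. - (r * amp T r)) has_real_derivative dP) (at r) \<and> ((\<lambda>r. - amp T r)
            has_real_derivative dQ) (at r) \<and>
        (fast (- (r * amp T r)) (- amp T r) - k * - (amp T r * pos_ratio T N r / k)) * dP =
            - (k - 1) * - (r * amp T r) * dX \<and>
        (slow (- (r * amp T r)) (- amp T r) - k * - (amp T r * pos_ratio T N r / k)) * dQ =
            - (k - 1) * - amp T r * dX"
    unfolding f
    by (intro exI[of _ "- ?dX"] exI[of _ "- (- (k - 1) * amp T r * N r / T r)"] exI[of _ "- (- (k -
        1) * amp T r * T1 r / T r)"] conjI
         DERIV_minus P(1-3)) (use P(4,5) in \<open>auto simp only: minus_mult_minus mult_minus_right
             mult_minus_left minus_minus\<close>)
qed (use s in auto)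

text \<open>Here \<open>P > 0\<close> is the invariant of larger modulus and \<open>r = Q / P\<close>.\<close>
lemma curve_right_moving:
  assumes sol: "hodograph_sol {s1<..<s2} T T1 N" and s: "s1 < s2" "s2 \<le> 1" "0 \<le> s1"
    and sgn: "\<And>r. s1 < r \<Longrightarrow> r < s2 \<Longrightarrow> T r > 0 \<and> T1 r > 0 \<and> N r > 0"
  shows "char_curve s1 s2 (\<lambda>r. amp T r * pos_ratio T N r / k) (\<lambda>r. amp T r) (\<lambda>r. r * amp T r)"
  unfolding char_curve_def
proof (intro conjI allI impI)
  fix r assume r: "s1 < r" "r < s2"
  have J: "r \<in> {s1<..<s2}" "r < 1" "r > 0" using r s by auto
  have T: "T r > 0" "T1 r > 0" "N r > 0" using sgn r by auto
  have e: "r * T1 r = N r + (n - 1) * T r" using sol J unfolding hodograph_sol_def by blast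
  note P = hodograph_param[OF sol J(1,2) T(1)]
  let ?dX = "- amp T r * ((1 - r) / (l * (n - 1))) * (N r * T1 r / (T r)\<^sup>2)"
  have G: "amp T r > 0" using T by (rule_tac amp_pos)
  have k0: "k \<noteq> 0" using k_gt_1 by simp
  have f: "slow (amp T r) (r * amp T r) - k * (amp T r * pos_ratio T N r / k) =
      (beta + alpha * r - pos_ratio T N r) * amp T r"
    "fast (amp T r) (r * amp T r) - k * (amp T r * pos_ratio T N r / k) =
        (alpha + beta * r - pos_ratio T N r) * amp T r"
    using k0 by (simp_all add: fast_def slow_def algebra_simps)
  show "r * amp T r < amp T r" using G J by simp
  have A: "alpha + beta * r - pos_ratio T N r \<noteq> 0" using pos_ratio_vs_slow[of r T N] J T by force
  have "pos_ratio T N r - (beta + alpha * r) \<noteq> 0"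
    unfolding pos_ratio_alt[of r T1 N T, OF e T(1)] using J T l_gt_1 n_gt_1 by simp
  then have B: "beta + alpha * r - pos_ratio T N r \<noteq> 0" by argo
  show "fast (amp T r) (r * amp T r) \<noteq> k * (amp T r * pos_ratio T N r / k)"
    using f(2) A G by force
  show "slow (amp T r) (r * amp T r) \<noteq> k * (amp T r * pos_ratio T N r / k)"
    using f(1) B G by force
  have "amp T r * ((1 - r) / (l * (n - 1))) > 0" using G J l_gt_1 n_gt_1 by simp
  moreover have "N r * T1 r / (T r)\<^sup>2 > 0" using T by simp
  ultimately have "?dX < 0" by (simp only: mult_minus_left neg_less_0_iff_less mult_pos_pos)
  then show "\<exists>dX dP dQ. dX < 0 \<and> ((\<lambda>r. amp T r * pos_ratio T N r / k) has_real_derivative dX) (at r) \<and>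
        ((\<lambda>r. amp T r) has_real_derivative dP) (at r) \<and> ((\<lambda>r. r * amp T r) has_real_derivative dQ)
            (at r) \<and>
        (fast (amp T r) (r * amp T r) - k * (amp T r * pos_ratio T N r / k)) * dP = - (k - 1)
            * amp T r * dX \<and>
        (slow (amp T r) (r * amp T r) - k * (amp T r * pos_ratio T N r / k)) * dQ = - (k - 1)
            * (r * amp T r) * dX"
    unfolding f
    by (intro exI[of _ "?dX"] exI[of _ "- (k - 1) * amp T r * N r / T r"] exI[of _ "- (k - 1)
        * amp T r * T1 r / T r"] conjI
         P)
qed (use s in auto)

text \<open>
  As for \<open>curve_left_moving\<close>, but with \<open>T' < 0\<close>: now \<open>r\<close> decreases along the flow, and \<open>- r\<close> is
  the parameter.
\<close>
lemma curve_left_moving_reversed: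
  assumes sol: "hodograph_sol {s1<..<s2} T T1 N" and s: "s1 < s2" "s2 \<le> 1" "0 \<notin> {s1<..<s2}"
    and sgn: "\<And>r. s1 < r \<Longrightarrow> r < s2 \<Longrightarrow> T r > 0 \<and> T1 r < 0 \<and> N r < 0"
  shows "char_curve (- s2) (- s1) (\<lambda>s. - (amp T (- s) * pos_ratio T N (- s) / k))
      (\<lambda>s. - (- s * amp T (- s))) (\<lambda>s. - amp T (- s))"
  unfolding char_curve_def
proof (intro conjI allI impI)
  fix s' assume "- s2 < s'" "s' < - s1"
  then obtain r where r: "s1 < r" "r < s2" "s' = - r" by (metis minus_less_iff minus_minus)
  have J: "r \<in> {s1<..<s2}" "r < 1" "r \<noteq> 0" using r s by auto
  have T: "T r > 0" "T1 r < 0" "N r < 0" using sgn r by auto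
  have e: "r * T1 r = N r + (n - 1) * T r" using sol J unfolding hodograph_sol_def by blast
  note P = hodograph_param[OF sol J(1,2) T(1)]
  let ?dX = "- amp T r * ((1 - r) / (l * (n - 1))) * (N r * T1 r / (T r)\<^sup>2)"
  have G: "amp T r > 0" using T by (rule_tac amp_pos)
  have k0: "k \<noteq> 0" using k_gt_1 by simp
  have sr: "- s' = r" using r by simp
  have f: "fast (- (r * amp T r)) (- amp T r) - k * - (amp T r * pos_ratio T N r / k) =
      - ((beta + alpha * r - pos_ratio T N r) * amp T r)"
    "slow (- (r * amp T r)) (- amp T r) - k * - (amp T r * pos_ratio T N r / k) =
        - ((alpha + beta * r - pos_ratio T N r) * amp T r)"
    using k0 by (simp_all add: fast_def slow_def algebra_simps)
  show "- amp T (- s') < - (- s' * amp T (- s'))" unfolding sr using G J by simp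
  have A: "alpha + beta * r - pos_ratio T N r \<noteq> 0" using pos_ratio_vs_slow[of r T N] J T by force
  have "pos_ratio T N r - (beta + alpha * r) \<noteq> 0"
    unfolding pos_ratio_alt[of r T1 N T, OF e T(1)] using J T l_gt_1 n_gt_1 by simp
  then have B: "beta + alpha * r - pos_ratio T N r \<noteq> 0" by argo
  show "fast (- (- s' * amp T (- s'))) (- amp T (- s')) \<noteq> k * - (amp T (- s') * pos_ratio T N (- s')
      / k)"
    unfolding sr using f(1) B G by force
  show "slow (- (- s' * amp T (- s'))) (- amp T (- s')) \<noteq> k * - (amp T (- s') * pos_ratio T N (- s')
      / k)"
    unfolding sr using f(2) A G by force
  have "amp T r * ((1 - r) / (l * (n - 1))) > 0" using G J l_gt_1 n_gt_1 by simp
  moreover have "N r * T1 r / (T r)\<^sup>2 > 0" using T by (simp add: mult_neg_neg)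
  ultimately have neg: "?dX < 0" by (simp only: mult_minus_left neg_less_0_iff_less mult_pos_pos)
  have m: "(uminus has_real_derivative - 1) (at s')" by (auto intro!: derivative_eq_intros)
  have ch: "((\<lambda>s. - f (- s)) has_real_derivative d) (at s')" if "(f has_real_derivative d) (at r)"
      for f d
  proof -
    have "((\<lambda>s. f (- s)) has_real_derivative d * - 1) (at s')"
      by (rule DERIV_chain2[of f]) (use that m sr in auto)
    from DERIV_minus[OF this] show ?thesis by simp
  qed
  show "\<exists>dX dP dQ. dX < 0 \<and> ((\<lambda>s. - (amp T (- s) * pos_ratio T N (- s) / k)) has_real_derivative dX)
      (at s') \<and>
        ((\<lambda>s. - (- s * amp T (- s))) has_real_derivative dP) (at s') \<and> ((\<lambda>s. - amp T (- s))
            has_real_derivative dQ) (at s') \<and>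
        (fast (- (- s' * amp T (- s'))) (- amp T (- s')) - k * - (amp T (- s')
            * pos_ratio T N (- s') / k)) * dP = - (k - 1) * - (- s' * amp T (- s')) * dX \<and>
        (slow (- (- s' * amp T (- s'))) (- amp T (- s')) - k * - (amp T (- s')
            * pos_ratio T N (- s') / k)) * dQ = - (k - 1) * - amp T (- s') * dX"
    unfolding sr f
    by (intro exI[of _ "?dX"] exI[of _ "- (k - 1) * amp T r * N r / T r"] exI[of _ "- (k - 1)
        * amp T r * T1 r / T r"] conjI
         neg ch[OF P(1)] ch[OF P(2)] ch[OF P(3)]) (use P(4,5) in \<open>auto simp only:
             mult_minus_right mult_minus_left minus_minus\<close>)
qed (use s in auto)

text \<open>
  At a zero of \<open>T\<close> both \<open>\<xi>\<close> and the invariants become infinite, and the powers match the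
  self-similar initial data.
\<close>
lemma far_field:
  assumes T: "(T \<longlongrightarrow> 0) F" "eventually (\<lambda>s. T s > 0) F" and Z: "(Z \<longlongrightarrow> Z0) F" "Z0 > (0::real)"
  shows "filterlim (\<lambda>s. T s powr (- k) * Z s) at_top F"
    and "((\<lambda>s. T s powr (- (k - 1)) / (T s powr (- k) * Z s) powr (1 / n)) \<longlongrightarrow> Z0 powr (- 1 / n)) F"
proof -
  have "filterlim T (at_right 0) F" unfolding filterlim_at
    using T by (auto elim: eventually_mono)
  moreover have "filterlim (\<lambda>x::real. x powr (- k)) at_top (at_right 0)"
  proof -
    have "((\<lambda>x::real. x powr k) \<longlongrightarrow> 0 powr k) (at_right 0)"
      by (rule tendsto_powr'[OF tendsto_ident_at tendsto_const])
         (use k_gt_1 in \<open>auto simp: eventually_at_right_less intro: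
             eventually_mono[OF eventually_at_right_less]\<close>)
    then have "filterlim (\<lambda>x::real. inverse (x powr k)) at_top (at_right 0)"
      by (intro filterlim_inverse_at_top) (auto simp: intro: eventually_mono[OF
          eventually_at_right_less])
    then show ?thesis by (simp add: powr_minus)
  qed
  ultimately have "filterlim (\<lambda>s. T s powr (- k)) at_top F" by (rule filterlim_compose[rotated])
  then have "filterlim (\<lambda>s. Z s * T s powr (- k)) at_top F"
    by (rule filterlim_tendsto_pos_mult_at_top[OF Z])
  then show "filterlim (\<lambda>s. T s powr (- k) * Z s) at_top F" by (simp only: mult.commute)
  have "((\<lambda>s. Z s powr (- 1 / n)) \<longlongrightarrow> Z0 powr (- 1 / n)) F"
    by (rule tendsto_powr[OF Z(1) tendsto_const]) (use Z in auto)
  then show "((\<lambda>s. T s powr (- (k - 1)) / (T s powr (- k) * Z s) powr (1 / n)) \<longlongrightarrow> Z0 powr (- 1 / n)) F"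
  proof (rule Lim_transform_eventually)
    have "eventually (\<lambda>s. Z s > 0) F" using Z by (rule order_tendstoD)
    with T(2) show "eventually (\<lambda>s. Z s powr (- 1 / n) = T s powr (- (k - 1)) / (T s powr (- k)
        * Z s) powr (1 / n)) F"
    proof eventually_elim
      case (elim s)
      have "(T s powr (- k) * Z s) powr (1 / n) = T s powr (- k / n) * Z s powr (1 / n)"
        using elim by (simp add: powr_mult powr_powr)
      moreover have "- k / n = - (k - 1)" using k_n n_gt_1 by (simp add: field_simps)
      moreover have "Z s powr (- 1 / n) = 1 / Z s powr (1 / n)"
        using powr_minus_divide[of "Z s" "1 / n"] by simp
      ultimately show ?case using elim by simp
    qed
  qed
qed

end

section \<open>From similarity profiles to flows\<close>

definition similarity_flow :: "real \<Rightarrow> (real \<Rightarrow> real) \<Rightarrow> real \<Rightarrow> real \<Rightarrow> real" where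
  "similarity_flow k U t x = t powr (k - 1) * U (t powr (- k) * x)"

text \<open>What the \<open>(u, c)\<close>-system becomes for the profiles.\<close>
definition smooth_profile :: "real \<Rightarrow> real \<Rightarrow> real set \<Rightarrow> (real \<Rightarrow> real) \<Rightarrow> (real \<Rightarrow> real) \<Rightarrow> bool" where
  "smooth_profile l k D U S \<longleftrightarrow> (\<exists>U1 S1. continuous_on D U1 \<and> continuous_on D S1 \<and>
     (\<forall>\<xi>\<in>D. (U has_real_derivative U1 \<xi>) (at \<xi>) \<and> (S has_real_derivative S1 \<xi>) (at \<xi>) \<and>
        (U \<xi> - k * \<xi>) * U1 \<xi> + l * S \<xi> * S1 \<xi> = - (k - 1) * U \<xi> \<and>
        (U \<xi> - k * \<xi>) * S1 \<xi> + inverse l * S \<xi> * U1 \<xi> = - (k - 1) * S \<xi>))"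

text \<open>
  The Rankine--Hugoniot conditions in the frame of the shock: continuity of the mass flux
  \<open>\<rho> w\<close> and of \<open>\<rho> w\<^sup>2 + p\<close>, with \<open>w = u - s\<close>, \<open>p = \<rho> c\<^sup>2 / \<gamma>\<close> and \<open>\<rho>\<close> proportional to \<open>c\<^sup>\<ell>\<close>.  In this
  form they are visibly homogeneous, hence invariant under the self-similar scaling in time.
\<close>
definition profile_shock :: "real \<Rightarrow> real \<Rightarrow> (real \<Rightarrow> real) \<Rightarrow> (real \<Rightarrow> real) \<Rightarrow> real \<Rightarrow> bool" where
  "profile_shock \<gamma> s U S z \<longleftrightarrow> (\<exists>um cm up cp.
     (U \<longlongrightarrow> um) (at_left z) \<and> (S \<longlongrightarrow> cm) (at_left z) \<and>
     (U \<longlongrightarrow> up) (at_right z) \<and> (S \<longlongrightarrow> cp) (at_right z) \<and> cm > 0 \<and> cp > 0 \<and>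
     cm powr ell \<gamma> * (um - s) = cp powr ell \<gamma> * (up - s) \<and>
     cm powr ell \<gamma> * ((um - s)\<^sup>2 + cm\<^sup>2 / \<gamma>) = cp powr ell \<gamma> * ((up - s)\<^sup>2 + cp\<^sup>2 / \<gamma>) \<and>
     um + cm > s \<and> s > up + cp)"

lemma pressure_density:
  assumes "a > 0" "\<gamma> > 1" "c > 0"
  shows "pressure a \<gamma> (density a \<gamma> c) = density a \<gamma> c * (c\<^sup>2 / \<gamma>)"
proof -
  define \<rho> where "\<rho> = density a \<gamma> c"
  have pos: "\<rho> > 0"
    using assms by (simp add: \<rho>_def density_def)
  have e: "ell \<gamma> * (\<gamma> - 1) = 2"
    unfolding ell_def using assms by (subst times_divide_eq_left, subst nonzero_divide_eq_eq) auto
  have "\<rho> powr (\<gamma> - 1) = (a * sqrt \<gamma>) powr (- ell \<gamma> * (\<gamma> - 1)) * c powr (ell \<gamma> * (\<gamma> - 1))"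
    using assms by (simp add: \<rho>_def density_def powr_mult powr_powr)
  also have "\<dots> = (a * sqrt \<gamma>) powr (- 2) * c powr 2"
    using e by simp
  also have "\<dots> = c\<^sup>2 / (a\<^sup>2 * \<gamma>)"
    using assms by (simp add: powr_minus divide_simps power_mult_distrib)
  finally have "\<rho> powr (\<gamma> - 1) = c\<^sup>2 / (a\<^sup>2 * \<gamma>)" .
  moreover have "\<rho> powr \<gamma> = \<rho> powr (\<gamma> - 1) * \<rho>" using pos by (simp add: powr_diff)
  ultimately have "a\<^sup>2 * \<rho> powr \<gamma> = \<rho> * (c\<^sup>2 / \<gamma>)" using assms by simp
  then show ?thesis by (simp add: pressure_def flip: \<rho>_def)
qed

lemma rankine_hugoniot_relative:
  assumes "a > 0" "\<gamma> > 1" "cm > 0" "cp > 0"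
    and mass: "cm powr ell \<gamma> * (um - s) = cp powr ell \<gamma> * (up - s)"
    and momentum: "cm powr ell \<gamma> * ((um - s)\<^sup>2 + cm\<^sup>2 / \<gamma>) = cp powr ell \<gamma> * ((up - s)\<^sup>2 + cp\<^sup>2 / \<gamma>)"
  shows "rankine_hugoniot a \<gamma> s um cm up cp"
proof -
  define A where "A = (a * sqrt \<gamma>) powr (- ell \<gamma>)"
  define m p where "m = density a \<gamma> cm" and "p = density a \<gamma> cp"
  have mp: "m = A * cm powr ell \<gamma>" "p = A * cp powr ell \<gamma>" by (simp_all add:
      m_def p_def A_def density_def)
  have 1: "m * (um - s) = p * (up - s)" unfolding mp using mass by simp
  have 2: "m * ((um - s)\<^sup>2 + cm\<^sup>2 / \<gamma>) = p * ((up - s)\<^sup>2 + cp\<^sup>2 / \<gamma>)"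
      unfolding mp using momentum by simp
  have e1: "s * (p - m) = p * up - m * um" using 1 by (simp add: algebra_simps)
  then have e2: "s * s * (p - m) = s * (p * up - m * um)" by simp
  have e3: "m * um\<^sup>2 - 2 * s * (m * um) + s * s * m + m * (cm\<^sup>2 / \<gamma>) = p * up\<^sup>2 - 2 * s * (p * up)
      + s * s * p + p * (cp\<^sup>2 / \<gamma>)"
    using 2 by (simp add: power2_eq_square algebra_simps)
  have "s * (p * up - m * um) = (p * up\<^sup>2 + p * (cp\<^sup>2 / \<gamma>)) - (m * um\<^sup>2 + m * (cm\<^sup>2 / \<gamma>))"
    using e2 e3 by (simp add: algebra_simps)
  then show ?thesis
    unfolding rankine_hugoniot_def Let_def m_def[symmetric] p_def[symmetric]
    using e1 pressure_density[OF assms(1,2,3)] pressure_density[OF assms(1,2,4)] by (simp flip: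
        m_def p_def)
qed

lemma similarity_scaling:
  fixes t x k z :: real
  assumes "t > 0"
  shows "z < t powr (- k) * x \<longleftrightarrow> t powr k * z < x" "t powr (- k) * x < z \<longleftrightarrow> x < t powr k * z"
    "t powr (- k) * x = z \<longleftrightarrow> x = t powr k * z" "t powr (- k) * (t powr k * z) = z"
proof -
  have p: "t powr k > 0" "t powr (- k) = inverse (t powr k)" using assms by (auto simp: powr_minus)
  show "z < t powr (- k) * x \<longleftrightarrow> t powr k * z < x" "t powr (- k) * x < z \<longleftrightarrow> x < t powr k * z"
    "t powr (- k) * x = z \<longleftrightarrow> x = t powr k * z" "t powr (- k) * (t powr k * z) = z"
    unfolding p(2) using p(1) by (auto simp: field_simps)
qed

lemma similarity_filterlim:
  fixes t k z :: real
  assumes "t > 0"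
  shows "filterlim (\<lambda>x. t powr (- k) * x) (at_left z) (at_left (t powr k * z))"
    and "filterlim (\<lambda>x. t powr (- k) * x) (at_right z) (at_right (t powr k * z))"
proof -
  have l: "((\<lambda>x. t powr (- k) * x) \<longlongrightarrow> t powr (- k) * (t powr k * z)) (at (t powr k * z) within A)" for A
    by (intro tendsto_intros)
  show "filterlim (\<lambda>x. t powr (- k) * x) (at_left z) (at_left (t powr k * z))"
    unfolding filterlim_at
  proof
    show "((\<lambda>x. t powr (- k) * x) \<longlongrightarrow> z) (at_left (t powr k * z))"
      using l similarity_scaling(4)[OF assms, of k z] by simp
    have "eventually (\<lambda>x. x < t powr k * z) (at_left (t powr k * z))" by (simp add:
        eventually_at_filter)
    then show "\<forall>\<^sub>F x in at_left (t powr k * z). t powr (- k) * x \<in> {..<z} \<and> t powr (- k) * x \<noteq> z"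
      by eventually_elim (use similarity_scaling[OF assms] in force)
  qed
  show "filterlim (\<lambda>x. t powr (- k) * x) (at_right z) (at_right (t powr k * z))"
    unfolding filterlim_at
  proof
    show "((\<lambda>x. t powr (- k) * x) \<longlongrightarrow> z) (at_right (t powr k * z))"
      using l similarity_scaling(4)[OF assms, of k z] by simp
    have "eventually (\<lambda>x. x > t powr k * z) (at_right (t powr k * z))" by (simp add:
        eventually_at_filter)
    then show "\<forall>\<^sub>F x in at_right (t powr k * z). t powr (- k) * x \<in> {z<..} \<and> t powr (- k) * x \<noteq> z"
      by eventually_elim (use similarity_scaling[OF assms] in force)
  qed
qed

lemma similarity_flow_tendsto:
  assumes "t > 0"
  shows "(U \<longlongrightarrow> L) (at_left z) \<Longrightarrow> (similarity_flow k U t \<longlongrightarrow> t powr (k - 1) * L) (at_left (t powr k * z))"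
    and "(U \<longlongrightarrow> L) (at_right z) \<Longrightarrow> (similarity_flow k U t \<longlongrightarrow> t powr (k - 1) * L) (at_right (t powr k * z))"
  unfolding similarity_flow_def[abs_def]
  by (intro tendsto_mult_left filterlim_compose[OF _ similarity_filterlim(1)[OF assms]], assumption)
     (intro tendsto_mult_left filterlim_compose[OF _ similarity_filterlim(2)[OF assms]], assumption)

lemma similarity_flow_isCont:
  assumes "t > 0" "isCont U (t powr (- k) * x)"
  shows "isCont (\<lambda>(t, x). similarity_flow k U t x) (t, x)"
proof -
  have c: "isCont (\<lambda>p::real \<times> real. fst p powr e) (t, x)" for e
    using assms(1) by (intro continuous_intros) auto
  have "isCont (\<lambda>p::real \<times> real. fst p powr (- k) * snd p) (t, x)"
    by (intro continuous_mult c continuous_snd continuous_ident)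
  then have "isCont (\<lambda>p. U (fst p powr (- k) * snd p)) (t, x)"
    by (rule isCont_o2) (use assms in simp)
  then have "isCont (\<lambda>p. fst p powr (k - 1) * U (fst p powr (- k) * snd p)) (t, x)"
    by (intro continuous_mult c)
  then show ?thesis by (simp add: similarity_flow_def case_prod_unfold)
qed

lemma similarity_flow_isCont_space:
  assumes "t > 0" "isCont U (t powr (- k) * x)"
  shows "isCont (similarity_flow k U t) x"
  unfolding similarity_flow_def[abs_def]
  by (intro continuous_mult continuous_const isCont_o2[where g=U and f="\<lambda>x. t powr (- k)
      * x"] continuous_ident assms(2))

lemma similarity_flow_deriv:
  assumes "t > 0" "(U has_real_derivative d) (at (t powr (- k) * x))"
  defines "\<xi> \<equiv> t powr (- k) * x"
  shows "((\<lambda>\<tau>. similarity_flow k U \<tau> x) has_real_derivative t powr (k - 2) * ((k - 1)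
      * U \<xi> - k * \<xi> * d)) (at t)"
    and "(similarity_flow k U t has_real_derivative d / t) (at x)"
    and "((\<lambda>(t, x). similarity_flow k U t x) has_derivative
       (\<lambda>(h, j). t powr (k - 2) * ((k - 1) * U \<xi> - k * \<xi> * d) * h + d / t * j)) (at (t, x))"
proof -
  have dp: "((\<lambda>\<tau>. \<tau> powr e) has_real_derivative e * t powr (e - 1)) (at t)" for e
    using assms(1) by (auto intro!: derivative_eq_intros)
  have tx: "t powr (- k - 1) * x = \<xi> / t" using assms(1) by (simp add: \<xi>_def powr_diff)
  have tk: "t powr (k - 1) / t = t powr (k - 2)" using assms(1) powr_diff[of t "k - 1" 1] by simp
  have tk': "t powr (k - 1 - 1) = t powr (k - 2)" by simp
  have di: "((\<lambda>\<tau>. \<tau> powr (- k) * x) has_real_derivative - k * \<xi> / t) (at t)"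
    using DERIV_cmult_right[OF dp[of "- k"], of x] tx by (simp add: mult.assoc)
  have "((\<lambda>\<tau>. U (\<tau> powr (- k) * x)) has_real_derivative d * (- k * \<xi> / t)) (at t)"
    by (rule DERIV_chain2[OF _ di]) (use assms in simp)
  from DERIV_mult[OF dp[of "k - 1"] this]
  have "((\<lambda>\<tau>. similarity_flow k U \<tau> x) has_real_derivative
     (k - 1) * t powr (k - 1 - 1) * U \<xi> + d * (- k * \<xi> / t) * t powr (k - 1)) (at t)"
    unfolding similarity_flow_def \<xi>_def .
  moreover have ft: "(k - 1) * t powr (k - 1 - 1) * U \<xi> + d * (- k * \<xi> / t) * t powr (k - 1) =
      t powr (k - 2) * ((k - 1) * U \<xi> - k * \<xi> * d)"
    unfolding tk' tk[symmetric] using assms(1) by (simp add: field_simps)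
  ultimately show "((\<lambda>\<tau>. similarity_flow k U \<tau> x) has_real_derivative t powr (k - 2) * ((k - 1)
      * U \<xi> - k * \<xi> * d)) (at t)" by simp
  have dx: "((\<lambda>y. t powr (- k) * y) has_real_derivative t powr (- k)) (at x)"
    by (auto intro!: derivative_eq_intros)
  have "((\<lambda>y. U (t powr (- k) * y)) has_real_derivative d * t powr (- k)) (at x)"
    by (rule DERIV_chain2[OF _ dx]) (use assms in simp)
  from DERIV_cmult[OF this, of "t powr (k - 1)"]
  have "(similarity_flow k U t has_real_derivative t powr (k - 1) * (d * t powr (- k))) (at x)"
    unfolding similarity_flow_def[abs_def] .
  moreover have fx: "t powr (k - 1) * (d * t powr (- k)) = d / t"
    using assms(1) by (simp add: powr_diff powr_minus field_simps)
  ultimately show "(similarity_flow k U t has_real_derivative d / t) (at x)" by simp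
  let ?e = "fst :: real \<times> real \<Rightarrow> real"
  have hp: "((\<lambda>p. ?e p powr e) has_derivative (\<lambda>p. fst p * (e * t powr (e - 1)))) (at (t, x))" for e
  proof -
    have "((\<lambda>\<tau>. \<tau> powr e) has_derivative (\<lambda>h. h * (e * t powr (e - 1)))) (at (fst (t, x)))"
      using dp[of e] by (simp add: has_field_derivative_def mult_commute_abs)
    from has_derivative_compose[OF has_derivative_fst[OF has_derivative_ident] this]
    show ?thesis by simp
  qed
  have "((\<lambda>p. ?e p powr (- k) * snd p) has_derivative
      (\<lambda>p. t powr (- k) * snd p + fst p * (- k * t powr (- k - 1)) * x)) (at (t, x))"
    using has_derivative_mult[OF hp[of "- k"] has_derivative_snd[OF has_derivative_ident]] by simp
  moreover have "(U has_derivative (\<lambda>h. d * h)) (at (fst (t, x) powr (- k) * snd (t, x)))"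
    using assms(2) by (simp add: has_field_derivative_def)
  ultimately have "((\<lambda>p. U (?e p powr (- k) * snd p)) has_derivative
      (\<lambda>p. d * (t powr (- k) * snd p + fst p * (- k * t powr (- k - 1)) * x))) (at (t, x))"
    by (rule has_derivative_compose)
  from has_derivative_mult[OF hp[of "k - 1"] this]
  have "((\<lambda>p. ?e p powr (k - 1) * U (?e p powr (- k) * snd p)) has_derivative
      (\<lambda>p. t powr (k - 1) * (d * (t powr (- k) * snd p + fst p * (- k * t powr (- k - 1)) * x))
        + fst p * ((k - 1) * t powr (k - 1 - 1)) * U \<xi>)) (at (t, x))"
    by (simp add: \<xi>_def)
  moreover have "(\<lambda>p. t powr (k - 1) * (d * (t powr (- k) * snd p + fst p * (- k * t powr (- k - 1))
      * x))
        + fst p * ((k - 1) * t powr (k - 1 - 1)) * U \<xi>)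
     = (\<lambda>(h, j). t powr (k - 2) * ((k - 1) * U \<xi> - k * \<xi> * d) * h + d / t * j)"
  proof
    fix p :: "real \<times> real"
    have "t powr (k - 1) * (d * (t powr (- k) * snd p + fst p * (- k * t powr (- k - 1)) * x))
        + fst p * ((k - 1) * t powr (k - 1 - 1)) * U \<xi>
      = t powr (k - 1) * (d * t powr (- k)) * snd p
        + ((k - 1) * t powr (k - 1 - 1) * U \<xi> + d * (- k * (t powr (- k - 1) * x)) * t powr (k - 1))
            * fst p"
      by (simp add: algebra_simps)
    also have "\<dots> = d / t * snd p + t powr (k - 2) * ((k - 1) * U \<xi> - k * \<xi> * d) * fst p"
      unfolding fx tx using ft by simp
    finally show "t powr (k - 1) * (d * (t powr (- k) * snd p + fst p * (- k * t powr (- k - 1)) * x))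
        + fst p * ((k - 1) * t powr (k - 1 - 1)) * U \<xi>
      = (case p of (h, j) \<Rightarrow> t powr (k - 2) * ((k - 1) * U \<xi> - k * \<xi> * d) * h + d / t * j)"
      by (simp add: case_prod_unfold)
  qed
  ultimately show "((\<lambda>(t, x). similarity_flow k U t x) has_derivative
       (\<lambda>(h, j). t powr (k - 2) * ((k - 1) * U \<xi> - k * \<xi> * d) * h + d / t * j)) (at (t, x))"
    by (simp add: similarity_flow_def case_prod_unfold)
qed

lemma similarity_flow_C1_on:
  assumes U1: "continuous_on D U1" and dU: "\<And>\<xi>. \<xi> \<in> D \<Longrightarrow> (U has_real_derivative U1 \<xi>) (at \<xi>)"
    and W: "\<And>t x. (t, x) \<in> W \<Longrightarrow> t > 0 \<and> t powr (- k) * x \<in> D"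
  shows "C1_on (similarity_flow k U) W"
proof -
  let ?x = "\<lambda>p::real \<times> real. fst p powr (- k) * snd p"
  have Wp: "fst p > 0 \<and> ?x p \<in> D" if "p \<in> W" for p using W[of "fst p" "snd p"] that by simp
  have cU: "continuous_on D U" using dU by (auto intro!: continuous_at_imp_continuous_on DERIV_isCont)
  have cp: "continuous_on W (\<lambda>p. fst p powr e)" for e
    by (intro continuous_on_powr continuous_intros) (use Wp in force)
  have cx: "continuous_on W ?x" by (intro continuous_intros cp)
  have im: "?x ` W \<subseteq> D" using Wp by auto
  have c1: "continuous_on W (\<lambda>p. U (?x p))" "continuous_on W (\<lambda>p. U1 (?x p))"
    by (rule continuous_on_compose2[OF cU cx im], rule continuous_on_compose2[OF U1 cx im])
  have "continuous_on W (\<lambda>p. fst p powr (k - 2) * ((k - 1) * U (?x p) - k * ?x p * U1 (?x p)))"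
    by (intro continuous_on_mult continuous_on_diff continuous_on_const cp c1 cx)
  moreover have "continuous_on W (\<lambda>p. U1 (?x p) / fst p)"
    by (intro continuous_on_divide c1 continuous_intros) (use Wp in force)
  moreover have "((\<lambda>(t, x). similarity_flow k U t x) has_derivative
     (\<lambda>(h, j). fst p powr (k - 2) * ((k - 1) * U (?x p) - k * ?x p * U1 (?x p)) * h + U1 (?x p)
         / fst p * j)) (at p)"
    if p: "p \<in> W" for p
    using similarity_flow_deriv(3)[of "fst p" U "U1 (?x p)" k "snd p"] Wp[OF p] dU by auto
  ultimately show ?thesis unfolding C1_on_def by blast
qed

lemma similarity_flow_uc_system:
  assumes "t > 0" "\<xi> = t powr (- k) * x"
    and "(U has_real_derivative U1) (at \<xi>)" "(S has_real_derivative S1) (at \<xi>)"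
    and "(U \<xi> - k * \<xi>) * U1 + ell \<gamma> * S \<xi> * S1 = - (k - 1) * U \<xi>"
    and "(U \<xi> - k * \<xi>) * S1 + inverse (ell \<gamma>) * S \<xi> * U1 = - (k - 1) * S \<xi>"
  shows "uc_system \<gamma> (similarity_flow k U) (similarity_flow k S) t x"
proof -
  have dU: "deriv (\<lambda>\<tau>. similarity_flow k U \<tau> x) t = t powr (k - 2) * ((k - 1) * U \<xi> - k * \<xi> * U1)"
    "deriv (\<lambda>y. similarity_flow k U t y) x = U1 / t"
    using similarity_flow_deriv(1,2)[of t U U1 k x] assms by (auto intro!: DERIV_imp_deriv)
  have dS: "deriv (\<lambda>\<tau>. similarity_flow k S \<tau> x) t = t powr (k - 2) * ((k - 1) * S \<xi> - k * \<xi> * S1)"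
    "deriv (\<lambda>y. similarity_flow k S t y) x = S1 / t"
    using similarity_flow_deriv(1,2)[of t S S1 k x] assms by (auto intro!: DERIV_imp_deriv)
  have v: "similarity_flow k U t x = t powr (k - 2) * t * U \<xi>" "similarity_flow k S t x =
      t powr (k - 2) * t * S \<xi>"
    using assms(1,2) by (auto simp: similarity_flow_def powr_diff power2_eq_square)
  have q1: "t powr (k - 2) * ((k - 1) * U \<xi> - k * \<xi> * U1) + t powr (k - 2) * t * U \<xi> * (U1 / t)
      + ell \<gamma> * (t powr (k - 2) * t * S \<xi>) * (S1 / t)
     = t powr (k - 2) * ((U \<xi> - k * \<xi>) * U1 + ell \<gamma> * S \<xi> * S1 + (k - 1) * U \<xi>)"
    using assms(1) by (simp add: algebra_simps)
  have q2: "t powr (k - 2) * ((k - 1) * S \<xi> - k * \<xi> * S1) + t powr (k - 2) * t * U \<xi> * (S1 / t)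
      + inverse (ell \<gamma>) * (t powr (k - 2) * t * S \<xi>) * (U1 / t)
     = t powr (k - 2) * ((U \<xi> - k * \<xi>) * S1 + inverse (ell \<gamma>) * S \<xi> * U1 + (k - 1) * S \<xi>)"
    using assms(1) by (simp add: algebra_simps)
  show ?thesis unfolding uc_system_def dU dS v q1 q2 assms(5,6) by (simp add: algebra_simps)
qed

lemma similarity_flow_decay:
  assumes "t > 0" "K > 0" and lim: "((\<lambda>\<xi>. S \<xi> / (\<xi> - z) powr e) \<longlongrightarrow> K) (at_right z)"
  shows "decay_exponent (similarity_flow k S t) (t powr k * z) e"
  unfolding decay_exponent_def
proof (intro exI[of _ "t powr (k - 1 - k * e) * K"] conjI)
  let ?f = "\<lambda>x. t powr (- k) * x"
  have "((\<lambda>x. S (?f x) / (?f x - z) powr e) \<longlongrightarrow> K) (at_right (t powr k * z))"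
    by (rule filterlim_compose[OF lim similarity_filterlim(2)[OF assms(1)]])
  then have "((\<lambda>x. t powr (k - 1 - k * e) * (S (?f x) / (?f x - z) powr e)) \<longlongrightarrow> t powr (k - 1 - k * e)
      * K) (at_right (t powr k * z))"
    by (rule tendsto_mult_left)
  then show "((\<lambda>x. similarity_flow k S t x / (x - t powr k * z) powr e) \<longlongrightarrow> t powr (k - 1 - k * e)
      * K) (at_right (t powr k * z))"
  proof (rule Lim_transform_eventually)
    have "eventually (\<lambda>x. x > t powr k * z) (at_right (t powr k * z))" by (simp add:
        eventually_at_filter)
    then show "\<forall>\<^sub>F x in at_right (t powr k * z). t powr (k - 1 - k * e) * (S (?f x) / (?f x - z)
        powr e) = similarity_flow k S t x / (x - t powr k * z) powr e"
    proof eventually_elim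
      case (elim x)
      have "?f x - z = t powr (- k) * (x - t powr k * z)"
        using similarity_scaling(4)[OF assms(1), of k z] by (simp add: right_diff_distrib)
      then have "(?f x - z) powr e = t powr (- k * e) * (x - t powr k * z) powr e"
        using elim assms(1) by (simp add: powr_mult powr_powr)
      moreover have "t powr (k - 1 - k * e) = t powr (k - 1) * t powr (- k * e)"
        using assms(1) by (simp flip: powr_add)
      ultimately show ?case using assms(1) by (simp add: similarity_flow_def)
    qed
  qed
qed (use assms in simp)

lemma similarity_flow_initial:
  assumes "k > 0" "x > 0" and lim: "((\<lambda>\<xi>. U \<xi> / \<xi> powr (1 - 1 / k)) \<longlongrightarrow> A) at_top"
  shows "((\<lambda>t. similarity_flow k U t x) \<longlongrightarrow> A * x powr (1 - 1 / k)) (at_right 0)"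
proof -
  have t0: "eventually (\<lambda>t::real. t > 0) (at_right 0)" by (simp add: eventually_at_right_less)
  have "((\<lambda>t::real. t powr k) \<longlongrightarrow> 0 powr k) (at_right 0)"
    by (rule tendsto_powr'[OF tendsto_ident_at tendsto_const])
       (use assms(1) in \<open>auto intro: eventually_mono[OF eventually_at_right_less]\<close>)
  then have "filterlim (\<lambda>t::real. inverse (t powr k)) at_top (at_right 0)"
    by (intro filterlim_inverse_at_top) (auto intro: eventually_mono[OF eventually_at_right_less])
  then have "filterlim (\<lambda>t. t powr (- k)) at_top (at_right 0)" by (simp add: powr_minus)
  then have f: "filterlim (\<lambda>t. t powr (- k) * x) at_top (at_right 0)"
    using filterlim_tendsto_pos_mult_at_top[OF tendsto_const assms(2)] by (simp add: mult.commute)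
  have "((\<lambda>t. U (t powr (- k) * x) / (t powr (- k) * x) powr (1 - 1 / k) * x powr (1 - 1 / k))
      \<longlongrightarrow> A * x powr (1 - 1 / k)) (at_right 0)"
    by (intro tendsto_mult_right filterlim_compose[OF lim f])
  then show ?thesis
  proof (rule Lim_transform_eventually)
    show "\<forall>\<^sub>F t in at_right 0. U (t powr (- k) * x) / (t powr (- k) * x) powr (1 - 1 / k)
        * x powr (1 - 1 / k) = similarity_flow k U t x"
      using t0
    proof eventually_elim
      case (elim t)
      have "(t powr (- k) * x) powr (1 - 1 / k) = t powr (- k * (1 - 1 / k)) * x powr (1 - 1 / k)"
        using elim assms by (simp add: powr_mult powr_powr)
      also have "- k * (1 - 1 / k) = - (k - 1)" using assms(1) by (simp add: field_simps)
      finally have e: "(t powr (- k) * x) powr (1 - 1 / k) = t powr (- (k - 1)) * x powr (1 - 1 / k)" .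
      have "t powr (- (k - 1)) = inverse (t powr (k - 1))" "x powr (1 - 1 / k) \<noteq> 0"
        using assms powr_minus[of t "k - 1"] by simp_all
      then show ?case unfolding e similarity_flow_def using elim
        by (simp add: divide_inverse mult.commute[of _ "t powr (k - 1)"])
    qed
  qed
qed

lemma isCont_slice:
  assumes "isCont (\<lambda>(t, x). f t x) (t, x)"
  shows "isCont (f t) x"
proof -
  have "isCont (\<lambda>y. (case (t, y) of (t, x) \<Rightarrow> f t x)) x"
    by (rule isCont_o2[where g="\<lambda>(t, x). f t x" and f="\<lambda>y. (t, y)"]) (use assms in \<open>auto intro!:
        continuous_intros\<close>)
  then show ?thesis by simp
qed

text \<open>
  The second part holds because the entropy condition forbids the two one-sided states to coincide.
\<close>
lemma shock2_similarity_flow: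
  assumes "a > 0" "\<gamma> > 1" "t > 0" and shock: "profile_shock \<gamma> (k * z) U S z"
  shows "shock2 a \<gamma> (similarity_flow k U) (similarity_flow k S) (\<lambda>\<tau>. \<tau> powr k * z) t"
    and "\<not> (isCont (\<lambda>(t, x). similarity_flow k U t x) (t, t powr k * z) \<and>
            isCont (\<lambda>(t, x). similarity_flow k S t x) (t, t powr k * z))"
proof -
  obtain um cm up cp where lim: "(U \<longlongrightarrow> um) (at_left z)" "(S \<longlongrightarrow> cm) (at_left z)"
     "(U \<longlongrightarrow> up) (at_right z)" "(S \<longlongrightarrow> cp) (at_right z)" and pos: "cm > 0" "cp > 0"
    and mass: "cm powr ell \<gamma> * (um - k * z) = cp powr ell \<gamma> * (up - k * z)"
    and mom: "cm powr ell \<gamma> * ((um - k * z)\<^sup>2 + cm\<^sup>2 / \<gamma>) = cp powr ell \<gamma> * ((up - k * z)\<^sup>2 + cp\<^sup>2 / \<gamma>)"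
    and ent: "um + cm > k * z" "k * z > up + cp"
    using shock unfolding profile_shock_def by blast
  define \<tau> where "\<tau> = t powr (k - 1)"
  have \<tau>: "\<tau> > 0" using assms by (simp add: \<tau>_def)
  have ds: "((\<lambda>\<tau>. \<tau> powr k * z) has_real_derivative \<tau> * (k * z)) (at t)"
    unfolding \<tau>_def using assms(3) by (auto intro!: derivative_eq_intros)
  have pw: "(\<tau> * c) powr ell \<gamma> = \<tau> powr ell \<gamma> * c powr ell \<gamma>" if "c > 0" for c
    using \<tau> that by (simp add: powr_mult)
  have "(\<tau> * cm) powr ell \<gamma> * (\<tau> * um - \<tau> * (k * z)) = \<tau> powr ell \<gamma> * \<tau> * (cm powr ell \<gamma> * (um - k *
      z))"
    unfolding pw[OF pos(1)] by (simp add: algebra_simps)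
  also have "\<dots> = (\<tau> * cp) powr ell \<gamma> * (\<tau> * up - \<tau> * (k * z))"
    unfolding pw[OF pos(2)] mass by (simp add: algebra_simps)
  finally have mass': "(\<tau> * cm) powr ell \<gamma> * (\<tau> * um - \<tau> * (k * z)) = (\<tau> * cp)
      powr ell \<gamma> * (\<tau> * up - \<tau> * (k * z))" .
  have hom: "(\<tau> * v - \<tau> * s)\<^sup>2 + (\<tau> * c)\<^sup>2 / \<gamma> = \<tau>\<^sup>2 * ((v - s)\<^sup>2 + c\<^sup>2 / \<gamma>)" for v s c
    by (simp add: power2_eq_square algebra_simps)
  have mom': "(\<tau> * cm) powr ell \<gamma> * ((\<tau> * um - \<tau> * (k * z))\<^sup>2 + (\<tau> * cm)\<^sup>2 / \<gamma>)
      = (\<tau> * cp) powr ell \<gamma> * ((\<tau> * up - \<tau> * (k * z))\<^sup>2 + (\<tau> * cp)\<^sup>2 / \<gamma>)"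
    unfolding hom pw[OF pos(1)] pw[OF pos(2)] using mom by simp
  have RH: "rankine_hugoniot a \<gamma> (\<tau> * (k * z)) (\<tau> * um) (\<tau> * cm) (\<tau> * up) (\<tau> * cp)"
    by (rule rankine_hugoniot_relative[OF assms(1,2) _ _ mass' mom']) (use pos \<tau> in auto)
  have E: "entropy2 (\<tau> * (k * z)) (\<tau> * um) (\<tau> * cm) (\<tau> * up) (\<tau> * cp)"
    unfolding entropy2_def using ent \<tau> by (simp flip: distrib_left)
  have lim': "(similarity_flow k U t \<longlongrightarrow> \<tau> * um) (at_left (t powr k * z))"
    "(similarity_flow k S t \<longlongrightarrow> \<tau> * cm) (at_left (t powr k * z))"
    "(similarity_flow k U t \<longlongrightarrow> \<tau> * up) (at_right (t powr k * z))"
    "(similarity_flow k S t \<longlongrightarrow> \<tau> * cp) (at_right (t powr k * z))"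
    unfolding \<tau>_def using similarity_flow_tendsto[OF assms(3)] lim by blast+
  show "shock2 a \<gamma> (similarity_flow k U) (similarity_flow k S) (\<lambda>\<tau>. \<tau> powr k * z) t"
    unfolding shock_with_def using ds lim' RH E by blast
  show "\<not> (isCont (\<lambda>(t, x). similarity_flow k U t x) (t, t powr k * z) \<and>
            isCont (\<lambda>(t, x). similarity_flow k S t x) (t, t powr k * z))"
  proof
    assume c: "isCont (\<lambda>(t, x). similarity_flow k U t x) (t, t powr k * z) \<and>
            isCont (\<lambda>(t, x). similarity_flow k S t x) (t, t powr k * z)"
    have eq: "p = q" if "isCont f y" "(f \<longlongrightarrow> p) (at_left y)" "(f \<longlongrightarrow> q) (at_right y)" for f ::
        "real \<Rightarrow> real" and p q y
    proof -
      have "(f \<longlongrightarrow> f y) (at_left y)" "(f \<longlongrightarrow> f y) (at_right y)"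
        using that(1) by (simp_all add: isCont_def filterlim_at_split)
      then show ?thesis using that tendsto_unique by (metis trivial_limit_at_left_real
          trivial_limit_at_right_real)
    qed
    have "\<tau> * um = \<tau> * up" "\<tau> * cm = \<tau> * cp"
      using eq[OF isCont_slice[where f="similarity_flow k U"] lim'(1,3)]
        eq[OF isCont_slice[where f="similarity_flow k S"] lim'(2,4)] c by blast+
    then have "um = up" "cm = cp" using \<tau> by auto
    then show False using ent by simp
  qed
qed

text \<open>
  The bridge from ordinary to partial differential equations.  The curves in the definition of a
  solution are the rays \<open>x = z t\<^sup>k\<close> with \<open>z\<close> in \<open>Z\<close>; off them the chain rule applies.  For fixed \<open>x \<noteq> 0\<close>
  the limit \<open>t \<rightarrow> 0\<close> is the limit \<open>\<xi> \<rightarrow> \<plusminus>\<infinity>\<close>, so the far field of the profiles gives the initial data.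
\<close>
lemma self_similar_solution:
  assumes a: "a > 0" and g: "\<gamma> > 1" and k: "k > 1"
    and S0: "\<And>\<xi>. \<xi> \<le> \<xi>v \<Longrightarrow> S \<xi> = 0" and Spos: "\<And>\<xi>. \<xi> > \<xi>v \<Longrightarrow> S \<xi> > 0"
    and Slim: "(S \<longlongrightarrow> 0) (at_right \<xi>v)"
    and Z: "finite Z" "0 \<notin> Z" "Z \<subseteq> {\<xi>v<..}"
    and smooth: "smooth_profile (ell \<gamma>) k ({\<xi>v<..} - Z) U S"
    and jump: "\<And>z. z \<in> Z \<Longrightarrow> (isCont U z \<and> isCont S z) \<or> profile_shock \<gamma> (k * z) U S z"
    and far: "((\<lambda>\<xi>. U \<xi> / \<xi> powr (1 - 1 / k)) \<longlongrightarrow> uinf) at_top"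
      "((\<lambda>\<xi>. S \<xi> / \<xi> powr (1 - 1 / k)) \<longlongrightarrow> cinf) at_top"
  defines "X \<equiv> (\<lambda>t. t powr k * \<xi>v)"
  shows "euler_solution a \<gamma> (\<lambda>x. uinf * x powr (1 - 1 / k)) (\<lambda>x. if x > 0 then cinf * x powr (1 - 1
      / k) else 0)
      X (similarity_flow k U) (similarity_flow k S)"
    and "discontinuities X (similarity_flow k U) (similarity_flow k S)
      = {(t, t powr k * z) | t z. t > 0 \<and> z \<in> Z \<and> \<not> (isCont U z \<and> isCont S z)}"
    and "self_similar (1 / k) X (similarity_flow k U) (similarity_flow k S)
      (\<lambda>\<xi>. - (1 / k) * U \<xi> / \<xi>) (\<lambda>\<xi>. - (1 / k) * S \<xi> / \<xi>)"
proof -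
  let ?u = "similarity_flow k U" and ?c = "similarity_flow k S"
  let ?\<xi> = "\<lambda>t x::real. t powr (- k) * x"
  let ?D = "{\<xi>v<..} - Z"
  obtain U1 S1 where cont1: "continuous_on ?D U1" "continuous_on ?D S1"
    and d: "\<And>\<xi>. \<xi> \<in> ?D \<Longrightarrow> (U has_real_derivative U1 \<xi>) (at \<xi>) \<and> (S has_real_derivative S1 \<xi>) (at \<xi>) \<and>
        (U \<xi> - k * \<xi>) * U1 \<xi> + ell \<gamma> * S \<xi> * S1 \<xi> = - (k - 1) * U \<xi> \<and>
        (U \<xi> - k * \<xi>) * S1 \<xi> + inverse (ell \<gamma>) * S \<xi> * U1 \<xi> = - (k - 1) * S \<xi>"
    using smooth unfolding smooth_profile_def by blast
  have cont: "isCont U \<xi> \<and> isCont S \<xi>" if "\<xi> \<in> ?D" for \<xi> using d[OF that] DERIV_isCont by blast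
  have fluid: "(t, x) \<in> fluid X \<longleftrightarrow> t > 0 \<and> \<xi>v < ?\<xi> t x" for t x
    unfolding fluid_def X_def using similarity_scaling(1) by auto
  let ?\<Gamma> = "(\<lambda>z t. t powr k * z) ` Z"
  let ?W = "fluid X - (\<Union>\<sigma>\<in>?\<Gamma>. {(t, \<sigma> t) | t. t > 0})"
  have W: "t > 0 \<and> ?\<xi> t x \<in> ?D" if "(t, x) \<in> ?W" for t x
  proof -
    have t: "t > 0" "\<xi>v < ?\<xi> t x" using that fluid by auto
    moreover have "?\<xi> t x \<notin> Z"
    proof
      assume z: "?\<xi> t x \<in> Z"
      define z0 where "z0 = ?\<xi> t x"
      have "x = t powr k * z0" using similarity_scaling(3)[OF t(1), of k x z0] by (simp add: z0_def)
      moreover have "z0 \<in> Z" using z by (simp add: z0_def)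
      ultimately have "(t, x) \<in> (\<Union>\<sigma>\<in>?\<Gamma>. {(t, \<sigma> t) | t. t > 0})" using t by blast
      then show False using that by simp
    qed
    ultimately show ?thesis by simp
  qed
  have ic: "isCont (\<lambda>(t, x). ?u t x) (t, x) \<and> isCont (\<lambda>(t, x). ?c t x) (t, x)"
    if "t > 0" "isCont U (?\<xi> t x) \<and> isCont S (?\<xi> t x)" for t x
    using similarity_flow_isCont that by blast
  show disc: "discontinuities X ?u ?c = {(t, t powr k * z) | t z. t > 0 \<and> z \<in> Z \<and> \<not> (isCont U z \<and>
      isCont S z)}"
  proof (intro equalityI subsetI)
    fix p assume p: "p \<in> discontinuities X ?u ?c"
    obtain t x where tx: "p = (t, x)" by (cases p)
    have t: "t > 0" "\<xi>v < ?\<xi> t x" using p fluid unfolding discontinuities_def tx by auto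
    have n: "\<not> (isCont U (?\<xi> t x) \<and> isCont S (?\<xi> t x))" using p ic[OF t(1)] unfolding
        discontinuities_def tx by auto
    then have "?\<xi> t x \<in> Z" using cont t by blast
    moreover have "x = t powr k * ?\<xi> t x" using similarity_scaling(3)[OF t(1), of k x "?\<xi> t x"] by simp
    ultimately show "p \<in> {(t, t powr k * z) | t z. t > 0 \<and> z \<in> Z \<and> \<not> (isCont U z \<and> isCont S z)}"
      unfolding tx using n t(1) by blast
  next
    fix p assume "p \<in> {(t, t powr k * z) | t z. t > 0 \<and> z \<in> Z \<and> \<not> (isCont U z \<and> isCont S z)}"
    then obtain t z where p: "p = (t, t powr k * z)" "t > 0" "z \<in> Z" "\<not> (isCont U z \<and> isCont S z)"
        by blast
    have "profile_shock \<gamma> (k * z) U S z" using jump p by blast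
    from shock2_similarity_flow(2)[OF a g p(2) this]
    show "p \<in> discontinuities X ?u ?c"
    proof -
      have "(t, t powr k * z) \<in> fluid X"
        unfolding fluid similarity_scaling(4)[OF p(2)] using p Z(3) by auto
      then show "\<not> (isCont (\<lambda>(t, x). ?u t x) (t, t powr k * z) \<and> isCont (\<lambda>(t, x). ?c t x) (t,
          t powr k * z)) \<Longrightarrow>
        p \<in> discontinuities X ?u ?c"
        unfolding discontinuities_def p(1) by blast
    qed
  qed
  show "self_similar (1 / k) X ?u ?c (\<lambda>\<xi>. - (1 / k) * U \<xi> / \<xi>) (\<lambda>\<xi>. - (1 / k) * S \<xi> / \<xi>)"
    unfolding self_similar_def
  proof (intro conjI allI impI)
    fix t x :: real assume t: "t > 0" and x: "x \<noteq> 0"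
    have k1: "- 1 / (1 / k) = - k" "1 / (1 / k) = k" using k by auto
    have p: "t powr (k - 1) = t powr k / t" "t powr (- k) = inverse (t powr k)"
        using t by (auto simp: powr_diff powr_minus)
    have f: "- (1 / (1 / k)) * (x / t) * (- (1 / k) * F (?\<xi> t x) / ?\<xi> t x) = t powr (k - 1)
        * F (?\<xi> t x)" for F :: "real \<Rightarrow> real"
      using k t x by (simp add: p field_simps)
    show "?c t x = - (1 / (1 / k)) * (x / t) * (- (1 / k) * S (t powr (- 1 / (1 / k)) * x)
        / (t powr (- 1 / (1 / k)) * x))"
      "?u t x = - (1 / (1 / k)) * (x / t) * (- (1 / k) * U (t powr (- 1 / (1 / k)) * x)
          / (t powr (- 1 / (1 / k)) * x))"
      unfolding k1(1) f similarity_flow_def by auto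
  next
    fix t :: real assume t: "t > 0" and "X t < 0"
    then have "\<xi>v < 0" unfolding X_def by (simp add: mult_less_0_iff)
    then have "isCont U (?\<xi> t 0)" "isCont S (?\<xi> t 0)" using cont[of 0] Z by auto
    then show "(?u t \<longlongrightarrow> ?u t 0) (at 0)" "(?c t \<longlongrightarrow> ?c t 0) (at 0)"
      using similarity_flow_isCont_space[OF t] by (auto simp: isCont_def)
  qed
  show "euler_solution a \<gamma> (\<lambda>x. uinf * x powr (1 - 1 / k)) (\<lambda>x. if x > 0 then cinf * x powr (1 - 1 /
      k) else 0) X ?u ?c"
    unfolding euler_solution_def
  proof (intro conjI allI impI)
    show "continuous_on {0<..} X" unfolding X_def by (intro continuous_intros) auto
    fix t :: real assume t: "t > 0"
    show "?c t x = 0" if "x \<le> X t" for x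
      using S0[of "?\<xi> t x"] similarity_scaling(1)[OF t, of \<xi>v k x] that by (simp add:
          similarity_flow_def X_def)
    show "?c t x > 0" if "x > X t" for x
      using Spos[of "?\<xi> t x"] similarity_scaling(1)[OF t, of \<xi>v k x] that t by (simp add:
          similarity_flow_def X_def)
    show "(?c t \<longlongrightarrow> 0) (at_right (X t))"
      using similarity_flow_tendsto(2)[OF t Slim, of k] by (simp add: X_def)
  next
    show "\<exists>\<Gamma>. finite \<Gamma> \<and> (\<forall>\<sigma>\<in>\<Gamma>. \<forall>t>0. \<sigma> differentiable (at t)) \<and>
        (let W = fluid X - (\<Union>\<sigma>\<in>\<Gamma>. {(t, \<sigma> t) | t. t > 0}) in
           C1_on ?u W \<and> C1_on ?c W \<and> (\<forall>(t, x)\<in>W. uc_system \<gamma> ?u ?c t x)) \<and>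
        (\<forall>\<sigma>\<in>\<Gamma>. \<forall>t>0. (t, \<sigma> t) \<in> discontinuities X ?u ?c \<longrightarrow>
           shock1 a \<gamma> ?u ?c \<sigma> t \<or> shock2 a \<gamma> ?u ?c \<sigma> t)"
    proof (intro exI[of _ ?\<Gamma>] conjI)
      show "finite ?\<Gamma>" using Z by simp
      show "\<forall>\<sigma>\<in>?\<Gamma>. \<forall>t>0. \<sigma> differentiable (at t)"
      proof (intro ballI allI impI)
        fix \<sigma> and t :: real assume t: "t > 0" and "\<sigma> \<in> ?\<Gamma>"
        then obtain z where z: "\<sigma> = (\<lambda>t. t powr k * z)" by auto
        from t have "((\<lambda>t. t powr k * z) has_real_derivative k * t powr (k - 1) * z) (at t)"
          by (auto intro!: derivative_eq_intros)
        then show "\<sigma> differentiable (at t)" unfolding z using real_differentiable_def by blast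
      qed
      show "let W = ?W in C1_on ?u W \<and> C1_on ?c W \<and> (\<forall>(t, x)\<in>W. uc_system \<gamma> ?u ?c t x)"
        unfolding Let_def
      proof (intro conjI)
        show "C1_on ?u ?W" by (rule similarity_flow_C1_on[OF cont1(1)]) (use d W in blast)+
        show "C1_on ?c ?W" by (rule similarity_flow_C1_on[OF cont1(2)]) (use d W in blast)+
        show "\<forall>(t, x)\<in>?W. uc_system \<gamma> ?u ?c t x"
        proof (rule ballI, rule prod.case_eq_if[THEN iffD2])
          fix p assume "p \<in> ?W"
          then have w: "fst p > 0" "?\<xi> (fst p) (snd p) \<in> ?D" using W[of "fst p"
              "snd p"] by (auto simp only: prod.collapse)
          show "uc_system \<gamma> ?u ?c (fst p) (snd p)"
            by (rule similarity_flow_uc_system[OF w(1) refl]) (use d[OF w(2)] in auto)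
        qed
      qed
      show "\<forall>\<sigma>\<in>?\<Gamma>. \<forall>t>0. (t, \<sigma> t) \<in> discontinuities X ?u ?c \<longrightarrow>
           shock1 a \<gamma> ?u ?c \<sigma> t \<or> shock2 a \<gamma> ?u ?c \<sigma> t"
      proof (intro ballI allI impI disjI2)
        fix \<sigma> t assume s: "\<sigma> \<in> ?\<Gamma>" and t: "(t::real) > 0" and dd: "(t, \<sigma> t) \<in> discontinuities X ?u ?c"
        obtain z where z: "z \<in> Z" "\<sigma> = (\<lambda>t. t powr k * z)" using s by auto
        from dd obtain t' z' where z': "(t, \<sigma> t) = (t', t' powr k * z')" "\<not> (isCont U z' \<and>
            isCont S z')" unfolding disc by blast
        then have "z' = z" using t z by auto
        then have "profile_shock \<gamma> (k * z) U S z" using z' jump z by blast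
        from shock2_similarity_flow(1)[OF a g t this] show "shock2 a \<gamma> ?u ?c \<sigma> t" unfolding z(2) .
      qed
    qed
  next
    fix x :: real assume x: "x > 0"
    show "((\<lambda>t. ?u t x) \<longlongrightarrow> uinf * x powr (1 - 1 / k)) (at_right 0)"
      using similarity_flow_initial[OF _ x far(1)] k by simp
  next
    fix x :: real assume x: "x \<noteq> 0"
    show "((\<lambda>t. ?c t x) \<longlongrightarrow> (if x > 0 then cinf * x powr (1 - 1 / k) else 0)) (at_right 0)"
    proof (cases "x > 0")
      case True
      then show ?thesis using similarity_flow_initial[OF _ True far(2)] k by simp
    next
      case False
      have x0: "x < 0" using False x by simp
      have "((\<lambda>t::real. t powr k * \<xi>v) \<longlongrightarrow> 0 powr k * \<xi>v) (at_right 0)"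
        by (intro tendsto_mult_right tendsto_powr'[OF tendsto_ident_at tendsto_const])
           (use k in \<open>auto intro: eventually_mono[OF eventually_at_right_less]\<close>)
      then have "eventually (\<lambda>t::real. x < t powr k * \<xi>v) (at_right 0)"
        by (rule order_tendstoD) (use x0 in simp)
      then have "eventually (\<lambda>t. 0 = ?c t x) (at_right 0)"
        using eventually_at_right_less[of "0::real"]
      proof eventually_elim
        case (elim t)
        then show ?case using S0[of "?\<xi> t x"] similarity_scaling(2)[OF elim(2), of k x \<xi>v]
          by (simp add: similarity_flow_def)
      qed
      then show ?thesis using False by (auto intro: Lim_transform_eventually[OF tendsto_const])
    qed
  qed
qed

section \<open>The wave next to the far field and the wave next to the vacuum\<close>

context self_similar_exponents
begin

lemma one_over_k: "1 - 1 / n = 1 / k"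
  using k_n k_gt_1 n_gt_1 conj_exp by (auto simp: field_simps)

lemma fast_slow_velocity: "fast P Q = (P + Q) / 2 + (P - Q) / (2 * l)" "slow P Q = (P + Q)
    / 2 - (P - Q) / (2 * l)"
  using l_gt_1 by (auto simp: fast_def slow_def alpha_def beta_def field_simps)

lemma char_wave_smooth_profile:
  assumes "char_wave D P Q"
  shows "smooth_profile l k D (\<lambda>\<xi>. (P \<xi> + Q \<xi>) / 2) (\<lambda>\<xi>. (P \<xi> - Q \<xi>) / (2 * l))"
proof -
  define P1 Q1 where "P1 = (\<lambda>\<xi>. - (k - 1) * P \<xi> / (fast (P \<xi>) (Q \<xi>) - k * \<xi>))"
    and "Q1 = (\<lambda>\<xi>. - (k - 1) * Q \<xi> / (slow (P \<xi>) (Q \<xi>) - k * \<xi>))"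
  have d: "(P has_real_derivative P1 \<xi>) (at \<xi>)" "(Q has_real_derivative Q1 \<xi>) (at \<xi>)"
    "fast (P \<xi>) (Q \<xi>) - k * \<xi> \<noteq> 0" "slow (P \<xi>) (Q \<xi>) - k * \<xi> \<noteq> 0" if "\<xi> \<in> D" for \<xi>
    using assms that unfolding char_wave_def P1_def Q1_def by auto
  have c: "continuous_on D P" "continuous_on D Q"
    using d DERIV_isCont by (blast intro: continuous_at_imp_continuous_on)+
  have c1: "continuous_on D P1" "continuous_on D Q1"
    unfolding P1_def Q1_def fast_def slow_def
    by (intro continuous_intros c; use d in \<open>simp add: fast_def slow_def\<close>)+
  show ?thesis
    unfolding smooth_profile_def
  proof (rule exI[of _ "\<lambda>\<xi>. (P1 \<xi> + Q1 \<xi>) / 2"], rule exI[of _ "\<lambda>\<xi>. (P1 \<xi> - Q1 \<xi>) / (2 * l)"],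
      intro conjI ballI)
    show "continuous_on D (\<lambda>\<xi>. (P1 \<xi> + Q1 \<xi>) / 2)" "continuous_on D (\<lambda>\<xi>. (P1 \<xi> - Q1 \<xi>) / (2 * l))"
      using c1 l_gt_1 by (auto intro!: continuous_intros)
    fix \<xi> assume \<xi>: "\<xi> \<in> D"
    show "((\<lambda>\<xi>. (P \<xi> + Q \<xi>) / 2) has_real_derivative (P1 \<xi> + Q1 \<xi>) / 2) (at \<xi>)"
      "((\<lambda>\<xi>. (P \<xi> - Q \<xi>) / (2 * l)) has_real_derivative (P1 \<xi> - Q1 \<xi>) / (2 * l)) (at \<xi>)"
      using d[OF \<xi>] by (auto intro!: DERIV_cdivide DERIV_add DERIV_diff)
    define U S where "U = (P \<xi> + Q \<xi>) / 2" and "S = (P \<xi> - Q \<xi>) / (2 * l)"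
    have 1: "(U + S - k * \<xi>) * P1 \<xi> = - (k - 1) * P \<xi>" "(U - S - k * \<xi>) * Q1 \<xi> = - (k - 1) * Q \<xi>"
      using d[OF \<xi>] unfolding P1_def Q1_def fast_slow_velocity U_def[symmetric] S_def[symmetric] by auto
    have PQ: "P \<xi> = U + l * S" "Q \<xi> = U - l * S" using l_gt_1 by (auto simp: U_def S_def field_simps)
    have l0: "l \<noteq> 0" using l_gt_1 by simp
    have "(U - k * \<xi>) * ((P1 \<xi> + Q1 \<xi>) / 2) + l * S * ((P1 \<xi> - Q1 \<xi>) / (2 * l))
       = ((U + S - k * \<xi>) * P1 \<xi> + (U - S - k * \<xi>) * Q1 \<xi>) / 2"
      using l0 by (simp add: field_simps)
    also have "\<dots> = - (k - 1) * U" unfolding 1 PQ by (simp add: field_simps)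
    finally show "((P \<xi> + Q \<xi>) / 2 - k * \<xi>) * ((P1 \<xi> + Q1 \<xi>) / 2) + l * ((P \<xi> - Q \<xi>) / (2 * l))
        * ((P1 \<xi> - Q1 \<xi>) / (2 * l))
       = - (k - 1) * ((P \<xi> + Q \<xi>) / 2)" unfolding U_def S_def .
    have "(U - k * \<xi>) * ((P1 \<xi> - Q1 \<xi>) / (2 * l)) + inverse l * S * ((P1 \<xi> + Q1 \<xi>) / 2)
       = ((U + S - k * \<xi>) * P1 \<xi> - (U - S - k * \<xi>) * Q1 \<xi>) / (2 * l)"
      using l0 by (simp add: field_simps)
    also have "\<dots> = - (k - 1) * S" unfolding 1 PQ using l0 by (simp add: field_simps)
    finally show "((P \<xi> + Q \<xi>) / 2 - k * \<xi>) * ((P1 \<xi> - Q1 \<xi>) / (2 * l)) + inverse l * ((P \<xi> - Q \<xi>)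
        / (2 * l)) * ((P1 \<xi> + Q1 \<xi>) / 2)
       = - (k - 1) * ((P \<xi> - Q \<xi>) / (2 * l))" unfolding U_def S_def .
  qed
qed

lemma smooth_profile_cong:
  assumes "smooth_profile l k D U S" "open D" "\<And>\<xi>. \<xi> \<in> D \<Longrightarrow> U \<xi> = U' \<xi> \<and> S \<xi> = S' \<xi>"
  shows "smooth_profile l k D U' S'"
proof -
  obtain U1 S1 where h: "continuous_on D U1" "continuous_on D S1"
     "\<And>\<xi>. \<xi> \<in> D \<Longrightarrow> (U has_real_derivative U1 \<xi>) (at \<xi>) \<and> (S has_real_derivative S1 \<xi>) (at \<xi>) \<and>
        (U \<xi> - k * \<xi>) * U1 \<xi> + l * S \<xi> * S1 \<xi> = - (k - 1) * U \<xi> \<and>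
        (U \<xi> - k * \<xi>) * S1 \<xi> + inverse l * S \<xi> * U1 \<xi> = - (k - 1) * S \<xi>"
    using assms(1) unfolding smooth_profile_def by blast
  have "(U' has_real_derivative U1 \<xi>) (at \<xi>) \<and> (S' has_real_derivative S1 \<xi>) (at \<xi>)" if "\<xi> \<in> D" for \<xi>
    using h(3)[OF that] has_field_derivative_transform_within_open[OF _ assms(2) that] assms(3) by blast
  then show ?thesis unfolding smooth_profile_def using h assms(3) by metis
qed

lemma smooth_profile_Un:
  assumes "smooth_profile l k A U S" "smooth_profile l k B U S" "open A" "open B" "A \<inter> B = {}"
  shows "smooth_profile l k (A \<union> B) U S"
proof -
  obtain U1 S1 where h: "continuous_on A U1" "continuous_on A S1"
     "\<And>\<xi>. \<xi> \<in> A \<Longrightarrow> (U has_real_derivative U1 \<xi>) (at \<xi>) \<and> (S has_real_derivative S1 \<xi>) (at \<xi>) \<and>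
        (U \<xi> - k * \<xi>) * U1 \<xi> + l * S \<xi> * S1 \<xi> = - (k - 1) * U \<xi> \<and>
        (U \<xi> - k * \<xi>) * S1 \<xi> + inverse l * S \<xi> * U1 \<xi> = - (k - 1) * S \<xi>"
    using assms(1) unfolding smooth_profile_def by blast
  obtain U2 S2 where g: "continuous_on B U2" "continuous_on B S2"
     "\<And>\<xi>. \<xi> \<in> B \<Longrightarrow> (U has_real_derivative U2 \<xi>) (at \<xi>) \<and> (S has_real_derivative S2 \<xi>) (at \<xi>) \<and>
        (U \<xi> - k * \<xi>) * U2 \<xi> + l * S \<xi> * S2 \<xi> = - (k - 1) * U \<xi> \<and>
        (U \<xi> - k * \<xi>) * S2 \<xi> + inverse l * S \<xi> * U2 \<xi> = - (k - 1) * S \<xi>"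
    using assms(2) unfolding smooth_profile_def by blast
  have c: "continuous_on (A \<union> B) (\<lambda>\<xi>. if \<xi> \<in> A then f \<xi> else g \<xi>)"
    if "continuous_on A f" "continuous_on B g" for f g :: "real \<Rightarrow> real"
  proof (rule continuous_on_open_Un[OF assms(3,4)])
    show "continuous_on A (\<lambda>\<xi>. if \<xi> \<in> A then f \<xi> else g \<xi>)" using that(1) by (simp cong:
        continuous_on_cong)
    show "continuous_on B (\<lambda>\<xi>. if \<xi> \<in> A then f \<xi> else g \<xi>)"
      using that(2) assms(5) by (subst continuous_on_cong[OF refl, where g=g]) auto
  qed
  show ?thesis unfolding smooth_profile_def
    by (intro exI[of _ "\<lambda>\<xi>. if \<xi> \<in> A then U1 \<xi> else U2 \<xi>"] exI[of _ "\<lambda>\<xi>. if \<xi> \<in> A then S1 \<xi> else S2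
        \<xi>"] conjI c h g ballI)
       (use h(3) g(3) in auto)
qed

text \<open>
  The system is invariant under multiplying \<open>\<xi>\<close>, \<open>P\<close> and \<open>Q\<close> by the same factor \<open>h\<close>.  A curve fixes
  only the ratio of the initial values of \<open>u\<close> and \<open>c\<close>, that is the Mach number; \<open>h\<close> adjusts their
  size.
\<close>
lemma right_wave_normalised:
  assumes curve: "char_curve s1 s2 X P Q" and lim: "(X \<longlongrightarrow> a) (at_left s2)"
    and T: "(T \<longlongrightarrow> 0) (at_right s1)" "eventually (\<lambda>s. T s > 0) (at_right s1)"
    and Z: "(Z \<longlongrightarrow> Z0) (at_right s1)" "Z0 > 0"
    and X: "eventually (\<lambda>s. X s = T s powr (- k) * Z s) (at_right s1)"
    and P: "eventually (\<lambda>s. P s = p s * T s powr (- (k - 1))) (at_right s1)" "(p \<longlongrightarrow> p0) (at_right s1)"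
    and Q: "eventually (\<lambda>s. Q s = q s * T s powr (- (k - 1))) (at_right s1)" "(q \<longlongrightarrow> q0) (at_right s1)"
    and g: "g > 0"
  shows "\<exists>h>0. \<exists>\<iota>. char_wave {h * a<..} (\<lambda>\<xi>. h * P (\<iota> \<xi>)) (\<lambda>\<xi>. h * Q (\<iota> \<xi>)) \<and>
     filterlim \<iota> (at_left s2) (at_right (h * a)) \<and> (\<forall>\<xi>>h * a. h * X (\<iota> \<xi>) = \<xi>) \<and>
     ((\<lambda>\<xi>. h * P (\<iota> \<xi>) / \<xi> powr (1 / n)) \<longlongrightarrow> g * p0) at_top \<and>
     ((\<lambda>\<xi>. h * Q (\<iota> \<xi>) / \<xi> powr (1 / n)) \<longlongrightarrow> g * q0) at_top"
proof -
  (* The invariants divided by the power 1/n of the position scale with h to the power 1 - 1/n = 1/k. *)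
  define h where "h = (g * Z0 powr (1 / n)) powr k"
  have h: "h > 0" using g Z by (simp add: h_def)
  have hk: "h powr (1 / k) = g * Z0 powr (1 / n)"
    using g Z k_gt_1 by (simp add: h_def powr_powr)
  have hg: "h / h powr (1 / n) * Z0 powr (- 1 / n) = g"
  proof -
    have "h / h powr (1 / n) = h powr (1 - 1 / n)" using h by (simp add: powr_diff)
    also have "\<dots> = g * Z0 powr (1 / n)" unfolding one_over_k hk ..
    finally show ?thesis using Z powr_minus_divide[of Z0 "1 / n"] by simp
  qed
  have curve': "char_curve s1 s2 (\<lambda>s. h * X s) (\<lambda>s. h * P s) (\<lambda>s. h * Q s)"
    by (rule char_curve_scale[OF curve h])
  have lim': "((\<lambda>s. h * X s) \<longlongrightarrow> h * a) (at_left s2)" by (intro tendsto_mult_left lim)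
  note ff = far_field[OF T Z]
  have "filterlim X at_top (at_right s1)"
    using filterlim_cong[OF refl refl X] ff(1) by simp
  then have top: "filterlim (\<lambda>s. h * X s) at_top (at_right s1)"
    by (rule filterlim_tendsto_pos_mult_at_top[OF tendsto_const h])
  obtain \<iota> where i: "char_wave {h * a<..} (\<lambda>\<xi>. h * P (\<iota> \<xi>)) (\<lambda>\<xi>. h * Q (\<iota> \<xi>))"
      "\<forall>\<xi>>h * a. h * X (\<iota> \<xi>) = \<xi>"
    "filterlim \<iota> (at_left s2) (at_right (h * a))" "filterlim \<iota> (at_right s1) at_top"
    using wave_of_curve_unbounded[OF curve' lim' top] by blast
  have main: "((\<lambda>\<xi>. h * R (\<iota> \<xi>) / \<xi> powr (1 / n)) \<longlongrightarrow> g * z0) at_top"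
    if R: "eventually (\<lambda>s. R s = z s * T s powr (- (k - 1))) (at_right s1)" "(z \<longlongrightarrow> z0) (at_right s1)"
        for R z z0
  proof -
    have "((\<lambda>s. h / h powr (1 / n) * (z s * (T s powr (- (k - 1)) / (T s powr (- k) * Z s)
        powr (1 / n)))) \<longlongrightarrow>
        h / h powr (1 / n) * (z0 * Z0 powr (- 1 / n))) (at_right s1)"
      by (intro tendsto_mult_left tendsto_mult R ff(2))
    moreover have "h / h powr (1 / n) * (z0 * Z0 powr (- 1 / n)) = g * z0" using hg by (simp add:
        mult.commute mult.left_commute)
    ultimately have "((\<lambda>s. h / h powr (1 / n) * (z s * (T s powr (- (k - 1)) / (T s powr (- k)
        * Z s) powr (1 / n)))) \<longlongrightarrow> g * z0) (at_right s1)"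
      by simp
    then have "((\<lambda>s. h * R s / (h * X s) powr (1 / n)) \<longlongrightarrow> g * z0) (at_right s1)"
    proof (rule Lim_transform_eventually)
      have "eventually (\<lambda>s. Z s > 0) (at_right s1)" using Z by (rule order_tendstoD)
      then show "eventually (\<lambda>s. h / h powr (1 / n) * (z s * (T s powr (- (k - 1)) / (T s powr (- k)
          * Z s) powr (1 / n)))
           = h * R s / (h * X s) powr (1 / n)) (at_right s1)"
        using X R(1) T(2)
      proof eventually_elim
        case (elim s)
        have "(h * X s) powr (1 / n) = h powr (1 / n) * (T s powr (- k) * Z s) powr (1 / n)"
          unfolding elim(2) using h elim by (subst powr_mult) auto
        then show ?case unfolding elim(3) by simp
      qed
    qed
    then have "((\<lambda>\<xi>. h * R (\<iota> \<xi>) / (h * X (\<iota> \<xi>)) powr (1 / n)) \<longlongrightarrow> g * z0) at_top"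
      by (rule filterlim_compose[OF _ i(4)])
    then show ?thesis
    proof (rule Lim_transform_eventually)
      show "eventually (\<lambda>\<xi>. h * R (\<iota> \<xi>) / (h * X (\<iota> \<xi>)) powr (1 / n) = h * R (\<iota> \<xi>) / \<xi> powr (1 / n))
          at_top"
        using eventually_gt_at_top[of "h * a"] by eventually_elim (use i(2) in simp)
    qed
  qed
  show ?thesis using h i main[OF P] main[OF Q] by blast
qed

text \<open>
  The vacuum wave as a graph over \<open>r\<close>.  For \<open>r \<le> 0\<close> it is continued by the sonic line, from which the
  vacuum wave departs at \<open>r = 0\<close>.  This continuation makes the intermediate value argument for the
  shock work for left states with \<open>r \<le> 0\<close> as well.
\<close>
definition reg_ratio :: "real \<Rightarrow> real" where
  "reg_ratio r = (if r > 0 then pos_ratio regT regN r else beta + alpha * r)"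

lemma reg_ratio_gt: "0 < r \<Longrightarrow> r < 1 \<Longrightarrow> beta + alpha * r < reg_ratio r"
proof -
  assume r: "0 < r" "r < 1"
  have "pos_ratio regT regN r - (beta + alpha * r) = r * (1 - r) * regT1 r / (l * (n - 1) * regT r)"
    using regT_sum regT_pos r by (intro pos_ratio_alt) auto
  also have "\<dots> > 0" using r regT1_pos[of r] regT_pos[of r] l_gt_1 n_gt_1 by simp
  finally show ?thesis using r by (simp add: reg_ratio_def)
qed

lemma reg_ratio_pos: "0 \<le> r \<Longrightarrow> r < 1 \<Longrightarrow> reg_ratio r > 0"
proof -
  assume r: "0 \<le> r" "r < 1"
  have "beta + alpha * r > 0" using beta_pos alpha_pos r by (simp add: add_pos_nonneg)
  then show ?thesis using reg_ratio_gt[of r] r by (cases "r = 0") (auto simp: reg_ratio_def)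
qed

lemma regN_isCont: "r > 0 \<Longrightarrow> isCont regN r" and regT_isCont: "r > 0 \<Longrightarrow> isCont regT r"
  using regN_deriv regT_deriv DERIV_isCont by blast+

lemma pos_ratio_reg_isCont: "r > 0 \<Longrightarrow> isCont (pos_ratio regT regN) r"
  unfolding pos_ratio_def[abs_def] using regT_pos[of r] l_gt_1 n_gt_1
  by (intro continuous_intros regN_isCont regT_isCont) auto

lemma regT_tendsto_0: "(regT \<longlongrightarrow> regT 0) (at_right 0)"
proof -
  have "(regT \<longlongrightarrow> regT 0) (at 0 within {0..})" using regT_continuous by (auto simp: continuous_on_def)
  then show ?thesis by (rule tendsto_within_subset) auto
qed

text \<open>
  At \<open>r = 0\<close> all waves that arrive there with \<open>r T' \<rightarrow> 0\<close> have the same value \<open>beta\<close> of \<open>k \<xi> / Q\<close>,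
  and \<open>P = 0\<close>.  This is why waves from the two sides of \<open>r = 0\<close> fit together.
\<close>
lemma pos_ratio_node:
  assumes "(T \<longlongrightarrow> T0) F" "T0 > 0" "((\<lambda>r. r * T1 r) \<longlongrightarrow> 0) F" "((\<lambda>r. r) \<longlongrightarrow> 0) F"
    and "eventually (\<lambda>r. r * T1 r = N r + (n - 1) * T r \<and> T r > 0) F"
  shows "(pos_ratio T N \<longlongrightarrow> beta) F"
proof -
  have "((\<lambda>r. beta + alpha * r + (1 - r) * (r * T1 r) / (l * (n - 1) * T r))
      \<longlongrightarrow> beta + alpha * 0 + (1 - 0) * 0 / (l * (n - 1) * T0)) F"
    by (intro tendsto_intros assms) (use assms(2) l_gt_1 n_gt_1 in auto)
  then have "((\<lambda>r. beta + alpha * r + (1 - r) * (r * T1 r) / (l * (n - 1) * T r)) \<longlongrightarrow> beta) F" by simp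
  then show ?thesis
  proof (rule Lim_transform_eventually)
    show "eventually (\<lambda>r. beta + alpha * r + (1 - r) * (r * T1 r) / (l * (n - 1) * T r) =
        pos_ratio T N r) F"
      using assms(5)
    proof eventually_elim
      case (elim r)
      then have "pos_ratio T N r - (beta + alpha * r) = r * (1 - r) * T1 r / (l * (n - 1) * T r)"
        by (intro pos_ratio_alt) auto
      then show ?case by (simp add: mult_ac)
    qed
  qed
qed

lemma reg_ratio_isCont: "r < 1 \<Longrightarrow> isCont reg_ratio r"
proof -
  assume r: "r < 1"
  consider "r > 0" | "r = 0" | "r < 0" by linarith
  then show ?thesis
  proof cases
    case 1
    have "eventually (\<lambda>x. x > 0) (nhds r)" using 1 by (intro eventually_nhds_in_open[of "{0<..}",
        simplified]) auto
    then have "eventually (\<lambda>x. reg_ratio x = pos_ratio regT regN x) (nhds r)"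
      by eventually_elim (simp add: reg_ratio_def)
    then show ?thesis using pos_ratio_reg_isCont[OF 1] isCont_cong by blast
  next
    case 3
    have "eventually (\<lambda>x. x < 0) (nhds r)" using 3 by (intro eventually_nhds_in_open[of "{..<0}",
        simplified]) auto
    then have "eventually (\<lambda>x. reg_ratio x = beta + alpha * x) (nhds r)"
      by eventually_elim (simp add: reg_ratio_def)
    from isCont_cong[OF this] show ?thesis by (simp add: continuous_intros)
  next
    case 2
    have "(pos_ratio regT regN \<longlongrightarrow> beta) (at_right 0)"
    proof (rule pos_ratio_node[OF regT_tendsto_0 _ regT1_weighted_tendsto tendsto_ident_at])
      show "eventually (\<lambda>r. r * regT1 r = regN r + (n - 1) * regT r \<and> regT r > 0) (at_right 0)"
        using eventually_at_right_less[of "0::real"] by eventually_elim (use regT_sum regT_pos in auto)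
    qed (use regT_pos in auto)
    then have "(reg_ratio \<longlongrightarrow> beta) (at_right 0)"
      by (rule Lim_transform_eventually)
         (use eventually_at_right_less[of "0::real"] in \<open>auto elim!: eventually_mono simp:
             reg_ratio_def\<close>)
    moreover have "(reg_ratio \<longlongrightarrow> beta) (at_left 0)"
    proof (rule Lim_transform_eventually)
      show "((\<lambda>x. beta + alpha * x) \<longlongrightarrow> beta) (at_left 0)" by (auto intro!: tendsto_eq_intros)
      show "\<forall>\<^sub>F x in at_left 0. beta + alpha * x = reg_ratio x"
        by (simp add: eventually_at_filter reg_ratio_def)
    qed
    ultimately show ?thesis unfolding 2 isCont_def by (simp add: filterlim_at_split reg_ratio_def)
  qed
qed

text \<open>
  The derivative of \<open>\<xi>\<close> with respect to \<open>r\<close> carries a factor \<open>1 - r\<close>, because both characteristic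
  speeds equal \<open>k \<xi>\<close> at the vacuum.  So \<open>\<xi>\<close> is quadratic in \<open>1 - r\<close> there while the sound speed is
  linear.  The wave may start at any ratio \<open>r' < 1\<close> and is scaled to start at the point \<open>zm\<close>.
\<close>
lemma vacuum_wave:
  assumes r': "0 \<le> r'" "r' < 1" and zm: "zm < 0"
  shows "\<exists>\<xi>v<zm. \<exists>P Q. char_wave {\<xi>v<..<zm} P Q \<and>
    (P \<longlongrightarrow> r' * (k * zm / reg_ratio r')) (at_left zm) \<and> (Q \<longlongrightarrow> k * zm / reg_ratio r') (at_left zm) \<and>
    (\<exists>K>0. ((\<lambda>\<xi>. (P \<xi> - Q \<xi>) / (2 * l) / (\<xi> - \<xi>v) powr (1 / 2)) \<longlongrightarrow> K) (at_right \<xi>v))"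
proof -
  let ?X = "\<lambda>r. - (amp regT r * pos_ratio regT regN r / k)"
  let ?P = "\<lambda>r. - (r * amp regT r)" let ?Q = "\<lambda>r. - amp regT r"
  have sol: "hodograph_sol {r'<..<1} regT regT1 regN"
    using regT_hodograph r' unfolding hodograph_sol_def by auto
  have curve: "char_curve r' 1 ?X ?P ?Q"
    by (rule curve_left_moving[OF sol]) (use r' regT_pos regT1_pos regN_neg in auto)
  have Tr': "(regT \<longlongrightarrow> regT r') (at_right r')"
    using regT_tendsto_0 regT_isCont[of r'] r' by (cases "r' = 0") (auto simp:
        isCont_def filterlim_at_split)
  have Gr': "(amp regT \<longlongrightarrow> amp regT r') (at_right r')"
    unfolding amp_def[abs_def] using regT_pos[OF r'(1)] by (intro tendsto_powr Tr' tendsto_const) auto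
  have Yr': "(pos_ratio regT regN \<longlongrightarrow> reg_ratio r') (at_right r')"
  proof (rule Lim_transform_eventually)
    show "(reg_ratio \<longlongrightarrow> reg_ratio r') (at_right r')"
      using reg_ratio_isCont[OF r'(2)] by (simp add: isCont_def filterlim_at_split)
    show "\<forall>\<^sub>F x in at_right r'. reg_ratio x = pos_ratio regT regN x"
      using eventually_at_right_less[of r'] by eventually_elim (use r' in \<open>simp add: reg_ratio_def\<close>)
  qed
  define X0 where "X0 = - (amp regT r' * reg_ratio r' / k)"
  have G0: "amp regT r' > 0" by (rule amp_pos[of regT r', OF regT_pos[OF r'(1)]])
  have X0: "X0 < 0" unfolding X0_def using G0 reg_ratio_pos[OF r'] k_gt_1 by simp
  define h where "h = zm / X0"
  have h: "h > 0" unfolding h_def using X0 zm by (simp add: divide_neg_neg)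
  have hX0: "h * X0 = zm" unfolding h_def using X0 by simp
  define X1 where "X1 = ?X 1"
  have G1: "isCont (amp regT) 1" "amp regT 1 > 0"
    unfolding amp_def[abs_def] using regT_pos[of 1] by (auto intro!: continuous_intros regT_isCont)
  have cX: "isCont ?X 1" using k_gt_1 by (intro continuous_intros G1 pos_ratio_reg_isCont) auto
  have lim0: "(?X \<longlongrightarrow> X0) (at_right r')" unfolding X0_def using k_gt_1 by (intro tendsto_intros Gr'
      Yr') auto
  have lim1: "(?X \<longlongrightarrow> X1) (at_left 1)" using cX by (simp add: isCont_def filterlim_at_split X1_def)
  obtain \<iota> where i: "char_wave {h * X1<..<h * X0} (\<lambda>\<xi>. h * ?P (\<iota> \<xi>)) (\<lambda>\<xi>. h * ?Q (\<iota> \<xi>))"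
      "h * X1 < h * X0"
     "\<forall>\<xi>. h * X1 < \<xi> \<longrightarrow> \<xi> < h * X0 \<longrightarrow> h * ?X (\<iota> \<xi>) = \<xi>"
     "filterlim \<iota> (at_left 1) (at_right (h * X1))" "filterlim \<iota> (at_right r') (at_left (h * X0))"
    using wave_of_curve_bounded[OF char_curve_scale[OF curve h] tendsto_mult_left[OF lim1]
        tendsto_mult_left[OF lim0]] by blast
  have Ql: "((\<lambda>\<xi>. h * ?Q (\<iota> \<xi>)) \<longlongrightarrow> h * (- amp regT r')) (at_left (h * X0))"
    by (intro tendsto_mult_left tendsto_minus filterlim_compose[OF Gr' i(5)])
  have il: "(\<iota> \<longlongrightarrow> r') (at_left (h * X0))" using i(5) by (simp add: filterlim_at)
  have Pl: "((\<lambda>\<xi>. h * ?P (\<iota> \<xi>)) \<longlongrightarrow> h * (- (r' * amp regT r'))) (at_left (h * X0))"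
    by (intro tendsto_mult_left tendsto_minus tendsto_mult il filterlim_compose[OF Gr' i(5)])
  have Qv: "h * (- amp regT r') = k * zm / reg_ratio r'"
    unfolding hX0[symmetric] X0_def using reg_ratio_pos[OF r'] k_gt_1 by simp
  define L where "L = - (amp regT 1 * (regN 1 * regT1 1 / (regT 1)\<^sup>2)) / (2 * l * (n - 1))"
  have "regN 1 * regT1 1 / (regT 1)\<^sup>2 < 0"
    using regN_neg[of 1] regT1_pos[of 1] regT_pos[of 1] by (intro divide_neg_pos mult_neg_pos) auto
  then have "amp regT 1 * (regN 1 * regT1 1 / (regT 1)\<^sup>2) < 0" using G1(2)
      by (rule mult_pos_neg[rotated])
  then have L: "L > 0" unfolding L_def using l_gt_1 n_gt_1 by (intro divide_pos_pos) auto
  have T1c: "isCont regT1 1"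
  proof -
    have "eventually (\<lambda>r::real. r > 0) (nhds 1)" by (intro eventually_nhds_in_open[of "{0<..}",
        simplified]) auto
    then have "eventually (\<lambda>r. regT1 r = (regN r + (n - 1) * regT r) / r) (nhds 1)"
      by eventually_elim (use regT_sum in \<open>simp add: field_simps\<close>)
    from isCont_cong[OF this] show ?thesis
      by (auto intro!: continuous_intros regN_isCont regT_isCont)
  qed
  have quad: "((\<lambda>r. (?X r - X1) / (1 - r)\<^sup>2) \<longlongrightarrow> L) (at_left 1)"
  proof (rule lhopital_left)
    have ev: "eventually (\<lambda>r::real. r \<in> {0<..<1}) (at_left 1)" by (rule eventually_at_leftI[of 0]) auto
    show "((\<lambda>r. ?X r - X1) \<longlongrightarrow> 0) (at_left 1)" using tendsto_diff[OF lim1 tendsto_const[of X1]] by simp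
    show "((\<lambda>r::real. (1 - r)\<^sup>2) \<longlongrightarrow> 0) (at_left 1)" by (auto intro!: tendsto_eq_intros)
    show "eventually (\<lambda>r::real. (1 - r)\<^sup>2 \<noteq> 0) (at_left 1)" using ev by eventually_elim auto
    show "eventually (\<lambda>r::real. - 2 * (1 - r) \<noteq> 0) (at_left 1)" using ev by eventually_elim auto
    show "eventually (\<lambda>r. ((\<lambda>r. ?X r - X1) has_real_derivative amp regT r * ((1 - r)
        / (l * (n - 1))) * (regN r * regT1 r / (regT r)\<^sup>2)) (at r)) (at_left 1)"
      using ev
    proof eventually_elim
      case (elim r)
      have "((\<lambda>r. amp regT r * pos_ratio regT regN r / k) has_real_derivative
          - amp regT r * ((1 - r) / (l * (n - 1))) * (regN r * regT1 r / (regT r)\<^sup>2)) (at r)"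
        by (rule hodograph_param(3)[OF regT_hodograph]) (use elim regT_pos in auto)
      from DERIV_diff[OF DERIV_minus[OF this] DERIV_const[of X1]] show ?case by simp
    qed
    show "eventually (\<lambda>r::real. ((\<lambda>r. (1 - r)\<^sup>2) has_real_derivative - 2 * (1 - r)) (at r)) (at_left 1)"
      by (intro always_eventually allI) (auto intro!: derivative_eq_intros)
    have "isCont (\<lambda>r. - (amp regT r * (regN r * regT1 r / (regT r)\<^sup>2)) / (2 * l * (n - 1))) 1"
      using l_gt_1 n_gt_1 regT_pos[of 1] by (intro continuous_intros G1 regN_isCont T1c regT_isCont)
          auto
    then have "((\<lambda>r. - (amp regT r * (regN r * regT1 r / (regT r)\<^sup>2)) / (2 * l * (n - 1))) \<longlongrightarrow> L)
        (at_left 1)"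
      by (simp add: isCont_def filterlim_at_split L_def)
    then show "((\<lambda>r. amp regT r * ((1 - r) / (l * (n - 1))) * (regN r * regT1 r / (regT r)\<^sup>2)
        / (- 2 * (1 - r))) \<longlongrightarrow> L) (at_left 1)"
    proof (rule Lim_transform_eventually)
      show "\<forall>\<^sub>F r in at_left 1. - (amp regT r * (regN r * regT1 r / (regT r)\<^sup>2)) / (2 * l * (n - 1))
         = amp regT r * ((1 - r) / (l * (n - 1))) * (regN r * regT1 r / (regT r)\<^sup>2) / (- 2 * (1 - r))"
        using ev
      proof eventually_elim
        case (elim r)
        define c where "c = l * (n - 1)"
        have "- (x * y) / (2 * c) = x * (q / c) * y / (- 2 * q)" if "q > 0" for x y q
          using that by simp
        moreover have "2 * l * (n - 1) = 2 * c" by (simp add: c_def)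
        ultimately show ?case using elim unfolding c_def[symmetric] by (simp only:
            greaterThanLessThan_iff diff_gt_0_iff_gt)
      qed
    qed
  qed
  define K where "K = h * amp regT 1 / (2 * l) / (h * L) powr (1 / 2)"
  have K: "K > 0" unfolding K_def using h G1 L l_gt_1 by simp
  have "((\<lambda>r. h * amp regT r / (2 * l) / (h * ((?X r - X1) / (1 - r)\<^sup>2)) powr (1 / 2)) \<longlongrightarrow> K) (at_left 1)"
    unfolding K_def
    by (intro tendsto_intros quad) (use G1 h L l_gt_1 in \<open>auto simp: isCont_def filterlim_at_split\<close>)
  from filterlim_compose[OF this i(4)]
  have "((\<lambda>\<xi>. h * amp regT (\<iota> \<xi>) / (2 * l) / (h * ((?X (\<iota> \<xi>) - X1) / (1 - \<iota> \<xi>)\<^sup>2)) powr (1 / 2))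
      \<longlongrightarrow> K) (at_right (h * X1))" .
  then have dec: "((\<lambda>\<xi>. (h * ?P (\<iota> \<xi>) - h * ?Q (\<iota> \<xi>)) / (2 * l) / (\<xi> - h * X1) powr (1 / 2)) \<longlongrightarrow> K)
      (at_right (h * X1))"
  proof (rule Lim_transform_eventually)
    have "eventually (\<lambda>\<xi>. \<xi> \<in> {h * X1<..<h * X0}) (at_right (h * X1))"
        by (rule eventually_at_rightI[OF _ i(2)]) auto
    moreover have "eventually (\<lambda>\<xi>. \<iota> \<xi> < 1) (at_right (h * X1))"
      using i(4) by (auto simp: filterlim_at elim: eventually_mono)
    ultimately show "\<forall>\<^sub>F \<xi> in at_right (h * X1). h * amp regT (\<iota> \<xi>) / (2 * l) / (h * ((?X (\<iota> \<xi>)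
        - X1) / (1 - \<iota> \<xi>)\<^sup>2)) powr (1 / 2)
       = (h * ?P (\<iota> \<xi>) - h * ?Q (\<iota> \<xi>)) / (2 * l) / (\<xi> - h * X1) powr (1 / 2)"
    proof eventually_elim
      case (elim \<xi>)
      define r where "r = \<iota> \<xi>"
      have r: "r < 1" using elim by (simp add: r_def)
      have x: "h * ?X r = \<xi>" using i(3) elim unfolding r_def by auto
      have e: "h * ((?X r - X1) / (1 - r)\<^sup>2) = (\<xi> - h * X1) / (1 - r)\<^sup>2"
        unfolding x[symmetric] by (simp add: right_diff_distrib)
      have "((1 - r)\<^sup>2) powr (1 / 2) = 1 - r" using r by (simp add: powr_half_sqrt)
      then have e2: "((\<xi> - h * X1) / (1 - r)\<^sup>2) powr (1 / 2) = (\<xi> - h * X1) powr (1 / 2) / (1 - r)"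
        using elim r by (subst powr_divide) auto
      show ?case unfolding r_def[symmetric] e e2 using r by (simp add: field_simps)
    qed
  qed
  define P' Q' where "P' = (\<lambda>\<xi>. h * ?P (\<iota> \<xi>))" and "Q' = (\<lambda>\<xi>. h * ?Q (\<iota> \<xi>))"
  have Pv: "h * (- (r' * amp regT r')) = r' * (k * zm / reg_ratio r')" unfolding Qv[symmetric] by simp
  have "char_wave {h * X1<..<zm} P' Q'" "h * X1 < zm"
    "(P' \<longlongrightarrow> r' * (k * zm / reg_ratio r')) (at_left zm)" "(Q' \<longlongrightarrow> k * zm / reg_ratio r') (at_left zm)"
    "((\<lambda>\<xi>. (P' \<xi> - Q' \<xi>) / (2 * l) / (\<xi> - h * X1) powr (1 / 2)) \<longlongrightarrow> K) (at_right (h * X1))"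
    unfolding P'_def Q'_def using i(1,2) Ql Pl dec unfolding hX0 Qv Pv by blast+
  then show ?thesis using K by blast
qed

end

section \<open>Rarefaction waves\<close>

context self_similar_exponents
begin

lemma hodograph_sol_minus:
  assumes "hodograph_sol J T T1 N"
  shows "hodograph_sol J (\<lambda>r. - T r) (\<lambda>r. - T1 r) (\<lambda>r. - N r)"
  unfolding hodograph_sol_def
proof (intro ballI conjI)
  fix r assume "r \<in> J"
  then have d: "(T has_real_derivative T1 r) (at r)"
      "(N has_real_derivative M * (N r + T1 r) / (1 - r)) (at r)"
      and e: "r * T1 r = N r + (n - 1) * T r" using assms unfolding hodograph_sol_def by blast+
  show "((\<lambda>r. - T r) has_real_derivative - T1 r) (at r)" by (rule DERIV_minus[OF d(1)])
  have "M * (- N r + - T1 r) / (1 - r) = - (M * (N r + T1 r) / (1 - r))"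
    by (simp add: algebra_simps minus_divide_left)
  then show "((\<lambda>r. - N r) has_real_derivative M * (- N r + - T1 r) / (1 - r)) (at r)"
    using DERIV_minus[OF d(2)] by simp
  show "r * - T1 r = - N r + (n - 1) * - T r" using e by simp
qed

lemma hodograph_sol_subset: "hodograph_sol J T T1 N \<Longrightarrow> J' \<subseteq> J \<Longrightarrow> hodograph_sol J' T T1 N"
  unfolding hodograph_sol_def by blast

lemma hodograph_sol_isCont:
  assumes "hodograph_sol J T T1 N" "r \<in> J" "open J" "0 \<notin> J"
  shows "isCont T r" "isCont N r" "isCont T1 r"
proof -
  show c: "isCont T r" "isCont N r" using assms DERIV_isCont unfolding hodograph_sol_def by blast+
  have r0: "r \<noteq> 0" using assms by auto
  have "eventually (\<lambda>x. x \<in> J) (nhds r)" by (rule eventually_nhds_in_open) (use assms in auto)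
  then have "eventually (\<lambda>x. T1 x = (N x + (n - 1) * T x) / x) (nhds r)"
  proof eventually_elim
    case (elim x)
    then have "x * T1 x = N x + (n - 1) * T x" "x \<noteq> 0" using assms unfolding hodograph_sol_def by auto
    then show ?case by (simp add: field_simps)
  qed
  from isCont_cong[OF this] show "isCont T1 r" using c r0 by (auto intro!: continuous_intros)
qed

lemma amp_scaled_ratio:
  assumes "T r > 0"
  shows "amp T r * pos_ratio T N r / k
    = T r powr (- k) * ((T r * (alpha + beta * r) + (1 - r) * N r / (l * (n - 1))) / k)"
proof -
  have "amp T r = T r powr (- k) * T r" using assms by (simp add:
      amp_def powr_diff powr_minus field_simps)
  moreover have "T r * pos_ratio T N r = T r * (alpha + beta * r) + (1 - r) * N r / (l * (n - 1))"
    using assms l_gt_1 n_gt_1 by (simp add: pos_ratio_def field_simps)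
  ultimately have "amp T r * pos_ratio T N r = T r powr (- k) * (T r * (alpha + beta * r) + (1 - r)
      * N r / (l * (n - 1)))"
    by (simp only: mult.assoc)
  then show ?thesis by simp
qed

lemma wronskian_continuous: "continuous_on {..0} wronskian"
  unfolding wronskian_def[abs_def]
  by (intro continuous_on_mult continuous_on_powr_const continuous_intros) (use M_gt_1 n_gt_1 in auto)

lemma wronskian_tendsto_0: "(wronskian \<longlongrightarrow> 0) (at 0 within A)" 
proof -
  have "((\<lambda>r. \<bar>r\<bar> powr (n + M - 2) * (1 - r) powr (- 2 * M)) \<longlongrightarrow> \<bar>0\<bar> powr (n + M - 2) * (1 - 0)
      powr (- 2 * M)) (at 0 within A)"
    by (intro tendsto_mult tendsto_powr' tendsto_rabs tendsto_diff tendsto_const tendsto_ident_at)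
        (use M_gt_1 n_gt_1 in auto)
  then show ?thesis by (simp add: wronskian_def[abs_def])
qed

text \<open>
  The multiplier for reduction of order is obtained on an interval that is closed at \<open>0\<close>, where the
  Wronskian vanishes continuously; so \<open>T\<close> has a limit at \<open>0\<close>.
\<close>
lemma rarefaction_wave_hodograph:
  assumes r0: "r0 < 0"
  shows "\<exists>T T1 N T0. hodograph_sol {r0<..<0} T T1 N \<and>
    (\<forall>r. r0 < r \<longrightarrow> r < 0 \<longrightarrow> T r > 0 \<and> T1 r > 0 \<and> N r < 0) \<and>
    isCont T r0 \<and> T r0 = 0 \<and> isCont N r0 \<and> N r0 < 0 \<and>
    (T \<longlongrightarrow> T0) (at_left 0) \<and> T0 > 0 \<and> ((\<lambda>r. r * T1 r) \<longlongrightarrow> 0) (at_left 0)"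
proof -
  (* Any point to the left of r0 would do; r0 has to be an interior point. *)
  define p where "p = r0 - 1"
  let ?g = "\<lambda>r. wronskian r / (truncT r)\<^sup>2"
  have sol0: "hodograph_sol {p<..<0} truncT truncT1 truncN"
    by (rule hodograph_sol_subset[OF truncT_hodograph]) auto
  have cg: "continuous_on {p..0} ?g"
    by (intro continuous_on_divide continuous_on_power continuous_on_subset[OF wronskian_continuous]
         continuous_on_subset[OF truncT_continuous]) (use truncT_pos in force)+
  obtain H0 where H0: "\<And>x. x \<in> {p..0} \<Longrightarrow> (H0 has_vector_derivative ?g x) (at x within {p..0})"
    using antiderivative_continuous[OF cg] by blast
  define H where "H = (\<lambda>r. H0 r - H0 r0)"
  have dH: "(H has_real_derivative ?g r) (at r)" if "r \<in> {p<..<0}" for r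
  proof -
    have "at r within {p..0} = at r" using that by (intro at_within_Icc_at) auto
    then have "(H0 has_real_derivative ?g r) (at r)"
      using H0[of r] that by (simp add: has_real_derivative_iff_has_vector_derivative)
    from DERIV_diff[OF this DERIV_const[of "H0 r0"]] show ?thesis unfolding H_def by simp
  qed
  have Hlim: "(H \<longlongrightarrow> H 0) (at_left 0)"
  proof -
    have "continuous_on {p..0} H0"
      unfolding continuous_on_eq_continuous_within
      by (intro ballI has_vector_derivative_continuous[OF H0])
    then have "(H0 \<longlongrightarrow> H0 0) (at 0 within {p..0})" using r0 by (auto simp: continuous_on_def p_def)
    moreover have "at 0 within {p..0} = at_left 0"
      using r0 by (intro at_within_Icc_at_left) (simp add: p_def)
    ultimately show ?thesis unfolding H_def by (auto intro: tendsto_diff)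
  qed
  have Hr0: "H r0 = 0" by (simp add: H_def)
  define T where "T = (\<lambda>r. truncT r * H r)"
  define T1 where "T1 = (\<lambda>r. truncT1 r * H r + wronskian r / truncT r)"
  define N where "N = (\<lambda>r. truncN r * H r + r * wronskian r / truncT r)"
  have sol: "hodograph_sol {p<..<0} T T1 N"
    unfolding T_def T1_def N_def
    by (rule hodograph_reduction_of_order[OF _ sol0 _ dH]) (use truncT_pos in auto)
  have gpos: "?g r > 0" if "r < 0" for r
    using wronskian_pos[of r] truncT_pos[of r] that by simp
  have Hinc: "H x < H y" if "p < x" "x < y" "y < 0" for x y
  proof (rule DERIV_pos_imp_increasing[OF that(2)])
    fix z assume "x \<le> z" "z \<le> y"
    then have "z \<in> {p<..<0}" "z < 0" using that by auto
    then show "\<exists>d. (H has_real_derivative d) (at z) \<and> d > 0" using dH gpos by blast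
  qed
  have Tpos: "T r > 0" if "r0 < r" "r < 0" for r
    unfolding T_def using Hinc[of r0 r] Hr0 that truncT_pos[of r] by (simp add: p_def)
  have slope: "T1 r / wronskian r > 0" if r: "r0 \<le> r" "r < 0" for r
  proof -
    have d: "((\<lambda>r. T1 r / wronskian r) has_real_derivative - M * (n - 1) * T x / (x * (1 - x)
        * wronskian x)) (at x)"
      if "r0 \<le> x" "x < 0" for x
      by (rule hodograph_slope_over_wronskian[OF refl _ _ sol]) (use that in \<open>auto simp: p_def\<close>)
    have at0: "T1 r0 / wronskian r0 > 0"
      unfolding T1_def Hr0 using wronskian_pos[of r0] truncT_pos[of r0] r0 by simp
    show ?thesis
    proof (cases "r = r0")
      case False
      then have lt: "r0 < r" using r by simp
      have "T1 r0 / wronskian r0 < T1 r / wronskian r"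
      proof (rule DERIV_pos_imp_increasing_open[OF lt])
        fix x assume x: "r0 < x" "x < r"
        have "- M * (n - 1) * T x / (x * (1 - x) * wronskian x) > 0"
          using x r M_gt_1 n_gt_1 Tpos[of x] wronskian_pos[of x]
          by (intro divide_neg_neg) (auto simp: mult_neg_pos)
        then show "\<exists>y. ((\<lambda>r. T1 r / wronskian r) has_real_derivative y) (at x) \<and> y > 0"
          using d[of x] x r by auto
      next
        show "continuous_on {r0..r} (\<lambda>r. T1 r / wronskian r)"
        proof (intro continuous_at_imp_continuous_on ballI)
          fix x assume "x \<in> {r0..r}"
          then show "isCont (\<lambda>r. T1 r / wronskian r) x" using d[of x] r DERIV_isCont by auto
        qed
      qed
      then show ?thesis using at0 by linarith
    qed (use at0 in simp)
  qed
  have T1pos: "T1 r > 0" if "r0 \<le> r" "r < 0" for r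
    using slope[OF that] wronskian_pos[of r] that by (simp add: zero_less_divide_iff)
  have N_eq: "N r = r * T1 r - (n - 1) * T r" if "r0 \<le> r" "r < 0" for r
    using sol that unfolding hodograph_sol_def by (auto simp: p_def)
  have Nneg: "N r < 0" if "r0 \<le> r" "r < 0" for r
  proof -
    have "r * T1 r < 0" using T1pos[OF that] that by (simp add: mult_neg_pos)
    moreover have "T r \<ge> 0" using Tpos[of r] that Hr0 by (cases "r = r0") (auto simp: T_def)
    then have "(n - 1) * T r \<ge> 0" using n_gt_1 by simp
    ultimately show ?thesis using N_eq[OF that] by simp
  qed
  have dl: "(truncT \<longlongrightarrow> truncT 0) (at_left 0)"
  proof -
    have "(truncT \<longlongrightarrow> truncT 0) (at 0 within {..0})" using truncT_continuous by (auto simp: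
        continuous_on_def)
    then show ?thesis by (rule tendsto_within_subset) auto
  qed
  have Tl: "(T \<longlongrightarrow> truncT 0 * H 0) (at_left 0)" unfolding T_def by (intro tendsto_mult dl Hlim)
  have "H (r0 / 2) \<le> H 0"
  proof (rule tendsto_lowerbound[OF Hlim])
    have "eventually (\<lambda>x. x \<in> {r0 / 2<..<0}) (at_left 0)" by (rule eventually_at_leftI[of "r0 / 2"])
        (use r0 in auto)
    then show "eventually (\<lambda>x. H (r0 / 2) \<le> H x) (at_left 0)"
    proof eventually_elim
      case (elim x)
      then show ?case using Hinc[of "r0 / 2" x] r0 by (simp add: p_def)
    qed
  qed simp
  moreover have "H (r0 / 2) > 0" using Hinc[of r0 "r0 / 2"] Hr0 r0 by (simp add: p_def)
  ultimately have T0: "truncT 0 * H 0 > 0" using truncT_pos[of 0] by simp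
  have "((\<lambda>r. (r * truncT1 r) * H r + r * wronskian r / truncT r) \<longlongrightarrow> 0 * H 0 + 0 * 0 / truncT 0)
      (at_left 0)"
    by (intro tendsto_intros truncT1_weighted_tendsto Hlim wronskian_tendsto_0 dl)
        (use truncT_pos[of 0] in auto)
  then have rT1: "((\<lambda>r. r * T1 r) \<longlongrightarrow> 0) (at_left 0)" by (simp add: T1_def algebra_simps)
  have c: "isCont T r0" "isCont N r0"
    using hodograph_sol_isCont[OF sol, of r0] r0 by (auto simp: p_def)
  have sol': "hodograph_sol {r0<..<0} T T1 N"
    by (rule hodograph_sol_subset[OF sol]) (auto simp: p_def)
  have "T r0 = 0" by (simp add: T_def Hr0)
  show ?thesis
    by (rule exI[of _ T], rule exI[of _ T1], rule exI[of _ N], rule exI[of _ "truncT 0 * H 0"])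
       (use sol' \<open>T r0 = 0\<close> Tpos T1pos Nneg c Tl T0 rT1 r0 in auto)
qed

lemma tendsto_at_right_isCont:
  fixes f :: "real \<Rightarrow> real"
  assumes "isCont f x"
  shows "(f \<longlongrightarrow> f x) (at_right x)"
  using assms unfolding isCont_def by (rule tendsto_within_subset) auto

lemma tendsto_at_left_isCont:
  fixes f :: "real \<Rightarrow> real"
  assumes "isCont f x"
  shows "(f \<longlongrightarrow> f x) (at_left x)"
  using assms unfolding isCont_def by (rule tendsto_within_subset) auto

lemma rarefaction_wave:
  assumes r0: "r0 < 0" and g: "g > 0"
  shows "\<exists>z<0. \<exists>P Q. char_wave {z<..} P Q \<and> (P \<longlongrightarrow> 0) (at_right z) \<and> (Q \<longlongrightarrow> k * z / beta) (at_right z) \<and>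
    ((\<lambda>\<xi>. P \<xi> / \<xi> powr (1 / n)) \<longlongrightarrow> g * (- r0)) at_top \<and> ((\<lambda>\<xi>. Q \<xi> / \<xi> powr (1 / n)) \<longlongrightarrow> g * (- 1)) at_top"
proof -
  obtain T T1 N T0 where sol: "hodograph_sol {r0<..<0} T T1 N"
    and sgn: "\<And>r. r0 < r \<Longrightarrow> r < 0 \<Longrightarrow> T r > 0 \<and> T1 r > 0 \<and> N r < 0"
    and start: "isCont T r0" "T r0 = 0" "isCont N r0" "N r0 < 0"
    and stop: "(T \<longlongrightarrow> T0) (at_left 0)" "T0 > 0" "((\<lambda>r. r * T1 r) \<longlongrightarrow> 0) (at_left 0)"
    using rarefaction_wave_hodograph[OF r0] by blast
  let ?X = "\<lambda>r. - (amp T r * pos_ratio T N r / k)"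
  have ev: "eventually (\<lambda>r. r \<in> {r0<..<0}) (at_left 0)" by (rule eventually_at_leftI[OF _ r0]) auto
  have evr: "eventually (\<lambda>r. r \<in> {r0<..<0}) (at_right r0)" by (rule eventually_at_rightI[OF _ r0]) auto
  have curve: "char_curve r0 0 ?X (\<lambda>r. - (r * amp T r)) (\<lambda>r. - amp T r)"
    by (rule curve_left_moving[OF sol]) (use r0 sgn in auto)
  define G0 where "G0 = T0 powr (- (k - 1))"
  have Gl: "(amp T \<longlongrightarrow> G0) (at_left 0)" unfolding amp_def[abs_def] G0_def
    using stop(2) by (intro tendsto_powr stop(1) tendsto_const) auto
  have G0: "G0 > 0" using stop by (simp add: G0_def)
  have Yl: "(pos_ratio T N \<longlongrightarrow> beta) (at_left 0)"
  proof (rule pos_ratio_node[OF stop tendsto_ident_at])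
    show "eventually (\<lambda>r. r * T1 r = N r + (n - 1) * T r \<and> T r > 0) (at_left 0)"
      using ev by eventually_elim (use sol sgn in \<open>auto simp: hodograph_sol_def\<close>)
  qed
  have Xl: "(?X \<longlongrightarrow> - (G0 * beta / k)) (at_left 0)" using k_gt_1 by (intro tendsto_intros Gl Yl) auto
  let ?Z = "\<lambda>r. - ((T r * (alpha + beta * r) + (1 - r) * N r / (l * (n - 1))) / k)"
  have Zl: "(?Z \<longlongrightarrow> - ((T r0 * (alpha + beta * r0) + (1 - r0) * N r0 / (l * (n - 1))) / k)) (at_right r0)"
    by (rule tendsto_at_right_isCont) (use k_gt_1 l_gt_1 n_gt_1 in \<open>auto intro!:
        continuous_intros start\<close>)
  have neg: "(1 - r0) * N r0 / (l * (n - 1)) < 0"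
    using r0 start(4) l_gt_1 n_gt_1 by (intro divide_neg_pos mult_pos_neg) auto
  have Z0: "- ((T r0 * (alpha + beta * r0) + (1 - r0) * N r0 / (l * (n - 1))) / k) > 0"
  proof -
    have "(1 - r0) * N r0 / (l * (n - 1)) / k < 0" by (rule divide_neg_pos) (use neg k_gt_1 in auto)
    then show ?thesis using start(2) by simp
  qed
  have T0l: "(T \<longlongrightarrow> 0) (at_right r0)" using tendsto_at_right_isCont[OF start(1)] start(2) by simp
  have "\<exists>h>0. \<exists>\<iota>. char_wave {h * (- (G0 * beta / k))<..} (\<lambda>\<xi>. h * - (\<iota> \<xi> * amp T (\<iota> \<xi>)))
      (\<lambda>\<xi>. h * - amp T (\<iota> \<xi>)) \<and>
     filterlim \<iota> (at_left 0) (at_right (h * (- (G0 * beta / k)))) \<and>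
         (\<forall>\<xi>>h * (- (G0 * beta / k)). h * ?X (\<iota> \<xi>) = \<xi>) \<and>
     ((\<lambda>\<xi>. h * - (\<iota> \<xi> * amp T (\<iota> \<xi>)) / \<xi> powr (1 / n)) \<longlongrightarrow> g * (- r0)) at_top \<and>
     ((\<lambda>\<xi>. h * - amp T (\<iota> \<xi>) / \<xi> powr (1 / n)) \<longlongrightarrow> g * (- 1)) at_top"
  proof (rule right_wave_normalised[OF curve Xl T0l _ Zl Z0 _ _ _ _ _ g, where p="\<lambda>r. - r"
      and q="\<lambda>r. - 1"])
    show "eventually (\<lambda>r. T r > 0) (at_right r0)" using evr by eventually_elim (use sgn in auto)
    show "eventually (\<lambda>r. ?X r = T r powr (- k) * ?Z r) (at_right r0)"
      using evr by eventually_elim (use sgn amp_scaled_ratio in auto)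
    show "eventually (\<lambda>r. - (r * amp T r) = - r * T r powr (- (k - 1))) (at_right r0)"
      "eventually (\<lambda>r. - amp T r = - 1 * T r powr (- (k - 1))) (at_right r0)"
      by (simp_all add: amp_def)
    show "((\<lambda>r. - r) \<longlongrightarrow> - r0) (at_right r0)" "((\<lambda>r. - 1) \<longlongrightarrow> (- 1::real)) (at_right r0)"
      by (auto intro!: tendsto_intros)
  qed
  then obtain h \<iota> where h: "h > 0" and w: "char_wave {h * (- (G0 * beta / k))<..} (\<lambda>\<xi>. h * - (\<iota> \<xi> *
      amp T (\<iota> \<xi>))) (\<lambda>\<xi>. h * - amp T (\<iota> \<xi>))"
     "filterlim \<iota> (at_left 0) (at_right (h * (- (G0 * beta / k))))"
     "((\<lambda>\<xi>. h * - (\<iota> \<xi> * amp T (\<iota> \<xi>)) / \<xi> powr (1 / n)) \<longlongrightarrow> g * (- r0)) at_top"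
     "((\<lambda>\<xi>. h * - amp T (\<iota> \<xi>) / \<xi> powr (1 / n)) \<longlongrightarrow> g * (- 1)) at_top" by blast
  define z where "z = h * (- (G0 * beta / k))"
  have z: "z < 0" unfolding z_def using h G0 beta_pos k_gt_1 by (simp add: mult_pos_neg)
  have il: "(\<iota> \<longlongrightarrow> 0) (at_right z)" using w(2) by (simp add: filterlim_at z_def)
  have Gl': "((\<lambda>\<xi>. amp T (\<iota> \<xi>)) \<longlongrightarrow> G0) (at_right z)"
    using filterlim_compose[OF Gl w(2)] by (simp add: z_def)
  have "((\<lambda>\<xi>. h * - (\<iota> \<xi> * amp T (\<iota> \<xi>))) \<longlongrightarrow> h * - (0 * G0)) (at_right z)"
    by (intro tendsto_intros il Gl')
  moreover have "((\<lambda>\<xi>. h * - amp T (\<iota> \<xi>)) \<longlongrightarrow> h * - G0) (at_right z)"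
    by (intro tendsto_intros Gl')
  moreover have "h * - G0 = k * z / beta" unfolding z_def using beta_pos k_gt_1 by simp
  moreover define P' Q' where "P' = (\<lambda>\<xi>. h * - (\<iota> \<xi> * amp T (\<iota> \<xi>)))" and "Q' = (\<lambda>\<xi>. h * - amp T (\<iota> \<xi>))"
  ultimately have "char_wave {z<..} P' Q'" "(P' \<longlongrightarrow> 0) (at_right z)" "(Q' \<longlongrightarrow> k * z / beta) (at_right z)"
    "((\<lambda>\<xi>. P' \<xi> / \<xi> powr (1 / n)) \<longlongrightarrow> g * (- r0)) at_top" "((\<lambda>\<xi>. Q' \<xi> / \<xi> powr (1 / n)) \<longlongrightarrow> g * (- 1))
        at_top"
    using w unfolding z_def[symmetric] by simp_all
  then show ?thesis using z by blast
qed

text \<open>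
  If \<open>P = 0\<close>, then \<open>\<xi>\<close> satisfies a linear equation as a function of \<open>Q\<close>, with solutions
  \<open>\<xi> = alpha Q + const |Q|\<^sup>n\<close>.  In terms of \<open>\<tau> = |Q|\<^sup>-\<^sup>(\<^sup>n\<^sup>-\<^sup>1\<^sup>)\<close> this is \<open>X\<close> below.  The wave ends at the
  parameter \<open>e\<close>, where the fast characteristic speed equals \<open>k \<xi>\<close>.
\<close>
lemma simple_wave_left:
  assumes g: "g > 0"
  shows "\<exists>z<0. \<exists>P Q. char_wave {z<..} P Q \<and> (P \<longlongrightarrow> 0) (at_right z) \<and> (Q \<longlongrightarrow> k * z / beta) (at_right z) \<and>
    ((\<lambda>\<xi>. P \<xi> / \<xi> powr (1 / n)) \<longlongrightarrow> 0) at_top \<and> ((\<lambda>\<xi>. Q \<xi> / \<xi> powr (1 / n)) \<longlongrightarrow> g * (- 1)) at_top"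
proof -
  define X where "X = (\<lambda>\<tau>. \<tau> powr (- k) * (1 - alpha * \<tau>))"
  define Q where "Q = (\<lambda>\<tau>. - (\<tau> powr (- (k - 1))))"
  define e where "e = k / (k * alpha - beta)"
  have den: "k * alpha - beta > 0"
  proof -
    have "beta < 1 * alpha" using alpha_gt_beta by simp
    also have "\<dots> < k * alpha" using k_gt_1 alpha_pos by (intro mult_strict_right_mono) auto
    finally show ?thesis by simp
  qed
  have e: "e > 0" unfolding e_def using den k_gt_1 by simp
  have pw: "\<tau> powr (- (k - 1)) = \<tau> powr (- k) * \<tau>" "\<tau> powr (- k - 1) = \<tau> powr (- k) / \<tau>" if "\<tau> > 0"
      for \<tau>
    using that by (simp_all add: powr_diff powr_minus field_simps)
  have curve: "char_curve 0 e X (\<lambda>\<tau>. 0) Q"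
    unfolding char_curve_def
  proof (intro conjI allI impI)
    fix \<tau> assume \<tau>: "0 < \<tau>" "\<tau> < e"
    let ?p = "\<tau> powr (- k)"
    have p: "?p > 0" using \<tau> by simp
    have lt: "(k * alpha - beta) * \<tau> < k" using \<tau> den by (simp add: e_def field_simps)
    have lt2: "(k - 1) * alpha * \<tau> < k"
    proof -
      have "(k - 1) * alpha < k * alpha - beta" using alpha_gt_beta by (simp add: algebra_simps)
      then have "(k - 1) * alpha * \<tau> < (k * alpha - beta) * \<tau>" using \<tau> by (intro mult_strict_right_mono)
      then show ?thesis using lt by simp
    qed
    show "Q \<tau> < 0" using \<tau> by (simp add: Q_def)
    have f: "fast 0 (Q \<tau>) - k * X \<tau> = ?p * ((k * alpha - beta) * \<tau> - k)"
      "slow 0 (Q \<tau>) - k * X \<tau> = ?p * ((k - 1) * alpha * \<tau> - k)"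
      unfolding X_def Q_def fast_def slow_def pw(1)[OF \<tau>(1)] by (simp_all add: algebra_simps)
    have "?p * ((k * alpha - beta) * \<tau> - k) < 0" "?p * ((k - 1) * alpha * \<tau> - k) < 0"
      using p lt lt2 by (auto intro!: mult_pos_neg)
    then show "fast 0 (Q \<tau>) \<noteq> k * X \<tau>" "slow 0 (Q \<tau>) \<noteq> k * X \<tau>" using f by auto
    have dp: "((\<lambda>\<tau>. \<tau> powr a) has_real_derivative a * \<tau> powr (a - 1)) (at \<tau>)" for a
      using \<tau> by (auto intro!: derivative_eq_intros)
    have "((\<lambda>\<tau>. 1 - alpha * \<tau>) has_real_derivative - alpha) (at \<tau>)" by (auto intro!:
        derivative_eq_intros)
    from DERIV_mult[OF dp[of "- k"] this]
    have "(X has_real_derivative - k * \<tau> powr (- k - 1) * (1 - alpha * \<tau>) + - alpha * ?p) (at \<tau>)"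
      unfolding X_def .
    moreover have "- k * \<tau> powr (- k - 1) * (1 - alpha * \<tau>) + - alpha * ?p = ?p / \<tau> * ((k - 1)
        * alpha * \<tau> - k)"
      unfolding pw(2)[OF \<tau>(1)] using \<tau> by (simp add: field_simps)
    ultimately have dX: "(X has_real_derivative ?p / \<tau> * ((k - 1) * alpha * \<tau> - k)) (at \<tau>)" by simp
    have "(Q has_real_derivative - (- (k - 1) * \<tau> powr (- (k - 1) - 1))) (at \<tau>)"
      unfolding Q_def by (intro DERIV_minus dp)
    moreover have "- (- (k - 1) * \<tau> powr (- (k - 1) - 1)) = (k - 1) * ?p" by (simp add: algebra_simps)
    ultimately have dQ: "(Q has_real_derivative (k - 1) * ?p) (at \<tau>)" by simp
    have neg: "?p / \<tau> * ((k - 1) * alpha * \<tau> - k) < 0" using p \<tau> lt2 by (intro mult_pos_neg) auto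
    have eqQ: "(slow 0 (Q \<tau>) - k * X \<tau>) * ((k - 1) * ?p) = - (k - 1) * Q \<tau> * (?p / \<tau> * ((k - 1)
        * alpha * \<tau> - k))"
    proof -
      have "(?p * y) * ((k - 1) * ?p) = - (k - 1) * - (?p * \<tau>) * (?p / \<tau> * y)" for y
        using \<tau> by (simp add: algebra_simps)
      then show ?thesis unfolding f(2) unfolding Q_def pw(1)[OF \<tau>(1)] .
    qed
    have eqP: "(fast 0 (Q \<tau>) - k * X \<tau>) * 0 = - (k - 1) * 0 * (?p / \<tau> * ((k - 1) * alpha * \<tau> - k))"
        by simp
    show "\<exists>dX dP dQ. dX < 0 \<and> (X has_real_derivative dX) (at \<tau>) \<and>
        ((\<lambda>\<tau>. 0) has_real_derivative dP) (at \<tau>) \<and> (Q has_real_derivative dQ) (at \<tau>) \<and>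
        (fast 0 (Q \<tau>) - k * X \<tau>) * dP = - (k - 1) * 0 * dX \<and>
        (slow 0 (Q \<tau>) - k * X \<tau>) * dQ = - (k - 1) * Q \<tau> * dX"
      using neg dX DERIV_const dQ eqP eqQ by blast
  qed (use e in auto)
  have c: "isCont X e" "isCont Q e"
    unfolding X_def Q_def using e by (auto intro!: continuous_intros)
  have ev: "eventually (\<lambda>\<tau>::real. \<tau> > 0) (at_right 0)" by (simp add: eventually_at_right_less)
  have "\<exists>h>0. \<exists>\<iota>. char_wave {h * X e<..} (\<lambda>\<xi>. h * 0) (\<lambda>\<xi>. h * Q (\<iota> \<xi>)) \<and>
     filterlim \<iota> (at_left e) (at_right (h * X e)) \<and> (\<forall>\<xi>>h * X e. h * X (\<iota> \<xi>) = \<xi>) \<and>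
     ((\<lambda>\<xi>. h * 0 / \<xi> powr (1 / n)) \<longlongrightarrow> g * 0) at_top \<and>
     ((\<lambda>\<xi>. h * Q (\<iota> \<xi>) / \<xi> powr (1 / n)) \<longlongrightarrow> g * (- 1)) at_top"
  proof (rule right_wave_normalised[OF curve tendsto_at_left_isCont[OF c(1)] _ _ _ _ _ _ _ _ _ g,
        where p="\<lambda>r. 0" and q="\<lambda>r. - 1" and T="\<lambda>\<tau>. \<tau>" and Z="\<lambda>\<tau>. 1 - alpha * \<tau>" and ?Z0.0=1])
    show "((\<lambda>\<tau>. 1 - alpha * \<tau>) \<longlongrightarrow> 1) (at_right 0)" by (auto intro!: tendsto_eq_intros)
  qed (use ev in \<open>auto simp: X_def Q_def\<close>)
  then obtain h \<iota> where h: "h > 0" and w: "char_wave {h * X e<..} (\<lambda>\<xi>. h * 0) (\<lambda>\<xi>. h * Q (\<iota> \<xi>))"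
     "filterlim \<iota> (at_left e) (at_right (h * X e))"
     "((\<lambda>\<xi>. h * Q (\<iota> \<xi>) / \<xi> powr (1 / n)) \<longlongrightarrow> g * (- 1)) at_top" by blast
  have Xe: "k * X e = beta * Q e"
  proof -
    have "k * (1 - alpha * e) = - beta * e" unfolding e_def using den by (simp add: field_simps)
    then have "e powr (- k) * (k * (1 - alpha * e)) = e powr (- k) * (- beta * e)" by simp
    then show ?thesis unfolding X_def Q_def pw(1)[OF e] by (simp add: mult_ac)
  qed
  have Qe: "Q e < 0" using e by (simp add: Q_def)
  have "k * X e < 0" unfolding Xe using beta_pos Qe by (rule mult_pos_neg)
  then have Xn: "X e < 0" using k_gt_1 by (simp add: mult_less_0_iff)
  have "((\<lambda>\<xi>. h * Q (\<iota> \<xi>)) \<longlongrightarrow> h * Q e) (at_right (h * X e))"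
    by (intro tendsto_mult_left filterlim_compose[OF tendsto_at_left_isCont[OF c(2)] w(2)])
  moreover have "h * Q e = k * (h * X e) / beta" using Xe beta_pos by (simp add: field_simps)
  moreover define P' Q' where "P' = (\<lambda>\<xi>::real. 0::real)" and "Q' = (\<lambda>\<xi>. h * Q (\<iota> \<xi>))"
  ultimately have "char_wave {h * X e<..} P' Q'" "(P' \<longlongrightarrow> 0) (at_right (h * X e))"
    "(Q' \<longlongrightarrow> k * (h * X e) / beta) (at_right (h * X e))"
    "((\<lambda>\<xi>. P' \<xi> / \<xi> powr (1 / n)) \<longlongrightarrow> 0) at_top" "((\<lambda>\<xi>. Q' \<xi> / \<xi> powr (1 / n)) \<longlongrightarrow> g * (- 1)) at_top"
    using w by simp_all
  moreover have "h * X e < 0" using h Xn by (rule mult_pos_neg)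
  ultimately show ?thesis by blast
qed

end

section \<open>The shock adiabat and expansion waves\<close>

text \<open>
  The square of the Mach number ahead of a shock with density ratio \<open>d\<close>; at \<open>d = 1\<close> it is continued by
  its limit.
\<close>
definition adiabat :: "real \<Rightarrow> real \<Rightarrow> real" where
  "adiabat \<gamma> d = (if d = 1 then 1 else d * (d powr \<gamma> - 1) / (\<gamma> * (d - 1)))"

lemma powr_minus_one_bounds:
  fixes d \<gamma> :: real
  assumes "d > 1" "\<gamma> > 1"
  shows "\<gamma> * (d - 1) < d powr \<gamma> - 1" "d powr \<gamma> - 1 < \<gamma> * d powr (\<gamma> - 1) * (d - 1)"
proof -
  have "\<exists>z. 1 < z \<and> z < d \<and> d powr \<gamma> - 1 powr \<gamma> = (d - 1) * (\<gamma> * z powr (\<gamma> - 1))"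
    by (rule MVT2) (use assms in \<open>auto intro!: derivative_eq_intros\<close>)
  then obtain z where z: "1 < z" "z < d" "d powr \<gamma> - 1 = (d - 1) * (\<gamma> * z powr (\<gamma> - 1))" by auto
  have "1 < z powr (\<gamma> - 1)" using z assms by (intro gr_one_powr) auto
  then show "\<gamma> * (d - 1) < d powr \<gamma> - 1" unfolding z(3) using assms by simp
  have "z powr (\<gamma> - 1) < d powr (\<gamma> - 1)" using z assms by (intro powr_less_mono2) auto
  then show "d powr \<gamma> - 1 < \<gamma> * d powr (\<gamma> - 1) * (d - 1)" unfolding z(3) using assms by simp
qed

lemma adiabat_gt: "d > 1 \<Longrightarrow> \<gamma> > 1 \<Longrightarrow> d < adiabat \<gamma> d"
  and adiabat_less: "d > 1 \<Longrightarrow> \<gamma> > 1 \<Longrightarrow> adiabat \<gamma> d < d powr \<gamma>"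
proof -
  assume d: "d > 1" and g: "\<gamma> > 1"
  have c: "\<gamma> * (d - 1) > 0" using d g by simp
  have "d * (\<gamma> * (d - 1)) < d * (d powr \<gamma> - 1)"
    using powr_minus_one_bounds(1)[OF d g] d by simp
  then show "d < adiabat \<gamma> d" unfolding adiabat_def using d c by (simp add: pos_less_divide_eq)
  have "d powr \<gamma> = d powr (\<gamma> - 1) * d" using d by (simp add: powr_diff)
  then have "d * (d powr \<gamma> - 1) < d powr \<gamma> * (\<gamma> * (d - 1))"
    using mult_strict_left_mono[OF powr_minus_one_bounds(2)[OF d g], of d] d by (simp add: mult_ac)
  then show "adiabat \<gamma> d < d powr \<gamma>" unfolding adiabat_def using d c by (simp add: pos_divide_less_eq)
qed

lemma adiabat_continuous:
  assumes "\<gamma> > 1"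
  shows "continuous_on {1..} (adiabat \<gamma>)"
  unfolding continuous_on_eq_continuous_within
proof
  fix d :: real assume "d \<in> {1..}"
  then consider "d = 1" | "d > 1" by force
  then show "continuous (at d within {1..}) (adiabat \<gamma>)"
  proof cases
    case 1
    have "((\<lambda>x. x powr \<gamma>) has_real_derivative \<gamma>) (at 1)"
      by (auto intro!: derivative_eq_intros)
    then have "((\<lambda>x. (x powr \<gamma> - 1 powr \<gamma>) / (x - 1)) \<longlongrightarrow> \<gamma>) (at 1)"
      by (simp add: has_field_derivative_iff)
    then have "((\<lambda>x. x * ((x powr \<gamma> - 1 powr \<gamma>) / (x - 1)) / \<gamma>) \<longlongrightarrow> 1 * \<gamma> / \<gamma>) (at 1)"
      using assms by (intro tendsto_intros) auto
    then have "((\<lambda>x. x * ((x powr \<gamma> - 1) / (x - 1)) / \<gamma>) \<longlongrightarrow> 1) (at 1)" using assms by simp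
    then have "(adiabat \<gamma> \<longlongrightarrow> 1) (at 1)"
    proof (rule Lim_transform_eventually)
      show "eventually (\<lambda>x. x * ((x powr \<gamma> - 1) / (x - 1)) / \<gamma> = adiabat \<gamma> x) (at 1)"
        unfolding eventually_at_filter by (intro always_eventually) (auto simp:
            adiabat_def mult.commute)
    qed
    then have "(adiabat \<gamma> \<longlongrightarrow> adiabat \<gamma> 1) (at 1 within {1..})"
      by (auto simp: adiabat_def intro: tendsto_within_subset)
    then show ?thesis unfolding 1 continuous_within .
  next
    case 2
    have "eventually (\<lambda>x. x \<in> {1<..}) (nhds d)" by (rule eventually_nhds_in_open) (use 2 in auto)
    then have "eventually (\<lambda>x. adiabat \<gamma> x = x * (x powr \<gamma> - 1) / (\<gamma> * (x - 1))) (nhds d)"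
      by eventually_elim (auto simp: adiabat_def)
    from isCont_cong[OF this] have "isCont (adiabat \<gamma>) d"
      using 2 assms by (auto intro!: continuous_intros)
    then show ?thesis by (rule continuous_at_imp_continuous_within)
  qed
qed

lemma adiabat_strict_mono:
  assumes g: "\<gamma> > 1" and xy: "1 \<le> x" "x < y"
  shows "adiabat \<gamma> x < adiabat \<gamma> y"
proof (rule DERIV_pos_imp_increasing_open[OF xy(2)])
  show "continuous_on {x..y} (adiabat \<gamma>)"
    by (rule continuous_on_subset[OF adiabat_continuous[OF g]]) (use xy in auto)
  fix d assume "x < d" "d < y"
  then have d: "d > 1" using xy by simp
  let ?D = "((1 * (d powr \<gamma> - 1) + (\<gamma> * d powr (\<gamma> - 1) - 0) * d) * (\<gamma> * (d - 1))
      - d * (d powr \<gamma> - 1) * (\<gamma> * (1 - 0))) / ((\<gamma> * (d - 1)) * (\<gamma> * (d - 1)))"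
  have dp: "((\<lambda>d. d powr \<gamma>) has_real_derivative \<gamma> * d powr (\<gamma> - 1)) (at d)"
    using d by (auto intro!: derivative_eq_intros)
  have "((\<lambda>d. d * (d powr \<gamma> - 1) / (\<gamma> * (d - 1))) has_real_derivative ?D) (at d)"
    by (intro DERIV_divide DERIV_mult DERIV_diff DERIV_cmult dp DERIV_ident DERIV_const)
        (use d g in auto)
  then have "(adiabat \<gamma> has_real_derivative ?D) (at d)"
    by (rule has_field_derivative_transform_within_open[where S="{1<..}"]) (use d in \<open>auto simp:
        adiabat_def\<close>)
  moreover have "?D > 0"
  proof -
    have b: "d powr \<gamma> - 1 < \<gamma> * d powr (\<gamma> - 1) * (d - 1)" "d powr \<gamma> - 1 > 0"
      using powr_minus_one_bounds[OF d g] d g by (auto intro: less_trans[rotated])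
    have "(1 * (d powr \<gamma> - 1) + (\<gamma> * d powr (\<gamma> - 1) - 0) * d) * (\<gamma> * (d - 1)) - d * (d powr \<gamma> - 1)
        * (\<gamma> * (1 - 0))
        = \<gamma> * ((d powr \<gamma> - 1) * (d - 1) + d * (\<gamma> * d powr (\<gamma> - 1) * (d - 1) - (d powr \<gamma> - 1)))"
      by (simp add: algebra_simps)
    also have "\<dots> > 0" using b d g by (intro mult_pos_pos add_pos_pos) auto
    finally show ?thesis using d g by simp
  qed
  ultimately show "\<exists>D. (adiabat \<gamma> has_real_derivative D) (at d) \<and> D > 0" by blast
qed

text \<open>Hence the strength of a shock is a continuous function of the Mach number ahead of it.\<close>
lemma adiabat_inverse:
  assumes g: "\<gamma> > 1" and B: "B > 1"
  shows "\<exists>\<delta>. continuous_on {1..B} \<delta> \<and> (\<forall>m\<in>{1..B}. \<delta> m \<ge> 1 \<and> adiabat \<gamma> (\<delta> m) = m) \<and> \<delta> 1 = 1"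
proof -
  have a1: "adiabat \<gamma> 1 = 1" by (simp add: adiabat_def)
  have inj: "inj_on (adiabat \<gamma>) {1..B}"
  proof (rule inj_onI)
    fix x y assume "x \<in> {1..B}" "y \<in> {1..B}" "adiabat \<gamma> x = adiabat \<gamma> y"
    then show "x = y" using adiabat_strict_mono[OF g, of x y] adiabat_strict_mono[OF g, of y x]
      by (cases x y rule: linorder_cases) auto
  qed
  have c: "continuous_on {1..B} (adiabat \<gamma>)"
    by (rule continuous_on_subset[OF adiabat_continuous[OF g]]) auto
  define \<delta> where "\<delta> = the_inv_into {1..B} (adiabat \<gamma>)"
  have inv: "\<delta> (adiabat \<gamma> x) = x" if "x \<in> {1..B}" for x
    unfolding \<delta>_def by (rule the_inv_into_f_f[OF inj that])
  have surj: "\<exists>x\<in>{1..B}. adiabat \<gamma> x = m" if "m \<in> {1..B}" for m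
  proof -
    have "\<exists>x\<ge>1. x \<le> B \<and> adiabat \<gamma> x = m"
      by (rule IVT'[OF _ _ _ c]) (use that a1 adiabat_gt[OF B g] B in auto)
    then show ?thesis by auto
  qed
  have "continuous_on (adiabat \<gamma> ` {1..B}) \<delta>"
    by (rule continuous_on_inv[OF c]) (use inv in auto)
  then have "continuous_on {1..B} \<delta>"
    by (rule continuous_on_subset) (use surj in blast)
  moreover have "\<delta> m \<ge> 1 \<and> adiabat \<gamma> (\<delta> m) = m" if m: "m \<in> {1..B}" for m
  proof -
    obtain x where "x \<in> {1..B}" "adiabat \<gamma> x = m" using surj[OF m] by blast
    then show ?thesis using inv[of x] by auto
  qed
  moreover have "\<delta> 1 = 1" using inv[of 1] a1 B by simp
  ultimately show ?thesis by blast
qed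

context self_similar_exponents
begin

text \<open>
  Near \<open>r = 1\<close> the multiplier \<open>H\<close> grows like \<open>(1 - r)\<^sup>-\<^sup>l\<close>, and \<open>k \<xi> / P\<close> tends to \<open>k\<close>, so \<open>\<xi>\<close> behaves like
  \<open>amp T\<close>, that is like \<open>(1 - r)\<^sup>l\<^sup>(\<^sup>k\<^sup>-\<^sup>1\<^sup>)\<close>, and the sound speed is smaller by one factor \<open>1 - r\<close>.
\<close>
lemma expansion_wave:
  assumes r0: "0 < r0" "r0 < 1" and g: "g > 0"
  shows "\<exists>P Q. char_wave {0<..} P Q \<and>
    ((\<lambda>\<xi>. P \<xi> / \<xi> powr (1 / n)) \<longlongrightarrow> g * 1) at_top \<and> ((\<lambda>\<xi>. Q \<xi> / \<xi> powr (1 / n)) \<longlongrightarrow> g * r0) at_top \<and>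
    (\<exists>K>0. ((\<lambda>\<xi>. (P \<xi> - Q \<xi>) / (2 * l) / \<xi> powr (1 + 1 / ((k - 1) * l))) \<longlongrightarrow> K) (at_right 0))"
proof -
  obtain H where H0: "H r0 = 0" and dH: "\<And>r. r \<in> {0<..<1} \<Longrightarrow> (H has_real_derivative wronskian r /
      (regT r)\<^sup>2) (at r)"
    using hodograph_reduction_multiplier[OF refl _ _ regT_hodograph, of r0] r0 regT_pos by force
  define T where "T = (\<lambda>r. regT r * H r)"
  define T1 where "T1 = (\<lambda>r. regT1 r * H r + wronskian r / regT r)"
  define N where "N = (\<lambda>r. regN r * H r + r * wronskian r / regT r)"
  have sol: "hodograph_sol {0<..<1} T T1 N"
    unfolding T_def T1_def N_def
    by (rule hodograph_reduction_of_order[OF _ regT_hodograph _ dH]) (use regT_pos in auto)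
  have Hinc: "H x < H y" if "0 < x" "x < y" "y < 1" for x y
  proof (rule DERIV_pos_imp_increasing[OF that(2)])
    fix z assume "x \<le> z" "z \<le> y"
    then have z: "z \<in> {0<..<1}" "z < 1" "z \<noteq> 0" "z \<ge> 0" using that by auto
    then have "wronskian z / (regT z)\<^sup>2 > 0" using wronskian_pos[of z] regT_pos[of z] by simp
    then show "\<exists>d. (H has_real_derivative d) (at z) \<and> d > 0" using dH[OF z(1)] by blast
  qed
  have Hpos: "H r > 0" if "r0 < r" "r < 1" for r using Hinc[of r0 r] that r0 H0 by simp
  have Tpos: "T r > 0" if "r0 < r" "r < 1" for r
    unfolding T_def using Hpos[OF that] regT_pos[of r] that r0 by simp
  have T1pos: "T1 r > 0" if "r0 \<le> r" "r < 1" for r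
  proof -
    have "H r \<ge> 0" using Hpos[of r] H0 that by (cases "r = r0") auto
    moreover have "wronskian r / regT r > 0" using wronskian_pos[of r] regT_pos[of r] that r0 by simp
    ultimately show ?thesis unfolding T1_def using regT1_pos[of r] that r0 by (simp add: add_nonneg_pos)
  qed
  have N0: "N r0 > 0" unfolding N_def H0 using wronskian_pos[of r0] regT_pos[of r0] r0 by simp
  have Npos: "N r > 0" if r: "r0 < r" "r < 1" for r
  proof -
    have d: "((\<lambda>r. (1 - r) powr M * N r) has_real_derivative M * (1 - x) powr (M - 1) * T1 x) (at x)"
      if "r0 \<le> x" "x < 1" for x
      by (rule hodograph_N_weighted[OF sol]) (use that r0 in auto)
    have "(1 - r0) powr M * N r0 < (1 - r) powr M * N r"
    proof (rule DERIV_pos_imp_increasing[OF r(1)])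
      fix x assume "r0 \<le> x" "x \<le> r"
      then have x: "r0 \<le> x" "x < 1" using r by auto
      then have "M * (1 - x) powr (M - 1) * T1 x > 0" using T1pos[OF x] M_gt_1 by simp
      then show "\<exists>d. ((\<lambda>r. (1 - r) powr M * N r) has_real_derivative d) (at x) \<and> d > 0"
          using d[OF x] by blast
    qed
    moreover have "(1 - r0) powr M * N r0 > 0" using N0 r0 by simp
    ultimately have "(1 - r) powr M * N r > 0" by linarith
    then show ?thesis using r by (simp add: zero_less_mult_iff)
  qed
  let ?X = "\<lambda>r. amp T r * pos_ratio T N r / k"
  have curve: "char_curve r0 1 ?X (amp T) (\<lambda>r. r * amp T r)"
    by (rule curve_right_moving[OF hodograph_sol_subset[OF sol]]) (use r0 Tpos T1pos Npos in auto)
  have ev: "eventually (\<lambda>r. r \<in> {r0<..<1}) (at_left 1)" by (rule eventually_at_leftI[OF _ r0(2)]) auto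
  have evr: "eventually (\<lambda>r. r \<in> {r0<..<1}) (at_right r0)" by (rule eventually_at_rightI[OF _
      r0(2)]) auto
  have regT1l: "(regT \<longlongrightarrow> regT 1) (at_left 1)" by (rule tendsto_at_left_isCont[OF regT_isCont]) simp
  have p1: "regT 1 > 0" by (rule regT_pos) simp
  have pwl: "((\<lambda>r::real. \<bar>r\<bar> powr (n + M - 2)) \<longlongrightarrow> 1) (at_left 1)"
  proof -
    have "((\<lambda>r::real. \<bar>r\<bar> powr (n + M - 2)) \<longlongrightarrow> \<bar>1\<bar> powr (n + M - 2)) (at_left 1)"
      by (intro tendsto_powr tendsto_rabs tendsto_ident_at tendsto_const) auto
    then show ?thesis by simp
  qed
  have M2: "2 * M = l + 1" by (simp add: M_def)
  define b where "b = 1 / (l * (regT 1)\<^sup>2)"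
  have b: "b > 0" unfolding b_def using l_gt_1 p1 by simp
  have Hb: "((\<lambda>r. H r / (1 - r) powr (- l)) \<longlongrightarrow> b) (at_left 1)"
  proof (rule lhopital_left_at_top)
    have "((\<lambda>r::real. (1 - r) powr l) \<longlongrightarrow> (1 - 1) powr l) (at_left 1)"
      by (intro tendsto_powr' tendsto_diff tendsto_ident_at tendsto_const)
         (use l_gt_1 ev in \<open>auto elim: eventually_mono\<close>)
    then have "filterlim (\<lambda>r::real. inverse ((1 - r) powr l)) at_top (at_left 1)"
      using l_gt_1 ev by (intro filterlim_inverse_at_top) (auto elim: eventually_mono)
    then show "filterlim (\<lambda>r::real. (1 - r) powr (- l)) at_top (at_left 1)" by (simp add: powr_minus)
    show "eventually (\<lambda>r::real. l * (1 - r) powr (- l - 1) \<noteq> 0) (at_left 1)"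
      using ev by eventually_elim (use l_gt_1 in auto)
    show "eventually (\<lambda>r. (H has_real_derivative wronskian r / (regT r)\<^sup>2) (at r)) (at_left 1)"
      using ev by eventually_elim (use dH r0 in auto)
    show "eventually (\<lambda>r::real. ((\<lambda>r. (1 - r) powr (- l)) has_real_derivative l * (1 - r)
        powr (- l - 1)) (at r)) (at_left 1)"
      using ev by eventually_elim (auto intro!: derivative_eq_intros)
    have "((\<lambda>r. \<bar>r\<bar> powr (n + M - 2) / (l * (regT r)\<^sup>2)) \<longlongrightarrow> 1 / (l * (regT 1)\<^sup>2)) (at_left 1)"
      by (intro tendsto_intros pwl regT1l) (use p1 l_gt_1 in auto)
    then show "((\<lambda>r. wronskian r / (regT r)\<^sup>2 / (l * (1 - r) powr (- l - 1))) \<longlongrightarrow> b) (at_left 1)"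
      unfolding b_def
    proof (rule Lim_transform_eventually)
      show "eventually (\<lambda>r. \<bar>r\<bar> powr (n + M - 2) / (l * (regT r)\<^sup>2) =
          wronskian r / (regT r)\<^sup>2 / (l * (1 - r) powr (- l - 1))) (at_left 1)"
        using ev
      proof eventually_elim
        case (elim r)
        have "- 2 * M = - l - 1" using M2 by simp
        then have "wronskian r = \<bar>r\<bar> powr (n + M - 2) * (1 - r) powr (- l - 1)" by (simp add:
            wronskian_def)
        moreover have "(1 - r) powr (- l - 1) > 0" using elim by simp
        ultimately show ?case by simp
      qed
    qed
  qed
  have Hb': "((\<lambda>r. H r * (1 - r) powr l) \<longlongrightarrow> b) (at_left 1)"
    using Hb by (simp add: powr_minus divide_inverse)
  define c where "c = regT 1 * b"
  have c: "c > 0" using p1 b by (simp add: c_def)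
  have Tc: "((\<lambda>r. T r * (1 - r) powr l) \<longlongrightarrow> c) (at_left 1)"
    unfolding T_def c_def mult.assoc by (intro tendsto_mult regT1l Hb')
  have Yl: "(pos_ratio T N \<longlongrightarrow> k) (at_left 1)"
  proof -
    have "((\<lambda>r. alpha + beta * r + ((1 - r) * regN r / regT r + r * \<bar>r\<bar> powr (n + M - 2)
        / ((regT r)\<^sup>2 * (H r * (1 - r) powr l))) / (l * (n - 1)))
      \<longlongrightarrow> alpha + beta * 1 + ((1 - 1) * regN 1 / regT 1 + 1 * 1 / ((regT 1)\<^sup>2 * b)) / (l * (n - 1)))
          (at_left 1)"
      by (intro tendsto_intros pwl regT1l Hb' tendsto_at_left_isCont[OF regN_isCont])
          (use p1 b l_gt_1 n_gt_1 in auto)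
    moreover have "alpha + beta * 1 + ((1 - 1) * regN 1 / regT 1 + 1 * 1 / ((regT 1)\<^sup>2 * b))
        / (l * (n - 1)) = k"
    proof -
      have "1 / ((regT 1)\<^sup>2 * b) = l" unfolding b_def using p1 by simp
      moreover have "l / (l * (n - 1)) = k - 1"
      proof -
        have "k - 1 = 1 / (n - 1)" using conj_exp n_gt_1 by (simp add: eq_divide_eq)
        then show ?thesis using l_gt_1 by simp
      qed
      ultimately show ?thesis using alpha_beta_sum by simp
    qed
    ultimately have "((\<lambda>r. alpha + beta * r + ((1 - r) * regN r / regT r + r * \<bar>r\<bar> powr (n + M - 2)
        / ((regT r)\<^sup>2 * (H r * (1 - r) powr l))) / (l * (n - 1))) \<longlongrightarrow> k) (at_left 1)"
      by simp
    then show ?thesis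
    proof (rule Lim_transform_eventually)
      show "eventually (\<lambda>r. alpha + beta * r + ((1 - r) * regN r / regT r + r * \<bar>r\<bar> powr (n + M - 2)
          / ((regT r)\<^sup>2 * (H r * (1 - r) powr l))) / (l * (n - 1)) = pos_ratio T N r) (at_left 1)"
        using ev
      proof eventually_elim
        case (elim r)
        have h: "H r > 0" "regT r > 0" "1 - r > 0" using Hpos regT_pos[of r] elim r0 by auto
        define q where "q = (1 - r) powr l"
        have q: "q > 0" using h by (simp add: q_def)
        have "- 2 * M = - l - 1" using M2 by simp
        then have "(1 - r) powr (- 2 * M) = (1 - r) powr (- l) / (1 - r)"
          using h by (simp add: powr_diff)
        also have "\<dots> = 1 / (q * (1 - r))" unfolding q_def powr_minus_divide by simp
        finally have w0: "(1 - r) powr (- 2 * M) = 1 / (q * (1 - r))" .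
        have w: "wronskian r = \<bar>r\<bar> powr (n + M - 2) / (q * (1 - r))" unfolding wronskian_def w0 by simp
        have nt: "(1 - r) * N r / T r = (1 - r) * regN r / regT r + r * \<bar>r\<bar> powr (n + M - 2)
            / ((regT r)\<^sup>2 * (H r * q))"
          unfolding N_def T_def w using h q by (simp add: field_simps power2_eq_square)
        have "(1 - r) * N r / (l * (n - 1) * T r) = ((1 - r) * N r / T r) / (l * (n - 1))" by simp
        also have "\<dots> = ((1 - r) * regN r / regT r + r * \<bar>r\<bar> powr (n + M - 2)
            / ((regT r)\<^sup>2 * (H r * q))) / (l * (n - 1))"
          unfolding nt ..
        finally show ?case unfolding pos_ratio_def q_def[symmetric] by simp
      qed
    qed
  qed
  have Ttop: "filterlim T at_top (at_left 1)"
  proof -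
    have "((\<lambda>r::real. (1 - r) powr l) \<longlongrightarrow> (1 - 1) powr l) (at_left 1)"
      by (intro tendsto_powr' tendsto_diff tendsto_ident_at tendsto_const)
         (use l_gt_1 ev in \<open>auto elim: eventually_mono\<close>)
    then have "filterlim (\<lambda>r::real. inverse ((1 - r) powr l)) at_top (at_left 1)"
      using l_gt_1 ev by (intro filterlim_inverse_at_top) (auto elim: eventually_mono)
    from filterlim_tendsto_pos_mult_at_top[OF Tc c this]
    have "filterlim (\<lambda>r. T r * (1 - r) powr l * inverse ((1 - r) powr l)) at_top (at_left 1)" .
    moreover have "eventually (\<lambda>r. T r * (1 - r) powr l * inverse ((1 - r) powr l) = T r) (at_left 1)"
      using ev by eventually_elim auto
    ultimately show ?thesis using filterlim_cong[OF refl refl] by fast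
  qed
  have Gl: "(amp T \<longlongrightarrow> 0) (at_left 1)"
    unfolding amp_def[abs_def] by (rule tendsto_neg_powr[OF _ Ttop]) (use k_gt_1 in simp)
  have Xl: "(?X \<longlongrightarrow> 0 * k / k) (at_left 1)" using k_gt_1 by (intro tendsto_intros Gl Yl) auto
  let ?Z = "\<lambda>r. (T r * (alpha + beta * r) + (1 - r) * N r / (l * (n - 1))) / k"
  note cont = hodograph_sol_isCont[OF sol, of r0]
  have Zl: "(?Z \<longlongrightarrow> (T r0 * (alpha + beta * r0) + (1 - r0) * N r0 / (l * (n - 1))) / k) (at_right r0)"
    by (rule tendsto_at_right_isCont) (use r0 k_gt_1 l_gt_1 n_gt_1 cont in \<open>auto intro!:
        continuous_intros\<close>)
  have T0: "T r0 = 0" by (simp add: T_def H0)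
  have Z0: "(T r0 * (alpha + beta * r0) + (1 - r0) * N r0 / (l * (n - 1))) / k > 0"
    using k_gt_1 T0 N0 r0 l_gt_1 n_gt_1 by simp
  have T0l: "(T \<longlongrightarrow> 0) (at_right r0)" using tendsto_at_right_isCont[OF cont(1)] T0 r0 by simp
  have "\<exists>h>0. \<exists>\<iota>. char_wave {h * (0 * k / k)<..} (\<lambda>\<xi>. h * amp T (\<iota> \<xi>)) (\<lambda>\<xi>. h * (\<iota> \<xi> * amp T (\<iota> \<xi>))) \<and>
     filterlim \<iota> (at_left 1) (at_right (h * (0 * k / k))) \<and> (\<forall>\<xi>>h * (0 * k / k). h * ?X (\<iota> \<xi>) = \<xi>) \<and>
     ((\<lambda>\<xi>. h * amp T (\<iota> \<xi>) / \<xi> powr (1 / n)) \<longlongrightarrow> g * 1) at_top \<and>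
     ((\<lambda>\<xi>. h * (\<iota> \<xi> * amp T (\<iota> \<xi>)) / \<xi> powr (1 / n)) \<longlongrightarrow> g * r0) at_top"
  proof (rule right_wave_normalised[OF curve Xl T0l _ Zl Z0 _ _ _ _ _ g, where p="\<lambda>r. 1" and q="\<lambda>r. r"])
    show "eventually (\<lambda>r. T r > 0) (at_right r0)" using evr by eventually_elim (use Tpos in auto)
    show "eventually (\<lambda>r. ?X r = T r powr (- k) * ?Z r) (at_right r0)"
      using evr by eventually_elim (use Tpos amp_scaled_ratio in auto)
    show "eventually (\<lambda>r. amp T r = 1 * T r powr (- (k - 1))) (at_right r0)"
      "eventually (\<lambda>r. r * amp T r = r * T r powr (- (k - 1))) (at_right r0)"
      by (simp_all add: amp_def)
    show "((\<lambda>r. 1) \<longlongrightarrow> (1::real)) (at_right r0)" "((\<lambda>r. r) \<longlongrightarrow> r0) (at_right r0)"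
      by (auto intro!: tendsto_intros)
  qed
  then obtain h \<iota> where h: "h > 0" and w0: "char_wave {h * (0 * k / k)<..} (\<lambda>\<xi>. h * amp T (\<iota> \<xi>))
      (\<lambda>\<xi>. h * (\<iota> \<xi> * amp T (\<iota> \<xi>)))"
     "filterlim \<iota> (at_left 1) (at_right (h * (0 * k / k)))" "\<forall>\<xi>>h * (0 * k / k). h * ?X (\<iota> \<xi>) = \<xi>"
     "((\<lambda>\<xi>. h * amp T (\<iota> \<xi>) / \<xi> powr (1 / n)) \<longlongrightarrow> g * 1) at_top"
     "((\<lambda>\<xi>. h * (\<iota> \<xi> * amp T (\<iota> \<xi>)) / \<xi> powr (1 / n)) \<longlongrightarrow> g * r0) at_top" by blast
  have z0: "h * (0 * k / k) = 0" by simp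
  note w = w0[unfolded z0]
  define e where "e = 1 + 1 / ((k - 1) * l)"
  define K where "K = h * c powr (1 / l) / (2 * l) / (h * k / k) powr e"
  have K: "K > 0" unfolding K_def using h c l_gt_1 k_gt_1 by simp
  have "((\<lambda>r. h * (T r * (1 - r) powr l) powr (1 / l) / (2 * l) / (h * pos_ratio T N r / k) powr e)
      \<longlongrightarrow> K) (at_left 1)"
    unfolding K_def by (intro tendsto_intros Tc Yl) (use h c l_gt_1 k_gt_1 in auto)
  from filterlim_compose[OF this w(2)]
  have "((\<lambda>\<xi>. h * (T (\<iota> \<xi>) * (1 - \<iota> \<xi>) powr l) powr (1 / l) / (2 * l) / (h * pos_ratio T N (\<iota> \<xi>)
      / k) powr e) \<longlongrightarrow> K) (at_right 0)" .
  then have dec: "((\<lambda>\<xi>. (h * amp T (\<iota> \<xi>) - h * (\<iota> \<xi> * amp T (\<iota> \<xi>))) / (2 * l) / \<xi> powr e) \<longlongrightarrow> K)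
      (at_right 0)"
  proof (rule Lim_transform_eventually)
    have "eventually (\<lambda>\<xi>. \<iota> \<xi> \<in> {r0<..<1}) (at_right 0)"
      using w(2) ev unfolding filterlim_iff by blast
    then show "eventually (\<lambda>\<xi>. h * (T (\<iota> \<xi>) * (1 - \<iota> \<xi>) powr l) powr (1 / l) / (2 * l)
        / (h * pos_ratio T N (\<iota> \<xi>) / k) powr e
       = (h * amp T (\<iota> \<xi>) - h * (\<iota> \<xi> * amp T (\<iota> \<xi>))) / (2 * l) / \<xi> powr e) (at_right 0)"
      using eventually_at_right_less[of "0::real"]
    proof eventually_elim
      case (elim \<xi>)
      define r where "r = \<iota> \<xi>"
      have r: "r0 < r" "r < 1" using elim by (auto simp: r_def)
      have x: "\<xi> = amp T r * (h * pos_ratio T N r / k)" using w(3)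
          elim unfolding r_def by (auto simp: mult_ac)
      have G: "amp T r > 0" "T r > 0" using Tpos[OF r] amp_pos by auto
      have "pos_ratio T N r > 0"
      proof -
        have "(1 - r) * N r / (l * (n - 1) * T r) > 0" using Npos[OF r] G r l_gt_1 n_gt_1 by simp
        then show ?thesis unfolding pos_ratio_def using alpha_pos beta_pos r r0 by (simp add:
            add_pos_pos)
      qed
      then have B: "h * pos_ratio T N r / k > 0" using h k_gt_1 by simp
      have xe: "\<xi> powr e = amp T r powr e * (h * pos_ratio T N r / k) powr e"
        unfolding x by (rule powr_mult)
      have "amp T r powr e = amp T r * amp T r powr (1 / ((k - 1) * l))"
        unfolding e_def using G by (simp add: powr_add)
      also have "amp T r powr (1 / ((k - 1) * l)) = T r powr (- (1 / l))"
      proof -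
        have "- j * (1 / (j * l)) = - (1 / l)" if "j > 0" for j using that by simp
        from this[of "k - 1"] have "- (k - 1) * (1 / ((k - 1) * l)) = - (1 / l)"
            using k_gt_1 by linarith
        then show ?thesis unfolding amp_def powr_powr by (rule arg_cong)
      qed
      finally have ge: "amp T r powr e = amp T r / T r powr (1 / l)" by (simp add: powr_minus_divide)
      have tl: "(T r * (1 - r) powr l) powr (1 / l) = T r powr (1 / l) * (1 - r)"
        using G r l_gt_1 by (simp add: powr_mult powr_powr)
      define B' where "B' = (h * pos_ratio T N r / k) powr e"
      have B': "B' > 0" unfolding B'_def using B by (metis less_numeral_extra(3) powr_gt_zero)
      have Tl: "T r powr (1 / l) > 0" using G by simp
      show ?case unfolding r_def[symmetric] xe ge tl B'_def[symmetric] using G B' Tl l_gt_1 by (simp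
          add: field_simps)
    qed
  qed
  define P' Q' where "P' = (\<lambda>\<xi>. h * amp T (\<iota> \<xi>))" and "Q' = (\<lambda>\<xi>. h * (\<iota> \<xi> * amp T (\<iota> \<xi>)))"
  have "char_wave {0<..} P' Q'"
    "((\<lambda>\<xi>. P' \<xi> / \<xi> powr (1 / n)) \<longlongrightarrow> g * 1) at_top" "((\<lambda>\<xi>. Q' \<xi> / \<xi> powr (1 / n)) \<longlongrightarrow> g * r0) at_top"
    "((\<lambda>\<xi>. (P' \<xi> - Q' \<xi>) / (2 * l) / \<xi> powr (1 + 1 / ((k - 1) * l))) \<longlongrightarrow> K) (at_right 0)"
    using w dec unfolding P'_def Q'_def e_def by blast+
  then show ?thesis using K by blast
qed

text \<open>
  The counterpart of \<open>simple_wave_left\<close> with \<open>Q = 0\<close>.  No sonic point interferes, and the parameter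
  \<open>\<tau>\<close> runs through all positive numbers; \<open>s / (1 - s)\<close> brings it to a bounded interval.
\<close>
lemma simple_wave_right:
  assumes g: "g > 0"
  shows "\<exists>P Q. char_wave {0<..} P Q \<and>
    ((\<lambda>\<xi>. P \<xi> / \<xi> powr (1 / n)) \<longlongrightarrow> g * 1) at_top \<and> ((\<lambda>\<xi>. Q \<xi> / \<xi> powr (1 / n)) \<longlongrightarrow> 0) at_top \<and>
    (\<exists>K>0. ((\<lambda>\<xi>. (P \<xi> - Q \<xi>) / (2 * l) / \<xi> powr 1) \<longlongrightarrow> K) (at_right 0))"
proof -
  define \<tau> where "\<tau> = (\<lambda>s::real. s / (1 - s))"
  define X where "X = (\<lambda>s. \<tau> s powr (- k) * (1 + alpha * \<tau> s))"
  define P where "P = (\<lambda>s. \<tau> s powr (- (k - 1)))"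
  have pw: "x powr (- (k - 1)) = x powr (- k) * x" "x powr (- k - 1) = x powr (- k) / x" if "x > 0"
      for x :: real
    using that by (simp_all add: powr_diff powr_minus field_simps)
  have curve: "char_curve 0 1 X P (\<lambda>s. 0)"
    unfolding char_curve_def
  proof (intro conjI allI impI)
    fix s :: real assume s: "0 < s" "s < 1"
    have t: "\<tau> s > 0" using s by (simp add: \<tau>_def)
    let ?t = "\<tau> s" let ?p = "\<tau> s powr (- k)"
    have p: "?p > 0" using t by simp
    define d where "d = inverse ((1 - s)\<^sup>2)"
    have d: "d > 0" using s by (simp add: d_def)
    have dt: "(\<tau> has_real_derivative d) (at s)"
      unfolding \<tau>_def d_def using s by (auto intro!: derivative_eq_intros simp:
          field_simps power2_eq_square)
    show "0 < P s" using t by (simp add: P_def)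
    have f: "fast (P s) 0 - k * X s = - (?p * ((k - 1) * alpha * ?t + k))"
      "slow (P s) 0 - k * X s = - (?p * ((k * alpha - beta) * ?t + k))"
      unfolding X_def P_def fast_def slow_def pw(1)[OF t] by (simp_all add: algebra_simps)
    have ka: "k * alpha - beta > 0"
    proof -
      have "beta < 1 * alpha" using alpha_gt_beta by simp
      also have "\<dots> < k * alpha" using k_gt_1 alpha_pos by (intro mult_strict_right_mono) auto
      finally show ?thesis by simp
    qed
    have q: "(k - 1) * alpha * ?t + k > 0" "(k * alpha - beta) * ?t + k > 0"
      using k_gt_1 alpha_pos t ka by (auto intro!: add_pos_pos mult_pos_pos)
    then have "?p * ((k - 1) * alpha * ?t + k) > 0" "?p * ((k * alpha - beta) * ?t + k) > 0"
        using p by (auto intro: mult_pos_pos)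
    then show "fast (P s) 0 \<noteq> k * X s" "slow (P s) 0 \<noteq> k * X s" using f by auto
    have dp: "((\<lambda>x. x powr a) has_real_derivative a * ?t powr (a - 1)) (at ?t)" for a
      using t by (auto intro!: derivative_eq_intros)
    have "((\<lambda>x. 1 + alpha * x) has_real_derivative alpha) (at ?t)" by (auto intro!:
        derivative_eq_intros)
    from DERIV_chain2[OF DERIV_mult[OF dp[of "- k"] this] dt]
    have "(X has_real_derivative (- k * ?t powr (- k - 1) * (1 + alpha * ?t) + alpha * ?p) * d) (at s)"
      unfolding X_def .
    moreover have "- k * ?t powr (- k - 1) * (1 + alpha * ?t) + alpha * ?p = - (?p / ?t * ((k - 1)
        * alpha * ?t + k))"
      unfolding pw(2)[OF t] using t by (simp add: field_simps)
    ultimately have dX: "(X has_real_derivative - (?p / ?t * ((k - 1) * alpha * ?t + k)) * d)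
        (at s)" by simp
    have "(P has_real_derivative (- (k - 1) * ?t powr (- (k - 1) - 1)) * d) (at s)"
      unfolding P_def by (rule DERIV_chain2[OF dp dt])
    then have dP: "(P has_real_derivative - (k - 1) * ?p * d) (at s)" by simp
    have neg: "- (?p / ?t * ((k - 1) * alpha * ?t + k)) * d < 0" using p t q(1) d by simp
    have eqP: "(fast (P s) 0 - k * X s) * (- (k - 1) * ?p * d) = - (k - 1)
        * P s * (- (?p / ?t * ((k - 1) * alpha * ?t + k)) * d)"
    proof -
      have "- (?p * y) * (- (k - 1) * ?p * d) = - (k - 1) * (?p * ?t) * (- (?p / ?t * y) * d)" for y
        using t by (simp add: algebra_simps)
      then show ?thesis unfolding f(1) unfolding P_def pw(1)[OF t] .
    qed
    have eqQ: "(slow (P s) 0 - k * X s) * 0 = - (k - 1) * 0 * (- (?p / ?t * ((k - 1)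
        * alpha * ?t + k)) * d)" by simp
    show "\<exists>dX dP dQ. dX < 0 \<and> (X has_real_derivative dX) (at s) \<and>
        (P has_real_derivative dP) (at s) \<and> ((\<lambda>s. 0) has_real_derivative dQ) (at s) \<and>
        (fast (P s) 0 - k * X s) * dP = - (k - 1) * P s * dX \<and>
        (slow (P s) 0 - k * X s) * dQ = - (k - 1) * 0 * dX"
      using neg dX DERIV_const dP eqP eqQ by blast
  qed simp
  have ev: "eventually (\<lambda>s::real. s \<in> {0<..<1}) (at_right 0)" "eventually (\<lambda>s::real. s \<in> {0<..<1})
      (at_left 1)"
    by (rule eventually_at_rightI[of 0 1], simp, simp, rule eventually_at_leftI[of 0 1], simp, simp)
  have t0: "(\<tau> \<longlongrightarrow> 0) (at_right 0)" unfolding \<tau>_def by (auto intro!: tendsto_eq_intros)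
  have it: "((\<lambda>s. inverse (\<tau> s)) \<longlongrightarrow> 0) (at_left 1)"
  proof (rule Lim_transform_eventually)
    show "((\<lambda>s::real. (1 - s) / s) \<longlongrightarrow> 0) (at_left 1)" by (auto intro!: tendsto_eq_intros)
    show "eventually (\<lambda>s. (1 - s) / s = inverse (\<tau> s)) (at_left 1)" using ev(2)
        by eventually_elim (simp add: \<tau>_def)
  qed
  have tpos: "\<tau> s > 0" if "0 < s" "s < 1" for s using that by (simp add: \<tau>_def)
  have ttop: "filterlim \<tau> at_top (at_left 1)"
  proof -
    have "filterlim (\<lambda>s. inverse (inverse (\<tau> s))) at_top (at_left 1)"
      by (rule filterlim_inverse_at_top[OF it]) (use ev(2) tpos in \<open>auto elim!: eventually_mono\<close>)
    then show ?thesis by simp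
  qed
  have Pl: "(P \<longlongrightarrow> 0) (at_left 1)" unfolding P_def by (rule tendsto_neg_powr[OF _ ttop])
      (use k_gt_1 in simp)
  have XP: "X s = P s * (inverse (\<tau> s) + alpha)" if "0 < s" "s < 1" for s
    unfolding X_def P_def pw(1)[OF tpos[OF that]] using tpos[OF that] by (simp add: field_simps)
  have Xl: "(X \<longlongrightarrow> 0) (at_left 1)"
  proof (rule Lim_transform_eventually)
    show "((\<lambda>s. P s * (inverse (\<tau> s) + alpha)) \<longlongrightarrow> 0) (at_left 1)"
      using tendsto_mult[OF Pl tendsto_add[OF it tendsto_const[of alpha]]] by simp
    show "eventually (\<lambda>s. P s * (inverse (\<tau> s) + alpha) = X s) (at_left 1)"
      using ev(2) by eventually_elim (use XP in auto)
  qed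
  have "\<exists>h>0. \<exists>\<iota>. char_wave {h * 0<..} (\<lambda>\<xi>. h * P (\<iota> \<xi>)) (\<lambda>\<xi>. h * 0) \<and>
     filterlim \<iota> (at_left 1) (at_right (h * 0)) \<and> (\<forall>\<xi>>h * 0. h * X (\<iota> \<xi>) = \<xi>) \<and>
     ((\<lambda>\<xi>. h * P (\<iota> \<xi>) / \<xi> powr (1 / n)) \<longlongrightarrow> g * 1) at_top \<and>
     ((\<lambda>\<xi>. h * 0 / \<xi> powr (1 / n)) \<longlongrightarrow> g * 0) at_top"
  proof (rule right_wave_normalised[OF curve Xl t0 _ _ _ _ _ _ _ _ g,
        where p="\<lambda>r. 1" and q="\<lambda>r. 0" and Z="\<lambda>s. 1 + alpha * \<tau> s" and ?Z0.0=1])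
    show "((\<lambda>s. 1 + alpha * \<tau> s) \<longlongrightarrow> 1) (at_right 0)" using tendsto_add[OF tendsto_const
        tendsto_mult_left[OF t0, of alpha], of 1] by simp
    show "eventually (\<lambda>s. \<tau> s > 0) (at_right 0)" using ev(1) by eventually_elim (use tpos in auto)
  qed (auto simp: X_def P_def)
  then obtain h \<iota> where h: "h > 0" and w0: "char_wave {h * 0<..} (\<lambda>\<xi>. h * P (\<iota> \<xi>)) (\<lambda>\<xi>. h * 0)"
     "filterlim \<iota> (at_left 1) (at_right (h * 0))" "\<forall>\<xi>>h * 0. h * X (\<iota> \<xi>) = \<xi>"
     "((\<lambda>\<xi>. h * P (\<iota> \<xi>) / \<xi> powr (1 / n)) \<longlongrightarrow> g * 1) at_top" by blast
  note w = w0[unfolded mult_zero_right]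
  define K where "K = 1 / (2 * l) / (0 + alpha)"
  have K: "K > 0" unfolding K_def using l_gt_1 alpha_pos by simp
  have "((\<lambda>s. 1 / (2 * l) / (inverse (\<tau> s) + alpha)) \<longlongrightarrow> K) (at_left 1)"
    unfolding K_def by (intro tendsto_intros it) (use alpha_pos l_gt_1 in auto)
  from filterlim_compose[OF this w(2)]
  have "((\<lambda>\<xi>. 1 / (2 * l) / (inverse (\<tau> (\<iota> \<xi>)) + alpha)) \<longlongrightarrow> K) (at_right 0)" .
  then have dec: "((\<lambda>\<xi>. (h * P (\<iota> \<xi>) - 0) / (2 * l) / \<xi> powr 1) \<longlongrightarrow> K) (at_right 0)"
  proof (rule Lim_transform_eventually)
    have "eventually (\<lambda>\<xi>. \<iota> \<xi> \<in> {0<..<1}) (at_right 0)"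
      using w(2) ev(2) unfolding filterlim_iff by blast
    then show "eventually (\<lambda>\<xi>. 1 / (2 * l) / (inverse (\<tau> (\<iota> \<xi>)) + alpha) = (h * P (\<iota> \<xi>) - 0)
        / (2 * l) / \<xi> powr 1) (at_right 0)"
      using eventually_at_right_less[of "0::real"]
    proof eventually_elim
      case (elim \<xi>)
      have s: "0 < \<iota> \<xi>" "\<iota> \<xi> < 1" using elim by auto
      have "h * X (\<iota> \<xi>) = \<xi>" using w(3) elim by simp
      then have "\<xi> = h * P (\<iota> \<xi>) * (inverse (\<tau> (\<iota> \<xi>)) + alpha)"
        unfolding XP[OF s] mult.assoc by (rule sym)
      moreover have "h * P (\<iota> \<xi>) > 0" using h tpos[OF s] by (simp add: P_def)
      moreover have "\<xi> powr 1 = \<xi>" using elim by simp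
      moreover have pcq: "p / c / (p * q) = 1 / c / q" if "p > 0" for p c q :: real
        using that by simp
      ultimately have "(h * P (\<iota> \<xi>) - 0) / (2 * l) / \<xi> powr 1
          = h * P (\<iota> \<xi>) / (2 * l) / (h * P (\<iota> \<xi>) * (inverse (\<tau> (\<iota> \<xi>)) + alpha))"
        by simp
      also have "\<dots> = 1 / (2 * l) / (inverse (\<tau> (\<iota> \<xi>)) + alpha)"
        by (rule pcq) (use h tpos[OF s] in \<open>simp add: P_def\<close>)
      finally show ?case by (rule sym)
    qed
  qed
  define P' Q' where "P' = (\<lambda>\<xi>. h * P (\<iota> \<xi>))" and "Q' = (\<lambda>\<xi>::real. 0::real)"
  have "char_wave {0<..} P' Q'"
    "((\<lambda>\<xi>. P' \<xi> / \<xi> powr (1 / n)) \<longlongrightarrow> g * 1) at_top" "((\<lambda>\<xi>. Q' \<xi> / \<xi> powr (1 / n)) \<longlongrightarrow> 0) at_top"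
    "((\<lambda>\<xi>. (P' \<xi> - Q' \<xi>) / (2 * l) / \<xi> powr 1) \<longlongrightarrow> K) (at_right 0)"
    using w dec unfolding P'_def Q'_def by simp_all
  then show ?thesis using K by blast
qed

end

section \<open>Compression waves and the shock\<close>

text \<open>
  \<open>w\<close> and \<open>A\<close> are the relative speed and the sound speed ahead of the shock.  Behind it, mass
  conservation divides \<open>w\<close> by the density ratio \<open>d\<close> and multiplies the sound speed by \<open>d\<^sup>1\<^sup>/\<^sup>l\<close>; the
  adiabat is what momentum conservation requires.  The last two claims are the entropy condition.
\<close>
lemma shock_relations:
  fixes A d l w \<gamma> :: real
  assumes l: "l > 1" and \<gamma>: "\<gamma> = 1 + 2 / l" and d: "d > 1" and A: "A > 0" and w: "w > 0" "w\<^sup>2 =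
      adiabat \<gamma> d * A\<^sup>2"
  shows "(d powr (1 / l) * A) powr l * (w / d) = A powr l * w"
    and "(d powr (1 / l) * A) powr l * ((w / d)\<^sup>2 + (d powr (1 / l) * A)\<^sup>2 / \<gamma>) =
        A powr l * (w\<^sup>2 + A\<^sup>2 / \<gamma>)"
    and "w / d < d powr (1 / l) * A" and "A < w"
proof -
  have g1: "\<gamma> > 1" using l \<gamma> by simp
  have Al: "(d powr (1 / l) * A) powr l = d * A powr l"
    using l d A by (simp add: powr_mult powr_powr)
  show "(d powr (1 / l) * A) powr l * (w / d) = A powr l * w" unfolding Al using d by simp
  have d2: "(d powr (1 / l))\<^sup>2 = d powr (\<gamma> - 1)"
    unfolding \<gamma> using d by (simp add: power2_eq_square flip: powr_add)
  have dg: "d * d powr (\<gamma> - 1) = d powr \<gamma>" using d by (simp add: powr_diff)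
  have ad: "adiabat \<gamma> d * (\<gamma> * (d - 1)) = d * (d powr \<gamma> - 1)" using d g1 by (simp add: adiabat_def)
  have "d * ((w / d)\<^sup>2 + (d powr (1 / l) * A)\<^sup>2 / \<gamma>) = w\<^sup>2 + A\<^sup>2 / \<gamma>"
  proof -
    have "d * ((w / d)\<^sup>2 + (d powr (1 / l) * A)\<^sup>2 / \<gamma>) = w\<^sup>2 / d + (d * d powr (\<gamma> - 1)) * A\<^sup>2 / \<gamma>"
      using d by (simp add: power_mult_distrib power_divide d2 distrib_left power2_eq_square[of d])
    also have "\<dots> = A\<^sup>2 * (adiabat \<gamma> d / d + d powr \<gamma> / \<gamma>)"
      unfolding w(2) dg by (simp add: algebra_simps)
    also have "adiabat \<gamma> d / d + d powr \<gamma> / \<gamma> = adiabat \<gamma> d + 1 / \<gamma>"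
    proof -
      have "adiabat \<gamma> d * \<gamma> * (d - 1) / d = d powr \<gamma> - 1" using ad d by (simp add: mult.assoc)
      then have "adiabat \<gamma> d * \<gamma> - adiabat \<gamma> d * \<gamma> / d = d powr \<gamma> - 1" using d by (simp add:
          field_simps)
      then show ?thesis using g1 by (simp add: field_simps)
    qed
    finally show ?thesis unfolding w(2) by (simp add: algebra_simps)
  qed
  then have "A powr l * (d * ((w / d)\<^sup>2 + (d powr (1 / l) * A)\<^sup>2 / \<gamma>)) = A powr l * (w\<^sup>2 + A\<^sup>2 / \<gamma>)"
      by simp
  then show "(d powr (1 / l) * A) powr l * ((w / d)\<^sup>2 + (d powr (1 / l) * A)\<^sup>2 / \<gamma>) =
      A powr l * (w\<^sup>2 + A\<^sup>2 / \<gamma>)"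
    unfolding Al by (simp only: mult_ac)
  have "w\<^sup>2 < d powr \<gamma> * A\<^sup>2" unfolding w(2) using adiabat_less[OF d g1] A by simp
  also have "\<dots> \<le> (d powr (\<gamma> - 1) * (d * d)) * A\<^sup>2"
  proof (rule mult_right_mono)
    have "d powr \<gamma> * 1 \<le> d powr \<gamma> * d" using d by (intro mult_left_mono) auto
    then show "d powr \<gamma> \<le> d powr (\<gamma> - 1) * (d * d)" unfolding dg[symmetric] by (simp add: mult_ac)
  qed simp
  also have "\<dots> = (d * (d powr (1 / l) * A))\<^sup>2" by (simp add: power_mult_distrib d2
      power2_eq_square[of d])
  finally have "w < d * (d powr (1 / l) * A)" by (rule power2_less_imp_less) (use d A in auto)
  then show "w / d < d powr (1 / l) * A" using d by (simp add: pos_divide_less_eq mult.commute)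
  have "1 * A\<^sup>2 < w\<^sup>2" unfolding w(2) using adiabat_gt[OF d g1] d A by (intro
      mult_strict_right_mono) auto
  then show "A < w" using w by (intro power2_less_imp_less[of A w]) auto
qed

context self_similar_exponents
begin

text \<open>The shock conditions in terms of the Riemann invariants on both sides.\<close>
definition shock_states :: "real \<Rightarrow> real \<Rightarrow> real \<Rightarrow> real \<Rightarrow> real \<Rightarrow> bool" where
  "shock_states s pm qm pp qp \<longleftrightarrow>
    (let um = (pm + qm) / 2; cm = (pm - qm) / (2 * l); up = (pp + qp) / 2; cp = (pp - qp)
        / (2 * l); \<gamma> = 1 + 2 / l in
      cm > 0 \<and> cp > 0 \<and> cm powr l * (um - s) = cp powr l * (up - s) \<and>
      cm powr l * ((um - s)\<^sup>2 + cm\<^sup>2 / \<gamma>) = cp powr l * ((up - s)\<^sup>2 + cp\<^sup>2 / \<gamma>) \<and>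
      um + cm > s \<and> s > up + cp)"

text \<open>
  \<open>y\<close> is \<open>k \<xi> / Q\<close> on the wave ahead of the shock, \<open>r1\<close> is the breaking point and \<open>rz\<close> the point
  \<open>\<xi> = 0\<close>.  Since the shock conditions are homogeneous, only ratios matter, and the left state is
  described by its own ratio \<open>r'\<close> and its own value of \<open>k \<xi> / Q\<close>.  The function \<open>\<psi>\<close> compares that
  value with the vacuum wave.  It is negative at \<open>r1\<close>, where the left state equals the right one and
  lies on the sonic line, below the vacuum wave.  It is positive at \<open>rz\<close>: the flow behind the shock
  is subsonic, and for \<open>\<xi> = 0\<close> that forces \<open>r' < 0\<close>.
\<close>
lemma shock_onto_vacuum_wave:
  assumes r: "0 < r1" "r1 < rz" "rz < 1" and cont: "continuous_on {r1..rz} y"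
    and y1: "y r1 = beta + alpha * r1" and yz: "y rz = 0"
    and y: "\<And>r. r1 < r \<Longrightarrow> r \<le> rz \<Longrightarrow> 0 \<le> y r \<and> y r < beta + alpha * r"
  shows "\<exists>r r'. r1 < r \<and> r < rz \<and> 0 < y r \<and> 0 < r' \<and> r' < 1 \<and>
    (\<forall>m>0. shock_states (- m * y r) (r' * (- m * y r / reg_ratio r')) (- m * y r / reg_ratio r')
        (- m * r) (- m))"
proof -
  define \<gamma> where "\<gamma> = 1 + 2 / l"
  have g1: "\<gamma> > 1" using l_gt_1 by (simp add: \<gamma>_def)
  define V A where "V = (\<lambda>r::real. (1 + r) / 2)" and "A = (\<lambda>r::real. (1 - r) / (2 * l))"
  have VA: "beta + alpha * r = V r - A r" for r
    using l_gt_1 by (simp add: V_def A_def alpha_def beta_def field_simps)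
  have Ap: "A r > 0" if "r \<le> rz" for r using that r l_gt_1 by (simp add: A_def)
  define m where "m = (\<lambda>r. ((V r - y r) / A r)\<^sup>2)"
  have cV: "continuous_on {r1..rz} V" "continuous_on {r1..rz} A"
    unfolding V_def A_def using l_gt_1 by (auto intro!: continuous_intros)
  have cm: "continuous_on {r1..rz} m" unfolding m_def
    by (intro continuous_intros cV cont) (use Ap in force)
  have m1: "m r1 = 1" using y1 Ap[of r1] r unfolding m_def VA by simp
  have wA: "V x - y x > A x" if "r1 < x" "x \<le> rz" for x using y[OF that] VA[of x] by simp
  have mgt: "m x > 1" if "r1 < x" "x \<le> rz" for x
  proof -
    have "(V x - y x) / A x > 1" using wA[OF that] Ap[OF that(2)] by simp
    then show ?thesis unfolding m_def by (simp add: one_less_power)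
  qed
  have "compact (m ` {r1..rz})" by (intro compact_continuous_image cm compact_Icc)
  then have "bounded (m ` {r1..rz})" by (rule compact_imp_bounded)
  then obtain B0 where "\<forall>v\<in>m ` {r1..rz}. norm v \<le> B0" unfolding bounded_iff by blast
  then have B0: "\<bar>m x\<bar> \<le> B0" if "x \<in> {r1..rz}" for x using that by force
  (* The Mach numbers on the compact range are bounded, so the inverse of the adiabat is needed on a
     compact interval only. *)
  define B where "B = max B0 2"
  have B: "B > 1" by (simp add: B_def)
  have mB: "m x \<in> {1..B}" if "x \<in> {r1..rz}" for x
    using B0[OF that] mgt[of x] m1 that by (cases "x = r1") (auto simp: B_def)
  obtain \<delta> where d: "continuous_on {1..B} \<delta>" "\<forall>m\<in>{1..B}. \<delta> m \<ge> 1 \<and> adiabat \<gamma> (\<delta> m) = m" "\<delta> 1 = 1"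
    using adiabat_inverse[OF g1 B] by blast
  define D where "D = (\<lambda>r. \<delta> (m r))"
  have cD: "continuous_on {r1..rz} D" unfolding D_def
    by (rule continuous_on_compose2[OF d(1) cm]) (use mB in auto)
  have D1: "D r1 = 1" by (simp add: D_def m1 d)
  have Dge: "D x \<ge> 1" if "x \<in> {r1..rz}" for x using d(2) mB[OF that] by (auto simp: D_def)
  have Dad: "adiabat \<gamma> (D x) = m x" if "x \<in> {r1..rz}" for x using d(2) mB[OF that] by (auto simp: D_def)
  have Dgt: "D x > 1" if x: "r1 < x" "x \<le> rz" for x
  proof -
    have "D x \<noteq> 1" using Dad[of x] mgt[OF x] x by (auto simp: adiabat_def)
    then show ?thesis using Dge[of x] x by simp
  qed
  define Vm Am where "Vm = (\<lambda>r. y r + (V r - y r) / D r)" and "Am = (\<lambda>r. D r powr (1 / l) * A r)"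
  have cVm: "continuous_on {r1..rz} Vm" "continuous_on {r1..rz} Am"
    unfolding Vm_def Am_def by (intro continuous_intros cV cont cD; use Dge in force)+
  have Amp: "Am x > 0" if "x \<in> {r1..rz}" for x using Ap[of x] Dge[OF that] that by (simp add: Am_def)
  have y0: "y x \<ge> 0" if "x \<in> {r1..rz}" for x
    using y[of x] that y1 beta_pos alpha_pos r by (cases "x = r1") auto
  have Vmp: "Vm x > 0" if x: "x \<in> {r1..rz}" for x
  proof -
    have "V x - y x > 0"
    proof (cases "x = r1")
      case True then show ?thesis using y1 VA[of r1] Ap[of r1] r by simp
    next
      case False then show ?thesis using wA[of x] Ap[of x] x by auto
    qed
    then have "(V x - y x) / D x > 0" using Dge[OF x] by simp
    then show ?thesis using y0[OF x] by (simp add: Vm_def)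
  qed
  define s where "s = (\<lambda>r. Vm r + l * Am r)"
  have sp: "s x > 0" if "x \<in> {r1..rz}" for x unfolding s_def using Vmp[OF that] Amp[OF that] l_gt_1
      by (simp add: add_pos_pos)
  define r' where "r' = (\<lambda>r. (Vm r - l * Am r) / s r)"
  have cs: "continuous_on {r1..rz} s" unfolding s_def by (intro continuous_intros cVm)
  have cr': "continuous_on {r1..rz} r'" unfolding r'_def by (intro continuous_intros cVm cs)
      (use sp in force)
  have r'1: "r' x < 1" if "x \<in> {r1..rz}" for x
    unfolding r'_def using sp[OF that] Amp[OF that] l_gt_1 by (simp add: s_def pos_divide_less_eq)
  have cr: "continuous_on {..<1} reg_ratio"
    using reg_ratio_isCont by (auto intro!: continuous_at_imp_continuous_on)
  define \<psi> where "\<psi> = (\<lambda>r. y r / s r - reg_ratio (r' r))"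
  have "continuous_on {r1..rz} (\<lambda>r. reg_ratio (r' r))"
    by (rule continuous_on_compose2[OF cr cr']) (use r'1 in auto)
  then have c\<psi>: "continuous_on {r1..rz} \<psi>" unfolding \<psi>_def
    by (intro continuous_on_diff continuous_on_divide cont cs) (use sp in force)+
  have w2: "(V x - y x)\<^sup>2 = adiabat \<gamma> (D x) * (A x)\<^sup>2" if x: "r1 < x" "x \<le> rz" for x
    using Dad[of x] x Ap[of x] by (simp add: m_def power_divide)
  have rel: "(Am x) powr l * ((V x - y x) / D x) = A x powr l * (V x - y x)"
    "(Am x) powr l * (((V x - y x) / D x)\<^sup>2 + (Am x)\<^sup>2 / \<gamma>) =
        A x powr l * ((V x - y x)\<^sup>2 + (A x)\<^sup>2 / \<gamma>)"
    "(V x - y x) / D x < Am x" if x: "r1 < x" "x \<le> rz" for x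
    using shock_relations[OF l_gt_1 \<gamma>_def Dgt[OF x] Ap[OF x(2)] _ w2[OF x]] wA[OF x] Ap[OF x(2)]
    unfolding Am_def by auto
  (* The state behind the shock lies on the subsonic side of the sonic line. *)
  have sub: "y x / s x > beta + alpha * r' x" if x: "r1 < x" "x \<le> rz" for x
  proof -
    have xi: "x \<in> {r1..rz}" using x by simp
    have "beta * s x + alpha * (Vm x - l * Am x) = (alpha + beta) * Vm x - (alpha - beta) * l * Am x"
      unfolding s_def by (simp add: algebra_simps)
    also have "\<dots> = Vm x - Am x" unfolding alpha_beta_sum alpha_beta_diff using l_gt_1 by simp
    also have "\<dots> < y x" using rel(3)[OF x] by (simp add: Vm_def)
    finally have "(beta * s x + alpha * (Vm x - l * Am x)) / s x < y x / s x"
      using sp[OF xi] by (intro divide_strict_right_mono)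
    then show ?thesis using sp[OF xi] by (simp add: add_divide_distrib r'_def)
  qed
  have start: "\<psi> r1 < 0"
  proof -
    have v: "Vm r1 = V r1" "Am r1 = A r1" by (simp_all add: Vm_def Am_def D1)
    have "s r1 = 1" unfolding s_def v using l_gt_1 by (simp add: V_def A_def field_simps)
    moreover have "Vm r1 - l * Am r1 = r1" unfolding v using l_gt_1 by (simp add:
        V_def A_def field_simps)
    ultimately have "\<psi> r1 = beta + alpha * r1 - reg_ratio r1" by (simp add: \<psi>_def r'_def y1)
    then show ?thesis using reg_ratio_gt[of r1] r by simp
  qed
  have low: "\<psi> x > 0" if x: "r1 < x" "x \<le> rz" and "r' x \<le> 0" for x
    using sub[OF x] that by (simp add: \<psi>_def reg_ratio_def)
  have stop: "\<psi> rz > 0"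
  proof -
    have "beta + alpha * r' rz < 0" using sub[of rz] yz r by simp
    then have "alpha * r' rz < 0" using beta_pos by simp
    then have "r' rz \<le> 0" using alpha_pos by (simp add: mult_less_0_iff)
    then show ?thesis using low[of rz] r by simp
  qed
  have "\<exists>x\<ge>r1. x \<le> rz \<and> \<psi> x = 0"
    by (rule IVT'[OF _ _ _ c\<psi>]) (use start stop r in auto)
  then obtain x where x: "r1 \<le> x" "x \<le> rz" "\<psi> x = 0" by blast
  have x1: "r1 < x" "x < rz" using x start stop by (auto simp: order_le_less)
  have xi: "x \<in> {r1..rz}" using x by simp
  have rp: "r' x > 0" using low[OF x1(1) x(2)] x(3) by (cases "r' x \<le> 0") auto
  have yr: "y x / s x = reg_ratio (r' x)" using x(3) by (simp add: \<psi>_def)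
  have "reg_ratio (r' x) > 0" using reg_ratio_pos[of "r' x"] rp r'1[OF xi] by simp
  then have yp: "y x > 0" using yr sp[OF xi] by (metis zero_less_divide_iff order.asym)
  have "shock_states (- m0 * y x) (r' x * (- m0 * y x / reg_ratio (r' x)))
      (- m0 * y x / reg_ratio (r' x)) (- m0 * x) (- m0)"
    if m0: "m0 > 0" for m0
  proof -
    have q: "- m0 * y x / reg_ratio (r' x) = - m0 * s x" unfolding yr[symmetric] using yp sp[OF xi]
        by simp
    have p: "r' x * (- m0 * s x) = - m0 * (Vm x - l * Am x)" unfolding r'_def using sp[OF xi] by simp
    have um: "(- m0 * (Vm x - l * Am x) + - m0 * s x) / 2 = - m0 * Vm x" by (simp add:
        s_def algebra_simps)
    have cm': "(- m0 * (Vm x - l * Am x) - - m0 * s x) / (2 * l) = m0 * Am x"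
        using l_gt_1 by (simp add: s_def field_simps)
    have up: "(- m0 * x + - m0) / 2 = - m0 * V x" by (simp add: V_def algebra_simps)
    have cp: "(- m0 * x - - m0) / (2 * l) = m0 * A x" using l_gt_1 by (simp add: A_def field_simps)
    have wm: "Vm x - y x = (V x - y x) / D x" by (simp add: Vm_def)
    have pA: "(m0 * Am x) powr l = m0 powr l * Am x powr l" "(m0 * A x) powr l = m0 powr l * A x powr l"
      using m0 Amp[OF xi] Ap[OF x(2)] by (simp_all add: powr_mult)
    note R = rel[OF x1(1) x(2)]
    have vel: "- m0 * Vm x - - m0 * y x = - m0 * (Vm x - y x)" "- m0 * V x - - m0 * y x =
        - m0 * (V x - y x)"
      by (simp_all add: algebra_simps)
    have sq: "(- m0 * a)\<^sup>2 + (m0 * b)\<^sup>2 / \<gamma> = m0\<^sup>2 * (a\<^sup>2 + b\<^sup>2 / \<gamma>)" for a b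
      by (simp add: power_mult_distrib distrib_left)
    have "(m0 * Am x) powr l * (- m0 * Vm x - - m0 * y x) = m0 powr l * - m0 * (Am x powr l * ((V x
        - y x) / D x))"
      unfolding vel pA wm by (simp only: mult_ac)
    also have "\<dots> = (m0 * A x) powr l * (- m0 * V x - - m0 * y x)"
      unfolding R(1) vel pA by (simp only: mult_ac)
    finally have mass: "(m0 * Am x) powr l * (- m0 * Vm x - - m0 * y x) = (m0 * A x)
        powr l * (- m0 * V x - - m0 * y x)" .
    have "(m0 * Am x) powr l * ((- m0 * Vm x - - m0 * y x)\<^sup>2 + (m0 * Am x)\<^sup>2 / \<gamma>)
        = m0 powr l * m0\<^sup>2 * (Am x powr l * (((V x - y x) / D x)\<^sup>2 + (Am x)\<^sup>2 / \<gamma>))"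
      unfolding vel sq pA wm by (simp only: mult_ac)
    also have "\<dots> = (m0 * A x) powr l * ((- m0 * V x - - m0 * y x)\<^sup>2 + (m0 * A x)\<^sup>2 / \<gamma>)"
      unfolding R(2) vel sq pA by (simp only: mult_ac)
    finally have mom: "(m0 * Am x) powr l * ((- m0 * Vm x - - m0 * y x)\<^sup>2 + (m0 * Am x)\<^sup>2 / \<gamma>)
        = (m0 * A x) powr l * ((- m0 * V x - - m0 * y x)\<^sup>2 + (m0 * A x)\<^sup>2 / \<gamma>)" .
    have "m0 * (Vm x - y x) < m0 * Am x" unfolding wm using R(3) m0 by (rule mult_strict_left_mono)
    then have e1: "- m0 * Vm x + m0 * Am x > - m0 * y x" by (simp add: algebra_simps)
    have "m0 * A x < m0 * (V x - y x)" using wA[OF x1(1) x(2)] m0 by simp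
    then have e2: "- m0 * y x > - m0 * V x + m0 * A x" by (simp add: algebra_simps)
    show ?thesis
      unfolding shock_states_def Let_def q p um cm' up cp \<gamma>_def[symmetric]
      using mass mom e1 e2 m0 Amp[OF xi] Ap[OF x(2)] by (intro conjI mult_pos_pos)
  qed
  then show ?thesis using x1 yp rp r'1[OF xi] by (intro exI[of _ x] exI[of _ "r' x"]) auto
qed

text \<open>
  \<open>T'\<close> is negative at \<open>r0\<close>.  Near \<open>0\<close> it is positive, because there the Wronskian is negligible while
  the derivative of \<open>regT\<close> stays away from \<open>0\<close>.  So \<open>T'\<close> changes sign, and only once.
\<close>
lemma compression_wave_hodograph:
  assumes r0: "0 < r0" "r0 < 1"
  shows "\<exists>T T1 N r1. 0 < r1 \<and> r1 < r0 \<and> hodograph_sol {0<..<1} T T1 N \<and> T1 r1 = 0 \<and>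
    (\<forall>r. 0 < r \<longrightarrow> r < r0 \<longrightarrow> T r > 0) \<and> (\<forall>r. r1 < r \<longrightarrow> r < r0 \<longrightarrow> T1 r < 0 \<and> N r < 0) \<and>
    T r0 = 0 \<and> N r0 < 0"
proof -
  obtain H where H0: "H r0 = 0" and dH: "\<And>r. r \<in> {0<..<1} \<Longrightarrow> (H has_real_derivative wronskian r /
      (regT r)\<^sup>2) (at r)"
    using hodograph_reduction_multiplier[OF refl _ _ regT_hodograph, of r0] r0 regT_pos by force
  define T where "T = (\<lambda>r. - (regT r * H r))"
  define T1 where "T1 = (\<lambda>r. - (regT1 r * H r + wronskian r / regT r))"
  define N where "N = (\<lambda>r. - (regN r * H r + r * wronskian r / regT r))"
  have sol: "hodograph_sol {0<..<1} T T1 N"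
    unfolding T_def T1_def N_def
    by (rule hodograph_sol_minus, rule hodograph_reduction_of_order[OF _ regT_hodograph _ dH])
        (use regT_pos in auto)
  have Hinc: "H x < H y" if "0 < x" "x < y" "y < 1" for x y
  proof (rule DERIV_pos_imp_increasing[OF that(2)])
    fix z assume "x \<le> z" "z \<le> y"
    then have z: "z \<in> {0<..<1}" "z < 1" "z \<noteq> 0" "z \<ge> 0" using that by auto
    then have "wronskian z / (regT z)\<^sup>2 > 0" using wronskian_pos[of z] regT_pos[of z] by simp
    then show "\<exists>d. (H has_real_derivative d) (at z) \<and> d > 0" using dH[OF z(1)] by blast
  qed
  have Hneg: "H r < 0" if "0 < r" "r < r0" for r using Hinc[of r r0] that r0 H0 by simp
  have Tpos: "T r > 0" if "0 < r" "r < r0" for r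
    unfolding T_def using Hneg[OF that] regT_pos[of r] that by (simp add: mult_pos_neg)
  have T1r0: "T1 r0 < 0" unfolding T1_def H0 using wronskian_pos[of r0] regT_pos[of r0] r0 by simp
  have dW: "((\<lambda>r. T1 r / wronskian r) has_real_derivative - M * (n - 1) * T x / (x * (1 - x)
      * wronskian x)) (at x)"
    if "0 < x" "x < 1" for x
    by (rule hodograph_slope_over_wronskian[OF refl _ _ sol]) (use that in auto)
  have dec: "T1 y / wronskian y < T1 x / wronskian x" if xy: "0 < x" "x < y" "y \<le> r0" for x y
  proof (rule DERIV_neg_imp_decreasing_open[OF xy(2)])
    fix z assume z: "x < z" "z < y"
    have "- M * (n - 1) * T z / (z * (1 - z) * wronskian z) < 0"
      using z xy r0 M_gt_1 n_gt_1 Tpos[of z] wronskian_pos[of z]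
      by (intro divide_neg_pos) (auto simp: mult_neg_pos)
    then show "\<exists>d. ((\<lambda>r. T1 r / wronskian r) has_real_derivative d) (at z) \<and> d < 0"
      using dW[of z] z xy r0 by auto
  next
    show "continuous_on {x..y} (\<lambda>r. T1 r / wronskian r)"
    proof (intro continuous_at_imp_continuous_on ballI)
      fix z assume "z \<in> {x..y}"
      then show "isCont (\<lambda>r. T1 r / wronskian r) z" using dW[of z] xy r0 DERIV_isCont by auto
    qed
  qed
  obtain ra where ra: "0 < ra" "ra < r0" "T1 ra > 0"
  proof -
    obtain \<delta> where \<delta>: "\<delta> > 0" "\<forall>r\<in>{0<..<1}. regT1 r \<ge> \<delta>" using regT1_bounded_below by blast
    define h where "h = - H (r0 / 2)"
    have h: "h > 0" using Hneg[of "r0 / 2"] r0 by (simp add: h_def)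
    have "((\<lambda>r. wronskian r / regT r) \<longlongrightarrow> 0 / regT 0) (at_right 0)"
      by (intro tendsto_divide wronskian_tendsto_0 regT_tendsto_0) (use regT_pos[of 0] in auto)
    then have "((\<lambda>r. wronskian r / regT r) \<longlongrightarrow> 0) (at_right 0)" by simp
    then have "eventually (\<lambda>r. wronskian r / regT r < \<delta> * h) (at_right 0)"
      by (rule order_tendstoD) (use \<delta> h in simp)
    moreover have "eventually (\<lambda>r. r \<in> {0<..<r0 / 2}) (at_right 0)"
        by (rule eventually_at_rightI[of 0 "r0 / 2"]) (use r0 in auto)
    ultimately have "eventually (\<lambda>r. wronskian r / regT r < \<delta> * h \<and> r \<in> {0<..<r0 / 2}) (at_right 0)"
        by (rule eventually_conj)
    from eventually_happens[OF this] obtain r where r: "wronskian r / regT r < \<delta> * h" "0 < r"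
        "r < r0 / 2"
      by (auto simp: trivial_limit_at_right_real)
    have "h \<le> - H r" using Hinc[of r "r0 / 2"] r r0 by (simp add: h_def)
    then have "\<delta> * h \<le> regT1 r * (- H r)" using \<delta> r r0 h regT1_pos[of r] by (intro mult_mono) auto
    then have "T1 r > 0" using r unfolding T1_def by simp
    then show ?thesis using that[of r] r r0 by auto
  qed
  have "\<exists>x\<ge>ra. x \<le> r0 \<and> T1 x / wronskian x = 0"
  proof (rule IVT2')
    show "T1 r0 / wronskian r0 \<le> 0" "0 \<le> T1 ra / wronskian ra"
      using T1r0 ra wronskian_pos[of r0] wronskian_pos[of ra] r0 by (auto simp: divide_nonpos_pos)
    show "continuous_on {ra..r0} (\<lambda>r. T1 r / wronskian r)"
    proof (intro continuous_at_imp_continuous_on ballI)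
      fix z assume "z \<in> {ra..r0}"
      then show "isCont (\<lambda>r. T1 r / wronskian r) z" using dW[of z] ra r0 DERIV_isCont by auto
    qed
  qed (use ra in auto)
  then obtain r1 where r1: "ra \<le> r1" "r1 \<le> r0" "T1 r1 / wronskian r1 = 0" by blast
  have w1: "wronskian r1 > 0" using wronskian_pos[of r1] r1 ra r0 by auto
  then have T11: "T1 r1 = 0" using r1 by simp
  have r1': "0 < r1" "r1 < r0" using r1 ra T11 T1r0 by (auto simp: order_le_less)
  have T1neg: "T1 r < 0" if "r1 < r" "r < r0" for r
  proof -
    have "T1 r / wronskian r < 0" using dec[of r1 r] that r1 r1' by auto
    then show ?thesis using wronskian_pos[of r] that r1' r0 by (simp add: divide_less_0_iff)
  qed
  have N_eq: "N r = r * T1 r - (n - 1) * T r" if "0 < r" "r < 1" for r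
    using sol that unfolding hodograph_sol_def by auto
  have Nneg: "N r < 0" if "r1 < r" "r < r0" for r
  proof -
    have "r * T1 r < 0" using T1neg[OF that] that r1' by (simp add: mult_pos_neg)
    moreover have "(n - 1) * T r > 0" using Tpos[of r] that r1' n_gt_1 by simp
    ultimately show ?thesis using N_eq[of r] that r1' r0 by simp
  qed
  have T0: "T r0 = 0" by (simp add: T_def H0)
  have "N r0 < 0" using N_eq[of r0] T0 T1r0 r0 by (simp add: mult_pos_neg)
  then show ?thesis using r1' sol T11 Tpos T1neg Nneg T0 by blast
qed

lemma compression_wave:
  assumes r0: "0 < r0" "r0 < 1" and g: "g > 0"
  shows "\<exists>z<0. \<exists>P Q pp qp r'. char_wave {z<..} P Q \<and> (P \<longlongrightarrow> pp) (at_right z) \<and> (Q \<longlongrightarrow> qp) (at_right z) \<and>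
    0 < r' \<and> r' < 1 \<and> shock_states (k * z) (r' * (k * z / reg_ratio r')) (k * z / reg_ratio r') pp qp \<and>
    ((\<lambda>\<xi>. P \<xi> / \<xi> powr (1 / n)) \<longlongrightarrow> g * (- r0)) at_top \<and> ((\<lambda>\<xi>. Q \<xi> / \<xi> powr (1 / n)) \<longlongrightarrow> g * (- 1)) at_top"
proof -
  obtain T T1 N r1 where r1: "0 < r1" "r1 < r0" and sol: "hodograph_sol {0<..<1} T T1 N" and T11:
      "T1 r1 = 0"
    and Tp: "\<forall>r. 0 < r \<longrightarrow> r < r0 \<longrightarrow> T r > 0" and sgn: "\<forall>r. r1 < r \<longrightarrow> r < r0 \<longrightarrow> T1 r < 0 \<and> N r < 0"
    and T0: "T r0 = 0" and N0: "N r0 < 0"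
    using compression_wave_hodograph[OF r0] by blast
  have op: "open {0<..<1::real}" "0 \<notin> {0<..<1::real}" by auto
  have c: "isCont T r" "isCont N r" "isCont T1 r" if "0 < r" "r < 1" for r
    using hodograph_sol_isCont[OF sol _ op, of r] that by auto
  let ?y = "pos_ratio T N"
  have eq: "r * T1 r = N r + (n - 1) * T r" if "0 < r" "r < 1" for r
    using sol that unfolding hodograph_sol_def by auto
  have cy: "isCont ?y r" if "0 < r" "r < r0" for r
    unfolding pos_ratio_def[abs_def] using Tp that r0 l_gt_1 n_gt_1
    by (intro continuous_intros c) auto
  have yB: "?y r - (beta + alpha * r) = r * (1 - r) * T1 r / (l * (n - 1) * T r)" if "0 < r"
      "r < r0" for r
    using pos_ratio_alt[of r T1 N T] eq[of r] Tp that r0 by auto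
  have y1: "?y r1 = beta + alpha * r1" using yB[of r1] r1 T11 by simp
  have ylt: "?y r < beta + alpha * r" if "r1 < r" "r < r0" for r
  proof -
    have "r * (1 - r) * T1 r / (l * (n - 1) * T r) < 0"
      using sgn Tp that r1 r0 l_gt_1 n_gt_1 by (intro divide_neg_pos mult_pos_neg mult_pos_pos) auto
    then show ?thesis using yB[of r] that r1 by simp
  qed
  let ?Z = "\<lambda>r. (T r * (alpha + beta * r) + (1 - r) * N r / (l * (n - 1))) / k"
  have cZ: "isCont ?Z r0" using r0 c k_gt_1 l_gt_1 n_gt_1 by (auto intro!: continuous_intros)
  have Zneg: "?Z r0 < 0" unfolding T0 using N0 r0 k_gt_1 l_gt_1 n_gt_1 by (simp add:
      mult_pos_neg divide_neg_pos)
  have ampZ: "amp T r * ?y r / k = T r powr (- k) * ?Z r" if "0 < r" "r < r0" for r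
    by (rule amp_scaled_ratio) (use Tp that in auto)
  obtain rb where rb: "r1 < rb" "rb < r0" "?y rb < 0"
  proof -
    have "eventually (\<lambda>r. ?Z r < 0) (at_left r0)"
      using tendsto_at_left_isCont[OF cZ] Zneg by (rule order_tendstoD)
    moreover have "eventually (\<lambda>r. r \<in> {r1<..<r0}) (at_left r0)"
        by (rule eventually_at_leftI[OF _ r1(2)]) auto
    ultimately have "eventually (\<lambda>r. ?Z r < 0 \<and> r \<in> {r1<..<r0}) (at_left r0)" by (rule eventually_conj)
    from eventually_happens[OF this] obtain r where r: "?Z r < 0" "r1 < r" "r < r0"
      by (auto simp: trivial_limit_at_left_real)
    have "0 < r" using r r1 by linarith
    then have Tr: "T r > 0" using Tp r by blast
    then have "T r powr (- k) > 0" by simp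
    then have "amp T r * ?y r / k < 0" using ampZ[OF \<open>0 < r\<close> r(3)] r(1) by (simp only: mult_pos_neg)
    moreover have "amp T r > 0" by (rule amp_pos) (rule Tr)
    ultimately have "?y r < 0" using k_gt_1 by (simp add: divide_less_0_iff mult_less_0_iff)
    then show ?thesis using that r by blast
  qed
  have "\<exists>x\<ge>r1. x \<le> rb \<and> ?y x = 0"
  proof (rule IVT2')
    show "?y rb \<le> 0" "0 \<le> ?y r1" using rb y1 beta_pos alpha_pos r1 by auto
    show "continuous_on {r1..rb} ?y" by (intro continuous_at_imp_continuous_on ballI cy)
        (use r1 rb in auto)
  qed (use rb in auto)
  then obtain rz where rz: "r1 \<le> rz" "rz \<le> rb" "?y rz = 0" by blast
  have "beta + alpha * r1 > 0" using beta_pos alpha_pos r1 by (intro add_pos_pos mult_pos_pos)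
  then have "rz \<noteq> r1" using y1 rz(3) by auto
  then have rz1: "r1 < rz" "rz < r0" using rz rb by auto
  have ynn: "0 \<le> ?y r" if r: "r1 < r" "r \<le> rz" for r
  proof (cases "r = rz")
    case False
    then have lt: "r < rz" using r by simp
    have "amp T rz * ?y rz / k < amp T r * ?y r / k"
    proof (rule DERIV_neg_imp_decreasing[OF lt])
      fix x assume x: "r \<le> x" "x \<le> rz"
      have xi: "x \<in> {0<..<1}" "x < 1" "T x > 0" "T1 x < 0" "N x < 0" using x r rz1 r1 r0 Tp sgn by auto
      have "amp T x * ((1 - x) / (l * (n - 1))) > 0" using amp_pos[of T x] xi l_gt_1 n_gt_1 by simp
      moreover have "N x * T1 x / (T x)\<^sup>2 > 0" using xi by (simp add: mult_neg_neg)
      ultimately have "- amp T x * ((1 - x) / (l * (n - 1))) * (N x * T1 x / (T x)\<^sup>2) < 0"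
        by (simp only: mult_minus_left neg_less_0_iff_less mult_pos_pos)
      then show "\<exists>d. ((\<lambda>r. amp T r * ?y r / k) has_real_derivative d) (at x) \<and> d < 0"
        using hodograph_param(3)[OF sol xi(1,2,3)] by blast
    qed
    then have "amp T r * ?y r / k > 0" using rz by simp
    moreover have "amp T r > 0" by (rule amp_pos) (use Tp r r1 rz1 in auto)
    ultimately show ?thesis using k_gt_1 by (simp add: zero_less_divide_iff zero_less_mult_iff)
  qed (use rz in simp)
  have cY: "continuous_on {r1..rz} ?y" by (intro continuous_at_imp_continuous_on ballI cy)
      (use r1 rz1 in auto)
  have "\<exists>r r'. r1 < r \<and> r < rz \<and> 0 < ?y r \<and> 0 < r' \<and> r' < 1 \<and>
    (\<forall>m>0. shock_states (- m * ?y r) (r' * (- m * ?y r / reg_ratio r')) (- m * ?y r / reg_ratio r')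
        (- m * r) (- m))"
    by (rule shock_onto_vacuum_wave[OF r1(1) rz1(1) _ cY y1 rz(3)]) (use rz1 r0 ynn ylt in auto)
  then obtain rs r' where rs: "r1 < rs" "rs < rz" "0 < ?y rs" "0 < r'" "r' < 1"
    and sh: "\<And>m. m > 0 \<Longrightarrow> shock_states (- m * ?y rs) (r' * (- m * ?y rs / reg_ratio r'))
        (- m * ?y rs / reg_ratio r') (- m * rs) (- m)"
    by blast
  have rs0: "0 < rs" "rs < r0" "rs < 1" using rs rz1 r1 r0 by auto
  let ?X = "\<lambda>s. - (amp T (- s) * ?y (- s) / k)"
  have curve: "char_curve (- r0) (- rs) ?X (\<lambda>s. - (- s * amp T (- s))) (\<lambda>s. - amp T (- s))"
    by (rule curve_left_moving_reversed[OF hodograph_sol_subset[OF sol]]) (use rs0 rs r0 Tp sgn in auto)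
  have cG: "isCont (amp T) rs" unfolding amp_def[abs_def] using Tp rs0 by (auto intro!:
      continuous_intros c)
  have fl: "filterlim (\<lambda>s::real. - s) (at_right rs) (at_left (- rs))"
    unfolding filterlim_at by (auto intro!: tendsto_eq_intros simp: eventually_at_filter)
  have fr: "filterlim (\<lambda>s::real. - s) (at_left r0) (at_right (- r0))"
    unfolding filterlim_at by (auto intro!: tendsto_eq_intros simp: eventually_at_filter)
  have Gl: "((\<lambda>s. amp T (- s)) \<longlongrightarrow> amp T rs) (at_left (- rs))"
    by (rule filterlim_compose[OF tendsto_at_right_isCont[OF cG] fl])
  have yl: "((\<lambda>s. ?y (- s)) \<longlongrightarrow> ?y rs) (at_left (- rs))"
    by (rule filterlim_compose[OF tendsto_at_right_isCont[OF cy[OF rs0(1,2)]] fl])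
  have Xl: "(?X \<longlongrightarrow> - (amp T rs * ?y rs / k)) (at_left (- rs))"
    using k_gt_1 by (intro tendsto_intros Gl yl) auto
  have Tl: "((\<lambda>s. T (- s)) \<longlongrightarrow> 0) (at_right (- r0))"
    using filterlim_compose[OF tendsto_at_left_isCont[OF c(1)[of r0]] fr] r0 T0 by simp
  have Zl: "((\<lambda>s. - ?Z (- s)) \<longlongrightarrow> - ?Z r0) (at_right (- r0))"
    by (intro tendsto_minus filterlim_compose[OF tendsto_at_left_isCont[OF cZ] fr])
  have Z0: "- ?Z r0 > 0" using Zneg by simp
  have ev: "eventually (\<lambda>s. s \<in> {- r0<..<0}) (at_right (- r0))"
      by (rule eventually_at_rightI[of _ 0]) (use r0 in auto)
  have "\<exists>h>0. \<exists>\<iota>. char_wave {h * (- (amp T rs * ?y rs / k))<..} (\<lambda>\<xi>. h * - (- \<iota> \<xi> * amp T (- \<iota> \<xi>)))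
      (\<lambda>\<xi>. h * - amp T (- \<iota> \<xi>)) \<and>
     filterlim \<iota> (at_left (- rs)) (at_right (h * (- (amp T rs * ?y rs / k)))) \<and>
         (\<forall>\<xi>>h * (- (amp T rs * ?y rs / k)). h * ?X (\<iota> \<xi>) = \<xi>) \<and>
     ((\<lambda>\<xi>. h * - (- \<iota> \<xi> * amp T (- \<iota> \<xi>)) / \<xi> powr (1 / n)) \<longlongrightarrow> g * (- r0)) at_top \<and>
     ((\<lambda>\<xi>. h * - amp T (- \<iota> \<xi>) / \<xi> powr (1 / n)) \<longlongrightarrow> g * (- 1)) at_top"
  proof (rule right_wave_normalised[OF curve Xl Tl _ Zl Z0 _ _ _ _ _ g, where p="\<lambda>s. s"
      and q="\<lambda>s. - 1"])
    show "eventually (\<lambda>s. T (- s) > 0) (at_right (- r0))" using ev by eventually_elim (use Tp in auto)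
    show "eventually (\<lambda>s. ?X s = T (- s) powr (- k) * - ?Z (- s)) (at_right (- r0))"
      using ev
    proof eventually_elim
      case (elim s)
      then show ?case using ampZ[of "- s"] by auto
    qed
    show "eventually (\<lambda>s. - (- s * amp T (- s)) = s * T (- s) powr (- (k - 1))) (at_right (- r0))"
      "eventually (\<lambda>s. - amp T (- s) = - 1 * T (- s) powr (- (k - 1))) (at_right (- r0))"
      by (simp_all add: amp_def)
    show "((\<lambda>s. s) \<longlongrightarrow> - r0) (at_right (- r0))" "((\<lambda>s. - 1) \<longlongrightarrow> (- 1::real)) (at_right (- r0))"
      by (auto intro!: tendsto_intros)
  qed
  then obtain h \<iota> where h: "h > 0" and w0: "char_wave {h * (- (amp T rs * ?y rs / k))<..} (\<lambda>\<xi>. h * -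
      (- \<iota> \<xi> * amp T (- \<iota> \<xi>))) (\<lambda>\<xi>. h * - amp T (- \<iota> \<xi>))"
     "filterlim \<iota> (at_left (- rs)) (at_right (h * (- (amp T rs * ?y rs / k))))"
     "((\<lambda>\<xi>. h * - (- \<iota> \<xi> * amp T (- \<iota> \<xi>)) / \<xi> powr (1 / n)) \<longlongrightarrow> g * (- r0)) at_top"
     "((\<lambda>\<xi>. h * - amp T (- \<iota> \<xi>) / \<xi> powr (1 / n)) \<longlongrightarrow> g * (- 1)) at_top"
    by blast
  define z where "z = h * (- (amp T rs * ?y rs / k))"
  note w = w0[folded z_def]
  have G: "amp T rs > 0" by (rule amp_pos) (use Tp rs0 in auto)
  have z: "z < 0" unfolding z_def using h G rs k_gt_1 by (simp add: mult_pos_neg)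
  define m where "m = h * amp T rs"
  have m: "m > 0" using h G by (simp add: m_def)
  have kz: "k * z = - m * ?y rs" unfolding z_def m_def using k_gt_1 by simp
  define P' Q' where "P' = (\<lambda>\<xi>. h * - (- \<iota> \<xi> * amp T (- \<iota> \<xi>)))" and "Q' = (\<lambda>\<xi>. h * - amp T (- \<iota> \<xi>))"
  have il: "(\<iota> \<longlongrightarrow> - rs) (at_right z)" using w(2) by (simp add: filterlim_at)
  have Gl': "((\<lambda>\<xi>. amp T (- \<iota> \<xi>)) \<longlongrightarrow> amp T rs) (at_right z)" by (rule filterlim_compose[OF Gl w(2)])
  have "(P' \<longlongrightarrow> h * - (- (- rs) * amp T rs)) (at_right z)" "(Q' \<longlongrightarrow> h * - amp T rs) (at_right z)"
    unfolding P'_def Q'_def by (intro tendsto_intros il Gl')+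
  moreover have "h * - (- (- rs) * amp T rs) = - m * rs" "h * - amp T rs = - m" by (simp_all add: m_def)
  ultimately have "(P' \<longlongrightarrow> - m * rs) (at_right z)" "(Q' \<longlongrightarrow> - m) (at_right z)" by (simp_all only:)
  moreover have "char_wave {z<..} P' Q'" "((\<lambda>\<xi>. P' \<xi> / \<xi> powr (1 / n)) \<longlongrightarrow> g * (- r0)) at_top"
    "((\<lambda>\<xi>. Q' \<xi> / \<xi> powr (1 / n)) \<longlongrightarrow> g * (- 1)) at_top"
    using w unfolding P'_def Q'_def by blast+
  moreover have "shock_states (k * z) (r' * (k * z / reg_ratio r')) (k * z / reg_ratio r')
      (- m * rs) (- m)"
    using sh[OF m] unfolding kz .
  ultimately show ?thesis using z rs(4,5) by blast
qed

end

section \<open>Assembling the profiles\<close>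

context self_similar_exponents
begin

text \<open>
  Profiles with vacuum to the left of \<open>\<xi>v\<close>, initial data \<open>uinf\<close> and \<open>cinf\<close>, decay exponent \<open>e\<close> at the
  interface, and exceptional points \<open>Z\<close> at which shocks or weak discontinuities may sit.
\<close>
definition vacuum_profile ::
    "real \<Rightarrow> real set \<Rightarrow> (real \<Rightarrow> real) \<Rightarrow> (real \<Rightarrow> real) \<Rightarrow> real \<Rightarrow> real \<Rightarrow> real \<Rightarrow> bool" where
  "vacuum_profile \<xi>v Z U S uinf cinf e \<longleftrightarrow>
     (\<forall>\<xi>\<le>\<xi>v. S \<xi> = 0) \<and> (\<forall>\<xi>>\<xi>v. S \<xi> > 0) \<and> finite Z \<and> 0 \<notin> Z \<and> Z \<subseteq> {\<xi>v<..} \<and>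
     smooth_profile l k ({\<xi>v<..} - Z) U S \<and>
     ((\<lambda>\<xi>. U \<xi> / \<xi> powr (1 / n)) \<longlongrightarrow> uinf) at_top \<and> ((\<lambda>\<xi>. S \<xi> / \<xi> powr (1 / n)) \<longlongrightarrow> cinf) at_top \<and>
     e > 0 \<and> (\<exists>K>0. ((\<lambda>\<xi>. S \<xi> / (\<xi> - \<xi>v) powr e) \<longlongrightarrow> K) (at_right \<xi>v))"

lemma far_field_velocity:
  assumes "((\<lambda>\<xi>. P \<xi> / \<xi> powr (1 / n)) \<longlongrightarrow> p) at_top" "((\<lambda>\<xi>. Q \<xi> / \<xi> powr (1 / n)) \<longlongrightarrow> q) at_top"
    and "eventually (\<lambda>\<xi>. U \<xi> = (P \<xi> + Q \<xi>) / 2) at_top" "eventually (\<lambda>\<xi>. S \<xi> = (P \<xi> - Q \<xi>)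
        / (2 * l)) at_top"
  shows "((\<lambda>\<xi>. U \<xi> / \<xi> powr (1 / n)) \<longlongrightarrow> (p + q) / 2) at_top"
    and "((\<lambda>\<xi>. S \<xi> / \<xi> powr (1 / n)) \<longlongrightarrow> (p - q) / (2 * l)) at_top"
proof -
  have "((\<lambda>\<xi>. (P \<xi> / \<xi> powr (1 / n) + Q \<xi> / \<xi> powr (1 / n)) / 2) \<longlongrightarrow> (p + q) / 2) at_top"
    by (intro tendsto_intros assms) auto
  then show "((\<lambda>\<xi>. U \<xi> / \<xi> powr (1 / n)) \<longlongrightarrow> (p + q) / 2) at_top"
  proof (rule Lim_transform_eventually)
    show "eventually (\<lambda>\<xi>. (P \<xi> / \<xi> powr (1 / n) + Q \<xi> / \<xi> powr (1 / n)) / 2 = U \<xi> / \<xi> powr (1 / n))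
        at_top"
      using assms(3) by eventually_elim (simp add: add_divide_distrib)
  qed
  have "((\<lambda>\<xi>. (P \<xi> / \<xi> powr (1 / n) - Q \<xi> / \<xi> powr (1 / n)) / (2 * l)) \<longlongrightarrow> (p - q) / (2 * l)) at_top"
    by (intro tendsto_intros assms) (use l_gt_1 in auto)
  then show "((\<lambda>\<xi>. S \<xi> / \<xi> powr (1 / n)) \<longlongrightarrow> (p - q) / (2 * l)) at_top"
  proof (rule Lim_transform_eventually)
    show "eventually (\<lambda>\<xi>. (P \<xi> / \<xi> powr (1 / n) - Q \<xi> / \<xi> powr (1 / n)) / (2 * l) =
        S \<xi> / \<xi> powr (1 / n)) at_top"
      using assms(4) by eventually_elim (simp add: diff_divide_distrib mult.commute)
  qed
qed

lemma one_wave_profile: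
  assumes wave: "char_wave {0<..} P Q"
    and far: "((\<lambda>\<xi>. P \<xi> / \<xi> powr (1 / n)) \<longlongrightarrow> p) at_top" "((\<lambda>\<xi>. Q \<xi> / \<xi> powr (1 / n)) \<longlongrightarrow> q) at_top"
    and dec: "\<exists>K>0. ((\<lambda>\<xi>. (P \<xi> - Q \<xi>) / (2 * l) / \<xi> powr e) \<longlongrightarrow> K) (at_right 0)" "e > 0"
  shows "\<exists>U S. vacuum_profile 0 {} U S ((p + q) / 2) ((p - q) / (2 * l)) e"
proof -
  define U where "U = (\<lambda>\<xi>. (P \<xi> + Q \<xi>) / 2)"
  define S where "S = (\<lambda>\<xi>. if \<xi> \<le> 0 then 0 else (P \<xi> - Q \<xi>) / (2 * l))"
  have sm: "smooth_profile l k ({0<..} - {}) U S"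
    using smooth_profile_cong[OF char_wave_smooth_profile[OF wave], of U S] by (auto simp: U_def S_def)
  have pos: "S \<xi> > 0" if "\<xi> > 0" for \<xi>
    using wave that l_gt_1 unfolding char_wave_def S_def by simp
  have "eventually (\<lambda>\<xi>. S \<xi> = (P \<xi> - Q \<xi>) / (2 * l)) at_top"
    using eventually_gt_at_top[of 0] by eventually_elim (simp add: S_def)
  note ff = far_field_velocity[OF far _ this, of U]
  have "\<exists>K>0. ((\<lambda>\<xi>. S \<xi> / (\<xi> - 0) powr e) \<longlongrightarrow> K) (at_right 0)"
  proof -
    obtain K where K: "K > 0" "((\<lambda>\<xi>. (P \<xi> - Q \<xi>) / (2 * l) / \<xi> powr e) \<longlongrightarrow> K) (at_right 0)"
        using dec by blast
    have "((\<lambda>\<xi>. S \<xi> / (\<xi> - 0) powr e) \<longlongrightarrow> K) (at_right 0)"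
      by (rule Lim_transform_eventually[OF K(2)])
         (use eventually_at_right_less[of "0::real"] in \<open>auto elim!: eventually_mono simp: S_def\<close>)
    then show ?thesis using K by blast
  qed
  then have "vacuum_profile 0 {} U S ((p + q) / 2) ((p - q) / (2 * l)) e"
    unfolding vacuum_profile_def using sm pos ff dec(2) by (auto simp: U_def S_def)
  then show ?thesis by blast
qed

lemma two_wave_profile:
  assumes vz: "\<xi>v < z" "z < 0" and left: "char_wave {\<xi>v<..<z} P1 Q1" and right: "char_wave {z<..} P2 Q2"
    and far: "((\<lambda>\<xi>. P2 \<xi> / \<xi> powr (1 / n)) \<longlongrightarrow> p) at_top" "((\<lambda>\<xi>. Q2 \<xi> / \<xi> powr (1 / n)) \<longlongrightarrow> q) at_top"
    and lim: "(P1 \<longlongrightarrow> pm) (at_left z)" "(Q1 \<longlongrightarrow> qm) (at_left z)" "(P2 \<longlongrightarrow> pp) (at_right z)" "(Q2 \<longlongrightarrow> qp)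
        (at_right z)"
    and cp: "qp < pp"
    and dec: "\<exists>K>0. ((\<lambda>\<xi>. (P1 \<xi> - Q1 \<xi>) / (2 * l) / (\<xi> - \<xi>v) powr (1 / 2)) \<longlongrightarrow> K) (at_right \<xi>v)"
  shows "\<exists>U S. vacuum_profile \<xi>v {z} U S ((p + q) / 2) ((p - q) / (2 * l)) (1 / 2) \<and>
    (U \<longlongrightarrow> (pm + qm) / 2) (at_left z) \<and> (S \<longlongrightarrow> (pm - qm) / (2 * l)) (at_left z) \<and>
    (U \<longlongrightarrow> (pp + qp) / 2) (at_right z) \<and> (S \<longlongrightarrow> (pp - qp) / (2 * l)) (at_right z) \<and>
    U z = (pp + qp) / 2 \<and> S z = (pp - qp) / (2 * l)"
proof -
  define U where "U = (\<lambda>\<xi>. if \<xi> < z then (P1 \<xi> + Q1 \<xi>) / 2 else if \<xi> = z then (pp + qp)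
      / 2 else (P2 \<xi> + Q2 \<xi>) / 2)"
  define S where "S = (\<lambda>\<xi>. if \<xi> \<le> \<xi>v then 0 else if \<xi> < z then (P1 \<xi> - Q1 \<xi>) / (2 * l)
     else if \<xi> = z then (pp - qp) / (2 * l) else (P2 \<xi> - Q2 \<xi>) / (2 * l))"
  have s1: "smooth_profile l k {\<xi>v<..<z} U S"
    by (rule smooth_profile_cong[OF char_wave_smooth_profile[OF left]]) (auto simp: U_def S_def)
  have s2: "smooth_profile l k {z<..} U S"
    by (rule smooth_profile_cong[OF char_wave_smooth_profile[OF right]]) (use vz in \<open>auto simp:
        U_def S_def\<close>)
  have un: "{\<xi>v<..} - {z} = {\<xi>v<..<z} \<union> {z<..}" using vz by auto
  have sm: "smooth_profile l k ({\<xi>v<..} - {z}) U S"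
    unfolding un by (rule smooth_profile_Un[OF s1 s2]) auto
  have pos: "S \<xi> > 0" if "\<xi> > \<xi>v" for \<xi>
    using left right that l_gt_1 cp vz unfolding char_wave_def S_def by auto
  have evt: "eventually (\<lambda>\<xi>. \<xi> > z) at_top" by (rule eventually_gt_at_top)
  have "eventually (\<lambda>\<xi>. U \<xi> = (P2 \<xi> + Q2 \<xi>) / 2) at_top" "eventually (\<lambda>\<xi>. S \<xi> = (P2 \<xi> - Q2 \<xi>)
      / (2 * l)) at_top"
    using evt by (eventually_elim, use vz in \<open>auto simp: U_def S_def\<close>)+
  note ff = far_field_velocity[OF far this]
  have evl: "eventually (\<lambda>\<xi>. \<xi> \<in> {\<xi>v<..<z}) (at_left z)" by (rule eventually_at_leftI[OF _ vz(1)]) auto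
  have evr: "eventually (\<lambda>\<xi>. \<xi> > z) (at_right z)" by (rule eventually_at_right_less)
  have evv: "eventually (\<lambda>\<xi>. \<xi> \<in> {\<xi>v<..<z}) (at_right \<xi>v)" by (rule eventually_at_rightI[OF _
      vz(1)]) auto
  have L: "(U \<longlongrightarrow> (pm + qm) / 2) (at_left z)" "(S \<longlongrightarrow> (pm - qm) / (2 * l)) (at_left z)"
  proof -
    have "((\<lambda>\<xi>. (P1 \<xi> + Q1 \<xi>) / 2) \<longlongrightarrow> (pm + qm) / 2) (at_left z)" by (intro tendsto_intros lim) auto
    then show "(U \<longlongrightarrow> (pm + qm) / 2) (at_left z)"
      by (rule Lim_transform_eventually) (use evl in \<open>eventually_elim, auto simp: U_def\<close>)
    have "((\<lambda>\<xi>. (P1 \<xi> - Q1 \<xi>) / (2 * l)) \<longlongrightarrow> (pm - qm) / (2 * l)) (at_left z)"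
        by (intro tendsto_intros lim) (use l_gt_1 in auto)
    then show "(S \<longlongrightarrow> (pm - qm) / (2 * l)) (at_left z)"
      by (rule Lim_transform_eventually) (use evl in \<open>eventually_elim, auto simp: S_def\<close>)
  qed
  have R: "(U \<longlongrightarrow> (pp + qp) / 2) (at_right z)" "(S \<longlongrightarrow> (pp - qp) / (2 * l)) (at_right z)"
  proof -
    have "((\<lambda>\<xi>. (P2 \<xi> + Q2 \<xi>) / 2) \<longlongrightarrow> (pp + qp) / 2) (at_right z)" by (intro tendsto_intros lim) auto
    then show "(U \<longlongrightarrow> (pp + qp) / 2) (at_right z)"
      by (rule Lim_transform_eventually) (use evr in \<open>eventually_elim, auto simp: U_def\<close>)
    have "((\<lambda>\<xi>. (P2 \<xi> - Q2 \<xi>) / (2 * l)) \<longlongrightarrow> (pp - qp) / (2 * l)) (at_right z)"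
        by (intro tendsto_intros lim) (use l_gt_1 in auto)
    then show "(S \<longlongrightarrow> (pp - qp) / (2 * l)) (at_right z)"
      by (rule Lim_transform_eventually) (use evr in \<open>eventually_elim, use vz in \<open>auto simp: S_def\<close>\<close>)
  qed
  have "\<exists>K>0. ((\<lambda>\<xi>. S \<xi> / (\<xi> - \<xi>v) powr (1 / 2)) \<longlongrightarrow> K) (at_right \<xi>v)"
  proof -
    obtain K where K: "K > 0" "((\<lambda>\<xi>. (P1 \<xi> - Q1 \<xi>) / (2 * l) / (\<xi> - \<xi>v) powr (1 / 2)) \<longlongrightarrow> K)
        (at_right \<xi>v)" using dec by blast
    have "((\<lambda>\<xi>. S \<xi> / (\<xi> - \<xi>v) powr (1 / 2)) \<longlongrightarrow> K) (at_right \<xi>v)"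
      by (rule Lim_transform_eventually[OF K(2)]) (use evv in \<open>eventually_elim, auto simp: S_def\<close>)
    then show ?thesis using K by blast
  qed
  then have "vacuum_profile \<xi>v {z} U S ((p + q) / 2) ((p - q) / (2 * l)) (1 / 2)"
    unfolding vacuum_profile_def using sm pos ff vz by (auto simp: S_def)
  moreover have "U z = (pp + qp) / 2" "S z = (pp - qp) / (2 * l)" using vz by (simp_all add:
      U_def S_def)
  ultimately show ?thesis using L R by blast
qed

lemma expansion_profile:
  assumes c: "c > 0" and u: "u > l * c"
  shows "\<exists>U S. vacuum_profile 0 {} U S u c (1 + 1 / ((k - 1) * l))"
proof -
  define r0 where "r0 = (u - l * c) / (u + l * c)"
  have lc: "l * c > 0" using l_gt_1 c by simp
  have g: "u + l * c > 0" using u lc by simp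
  have r0: "0 < r0" "r0 < 1" using u lc by (auto simp: r0_def)
  obtain P Q where w: "char_wave {0<..} P Q" "((\<lambda>\<xi>. P \<xi> / \<xi> powr (1 / n)) \<longlongrightarrow> (u + l * c) * 1) at_top"
    "((\<lambda>\<xi>. Q \<xi> / \<xi> powr (1 / n)) \<longlongrightarrow> (u + l * c) * r0) at_top"
    "\<exists>K>0. ((\<lambda>\<xi>. (P \<xi> - Q \<xi>) / (2 * l) / \<xi> powr (1 + 1 / ((k - 1) * l))) \<longlongrightarrow> K) (at_right 0)"
    using expansion_wave[OF r0 g] by blast
  have "1 + 1 / ((k - 1) * l) > 0" using k_gt_1 l_gt_1 by (simp add: add_pos_pos)
  from one_wave_profile[OF w this]
  have "\<exists>U S. vacuum_profile 0 {} U S (((u + l * c) * 1 + (u + l * c) * r0) / 2) (((u + l * c)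
      * 1 - (u + l * c) * r0) / (2 * l)) (1 + 1 / ((k - 1) * l))" .
  moreover have "(u + l * c) * r0 = u - l * c" unfolding r0_def using g by simp
  moreover have "((u + l * c) - (u - l * c)) / (2 * l) = c" using l_gt_1 by simp
  ultimately show ?thesis by simp
qed

lemma simple_profile:
  assumes c: "c > 0"
  shows "\<exists>U S. vacuum_profile 0 {} U S (l * c) c 1"
proof -
  have g: "2 * l * c > 0" using l_gt_1 c by simp
  obtain P Q where w: "char_wave {0<..} P Q" "((\<lambda>\<xi>. P \<xi> / \<xi> powr (1 / n)) \<longlongrightarrow> 2 * l * c * 1) at_top"
    "((\<lambda>\<xi>. Q \<xi> / \<xi> powr (1 / n)) \<longlongrightarrow> 0) at_top"
    "\<exists>K>0. ((\<lambda>\<xi>. (P \<xi> - Q \<xi>) / (2 * l) / \<xi> powr 1) \<longlongrightarrow> K) (at_right 0)"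
    using simple_wave_right[OF g] by blast
  from one_wave_profile[OF w] have "\<exists>U S. vacuum_profile 0 {} U S ((2 * l * c * 1 + 0) / 2)
      ((2 * l * c * 1 - 0) / (2 * l)) 1" by simp
  then show ?thesis using l_gt_1 by simp
qed

lemma rarefaction_profile:
  assumes c: "c > 0" and u: "- l * c \<le> u" "u < l * c"
  shows "\<exists>\<xi>v z U S. \<xi>v < z \<and> z < 0 \<and> vacuum_profile \<xi>v {z} U S u c (1 / 2) \<and> isCont U z \<and> isCont S z"
proof -
  define g where "g = l * c - u"
  have g: "g > 0" using u by (simp add: g_def)
  define r0 where "r0 = (u + l * c) / (u - l * c)"
  have gr: "g * (- r0) = u + l * c" unfolding g_def r0_def using u by (simp add: field_simps)
  have "\<exists>z<0. \<exists>P Q. char_wave {z<..} P Q \<and> (P \<longlongrightarrow> 0) (at_right z) \<and> (Q \<longlongrightarrow> k * z / beta) (at_right z) \<and>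
    ((\<lambda>\<xi>. P \<xi> / \<xi> powr (1 / n)) \<longlongrightarrow> u + l * c) at_top \<and> ((\<lambda>\<xi>. Q \<xi> / \<xi> powr (1 / n)) \<longlongrightarrow> g * (- 1)) at_top"
  proof (cases "u = - l * c")
    case True
    then show ?thesis using simple_wave_left[OF g] by simp
  next
    case False
    then have "r0 < 0" unfolding r0_def using u by (simp add: divide_pos_neg)
    from rarefaction_wave[OF this g] show ?thesis unfolding gr .
  qed
  then obtain z P2 Q2 where z: "z < 0" and w: "char_wave {z<..} P2 Q2" "(P2 \<longlongrightarrow> 0) (at_right z)"
      "(Q2 \<longlongrightarrow> k * z / beta) (at_right z)"
    "((\<lambda>\<xi>. P2 \<xi> / \<xi> powr (1 / n)) \<longlongrightarrow> u + l * c) at_top" "((\<lambda>\<xi>. Q2 \<xi> / \<xi> powr (1 / n)) \<longlongrightarrow> g * (- 1))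
        at_top" by blast
  have reg0: "reg_ratio 0 = beta" by (simp add: reg_ratio_def)
  obtain \<xi>v P1 Q1 where v: "\<xi>v < z" "char_wave {\<xi>v<..<z} P1 Q1" "(P1 \<longlongrightarrow> 0 * (k * z / reg_ratio 0))
      (at_left z)"
    "(Q1 \<longlongrightarrow> k * z / reg_ratio 0) (at_left z)"
    "\<exists>K>0. ((\<lambda>\<xi>. (P1 \<xi> - Q1 \<xi>) / (2 * l) / (\<xi> - \<xi>v) powr (1 / 2)) \<longlongrightarrow> K) (at_right \<xi>v)"
    using vacuum_wave[of 0 z] z by auto
  have v3: "(P1 \<longlongrightarrow> 0) (at_left z)" "(Q1 \<longlongrightarrow> k * z / beta) (at_left z)" using v(3,4) by (simp_all add: reg0)
  have neg: "k * z / beta < 0" using z beta_pos k_gt_1 by (intro divide_neg_pos mult_pos_neg) auto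
  obtain U S where p: "vacuum_profile \<xi>v {z} U S ((u + l * c + g * (- 1)) / 2)
      ((u + l * c - g * (- 1)) / (2 * l)) (1 / 2)"
    and L: "(U \<longlongrightarrow> (0 + k * z / beta) / 2) (at_left z)" "(S \<longlongrightarrow> (0 - k * z / beta) / (2 * l)) (at_left z)"
    "(U \<longlongrightarrow> (0 + k * z / beta) / 2) (at_right z)" "(S \<longlongrightarrow> (0 - k * z / beta) / (2 * l)) (at_right z)"
    "U z = (0 + k * z / beta) / 2" "S z = (0 - k * z / beta) / (2 * l)"
    using two_wave_profile[OF v(1) z v(2) w(1) w(4,5) v3 w(2,3) neg v(5)] by blast
  have "(u + l * c + g * (- 1)) / 2 = u" "(u + l * c - g * (- 1)) / (2 * l) = c"
    using l_gt_1 by (simp_all add: g_def field_simps)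
  then have "vacuum_profile \<xi>v {z} U S u c (1 / 2)" using p by (simp only:)
  moreover have "isCont U z" "isCont S z"
    unfolding isCont_def filterlim_at_split using L by simp_all
  ultimately show ?thesis using v(1) z by blast
qed

lemma compression_profile:
  assumes c: "c > 0" and u: "u < - l * c"
  shows "\<exists>\<xi>v z U S. \<xi>v < z \<and> z < 0 \<and> vacuum_profile \<xi>v {z} U S u c (1 / 2) \<and>
    profile_shock (1 + 2 / l) (k * z) U S z"
proof -
  define g where "g = l * c - u"
  have lc: "l * c > 0" using l_gt_1 c by simp
  have g: "g > 0" using u lc by (simp add: g_def)
  define r0 where "r0 = (u + l * c) / (u - l * c)"
  have gr: "g * (- r0) = u + l * c" unfolding g_def r0_def using u lc by (simp add: field_simps)
  have r0: "0 < r0" "r0 < 1" unfolding r0_def using u lc by (auto simp: divide_neg_neg divide_less_eq)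
  obtain z P2 Q2 pp qp r' where z: "z < 0" and w: "char_wave {z<..} P2 Q2" "(P2 \<longlongrightarrow> pp) (at_right z)"
      "(Q2 \<longlongrightarrow> qp) (at_right z)"
    and r': "0 < r'" "r' < 1" and sh: "shock_states (k * z) (r' * (k * z / reg_ratio r'))
        (k * z / reg_ratio r') pp qp"
    and far: "((\<lambda>\<xi>. P2 \<xi> / \<xi> powr (1 / n)) \<longlongrightarrow> g * (- r0)) at_top" "((\<lambda>\<xi>. Q2 \<xi> / \<xi> powr (1 / n))
        \<longlongrightarrow> g * (- 1)) at_top"
    using compression_wave[OF r0 g] by blast
  define pm qm where "pm = r' * (k * z / reg_ratio r')" and "qm = k * z / reg_ratio r'"
  obtain \<xi>v P1 Q1 where v: "\<xi>v < z" "char_wave {\<xi>v<..<z} P1 Q1" "(P1 \<longlongrightarrow> pm) (at_left z)"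
    "(Q1 \<longlongrightarrow> qm) (at_left z)"
    "\<exists>K>0. ((\<lambda>\<xi>. (P1 \<xi> - Q1 \<xi>) / (2 * l) / (\<xi> - \<xi>v) powr (1 / 2)) \<longlongrightarrow> K) (at_right \<xi>v)"
    using vacuum_wave[of r' z] z r' unfolding pm_def qm_def by auto
  note sh' = sh[folded pm_def, folded qm_def, unfolded shock_states_def Let_def]
  have cp: "qp < pp" using sh' l_gt_1 by (simp add: zero_less_divide_iff)
  obtain U S where p: "vacuum_profile \<xi>v {z} U S ((g * (- r0) + g * (- 1)) / 2) ((g * (- r0)
      - g * (- 1)) / (2 * l)) (1 / 2)"
    and L: "(U \<longlongrightarrow> (pm + qm) / 2) (at_left z)" "(S \<longlongrightarrow> (pm - qm) / (2 * l)) (at_left z)"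
    "(U \<longlongrightarrow> (pp + qp) / 2) (at_right z)" "(S \<longlongrightarrow> (pp - qp) / (2 * l)) (at_right z)"
    using two_wave_profile[OF v(1) z v(2) w(1) far v(3,4) w(2,3) cp v(5)] by blast
  have "(g * (- r0) + g * (- 1)) / 2 = u" "(g * (- r0) - g * (- 1)) / (2 * l) = c"
    unfolding gr using l_gt_1 by (simp_all add: g_def field_simps)
  then have "vacuum_profile \<xi>v {z} U S u c (1 / 2)" using p by (simp only:)
  moreover have "profile_shock (1 + 2 / l) (k * z) U S z"
  proof -
    have e: "ell (1 + 2 / l) = l" using l_gt_1 by (simp add: ell_def)
    show ?thesis unfolding profile_shock_def e using L sh' by blast
  qed
  ultimately show ?thesis using v(1) z by blast
qed

end

text \<open>
  The four ranges of the Mach number select the four constructions; the locale is instantiated with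
  the exponents belonging to \<open>\<gamma>\<close> and \<open>\<lambda>\<close>.
\<close>
theorem theorem1:
  fixes a \<gamma> lam u_plus c_plus Ma :: real
    and u0 c0 :: "real \<Rightarrow> real"
  assumes "a > 0"
    and "1 < \<gamma>" and "\<gamma> < 3"
    and "0 < lam" and "lam < 1"
    and "c_plus > 0"
    and "Ma = u_plus / c_plus"
    and "u0 = (\<lambda>x. u_plus * x powr (1 - lam))"
    and "c0 = (\<lambda>x. if x > 0 then c_plus * x powr (1 - lam) else 0)"
  shows "\<exists>X u c V C.
    euler_solution a \<gamma> u0 c0 X u c \<and>
    self_similar lam X u c V C \<and>
    (Ma > ell \<gamma> \<longrightarrow>
       continuous_flow X u c \<and> (\<forall>t>0. X t = 0) \<and> (\<forall>t>0. C1_decay (c t) (X t))) \<and>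
    (Ma = ell \<gamma> \<longrightarrow>
       continuous_flow X u c \<and> (\<forall>t>0. X t = 0) \<and> (\<forall>t>0. Lipschitz_decay (c t) (X t))) \<and>
    (- ell \<gamma> \<le> Ma \<and> Ma < ell \<gamma> \<longrightarrow>
       continuous_flow X u c \<and>
       (\<exists>\<xi>v<0. \<forall>t>0. X t = t powr (1 / lam) * \<xi>v) \<and>
       (\<forall>t>0. physical_singularity (c t) (X t))) \<and>
    (Ma < - ell \<gamma> \<longrightarrow>
       (\<exists>\<xi>v \<xi>s. \<xi>v < \<xi>s \<and> \<xi>s < 0 \<and>
          (\<forall>t>0. X t = t powr (1 / lam) * \<xi>v) \<and>
          discontinuities X u c = {(t, t powr (1 / lam) * \<xi>s) | t. t > 0} \<and>
          (\<forall>t>0. shock2 a \<gamma> u c (\<lambda>\<tau>. \<tau> powr (1 / lam) * \<xi>s) t)) \<and>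
       (\<forall>t>0. physical_singularity (c t) (X t))) \<and>
    (\<not> (Ma < ell \<gamma> \<and> lam = 1 / 2) \<longrightarrow> abrupt_change c0 X c)"
proof -
  define k l n where "k = 1 / lam" and "l = ell \<gamma>" and "n = 1 / (1 - lam)"
  have lam: "lam = 1 / k" "k > 1" and n: "n > 1" and l: "l > 1"
    using assms(2-5) by (auto simp: k_def n_def l_def ell_def)
  have kn: "(k - 1) * (n - 1) = 1" using assms(4,5) by (simp add: k_def n_def field_simps)
  interpret self_similar_exponents l n k
    by unfold_locales (use l n lam kn in auto)
  have \<gamma>l: "1 + 2 / l = \<gamma>" using assms(2) by (simp add: l_def ell_def diff_divide_distrib)
  have ex: "1 - lam = 1 / n" "1 - 1 / k = 1 - lam" by (simp_all add: n_def k_def)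
  have u: "u_plus = Ma * c_plus" using assms(6,7) by simp
  have main: "euler_solution a \<gamma> u0 c0 (\<lambda>t. t powr k * \<xi>v) (similarity_flow k U) (similarity_flow k S) \<and>
     self_similar lam (\<lambda>t. t powr k * \<xi>v) (similarity_flow k U) (similarity_flow k S)
       (\<lambda>\<xi>. - (1 / k) * U \<xi> / \<xi>) (\<lambda>\<xi>. - (1 / k) * S \<xi> / \<xi>) \<and>
     discontinuities (\<lambda>t. t powr k * \<xi>v) (similarity_flow k U) (similarity_flow k S)
      = {(t, t powr k * z) | t z. t > 0 \<and> z \<in> Z \<and> \<not> (isCont U z \<and> isCont S z)} \<and>
     (\<forall>t>0. decay_exponent (similarity_flow k S t) (t powr k * \<xi>v) e)"
    if p: "vacuum_profile \<xi>v Z U S u_plus c_plus e"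
      and j: "\<And>z. z \<in> Z \<Longrightarrow> (isCont U z \<and> isCont S z) \<or> profile_shock \<gamma> (k * z) U S z" for \<xi>v Z U S e
  proof -
    have S: "\<And>\<xi>. \<xi> \<le> \<xi>v \<Longrightarrow> S \<xi> = 0" "\<And>\<xi>. \<xi> > \<xi>v \<Longrightarrow> S \<xi> > 0" "finite Z" "0 \<notin> Z" "Z \<subseteq> {\<xi>v<..}"
      "smooth_profile (ell \<gamma>) k ({\<xi>v<..} - Z) U S"
      "((\<lambda>\<xi>. U \<xi> / \<xi> powr (1 - 1 / k)) \<longlongrightarrow> u_plus) at_top" "((\<lambda>\<xi>. S \<xi> / \<xi> powr (1 - 1 / k)) \<longlongrightarrow> c_plus)
          at_top" "e > 0"
      using p[unfolded vacuum_profile_def] unfolding l_def ex by auto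
    obtain K where K: "K > 0" "((\<lambda>\<xi>. S \<xi> / (\<xi> - \<xi>v) powr e) \<longlongrightarrow> K) (at_right \<xi>v)"
      using p unfolding vacuum_profile_def by blast
    have Slim: "(S \<longlongrightarrow> 0) (at_right \<xi>v)"
    proof -
      have ev: "eventually (\<lambda>\<xi>. \<xi> > \<xi>v) (at_right \<xi>v)" by (rule eventually_at_right_less)
      have "((\<lambda>\<xi>. (\<xi> - \<xi>v) powr e) \<longlongrightarrow> (\<xi>v - \<xi>v) powr e) (at_right \<xi>v)"
        by (intro tendsto_powr' tendsto_diff tendsto_ident_at tendsto_const)
           (use S(9) ev in \<open>auto elim: eventually_mono\<close>)
      from tendsto_mult[OF K(2) this] have "((\<lambda>\<xi>. S \<xi> / (\<xi> - \<xi>v) powr e * (\<xi> - \<xi>v) powr e) \<longlongrightarrow> 0)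
          (at_right \<xi>v)"
        using S(9) by simp
      then show ?thesis by (rule Lim_transform_eventually) (use ev in \<open>eventually_elim, auto\<close>)
    qed
    note sol = self_similar_solution[OF assms(1,2) lam(2) S(1,2) Slim S(3-6) j S(7,8)]
    have u0: "u0 = (\<lambda>x. u_plus * x powr (1 - 1 / k))" "c0 = (\<lambda>x. if x > 0 then c_plus * x powr (1 -
        1 / k) else 0)"
      using assms(8,9) ex by auto
    have "\<forall>t>0. decay_exponent (similarity_flow k S t) (t powr k * \<xi>v) e"
      using similarity_flow_decay[OF _ K] by blast
    then show ?thesis using sol unfolding u0 lam(1) by blast
  qed
  have cont: "continuous_flow X uu cc" if "discontinuities X uu cc = {}" for X uu cc
    unfolding continuous_flow_def using that unfolding discontinuities_def
    by (auto intro!: continuous_at_imp_continuous_on)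
  have dec0: "decay_exponent c0 0 (1 - lam)"
    unfolding decay_exponent_def
  proof (intro exI conjI)
    show "((\<lambda>x. c0 x / (x - 0) powr (1 - lam)) \<longlongrightarrow> c_plus) (at_right 0)"
    proof (rule Lim_transform_eventually[OF tendsto_const])
      show "eventually (\<lambda>x. c_plus = c0 x / (x - 0) powr (1 - lam)) (at_right 0)"
        using eventually_at_right_less[of "0::real"] by eventually_elim (simp add: assms(9))
    qed
  qed (use assms in simp)
  have abrupt: "abrupt_change c0 X cc" if "\<forall>t>0. decay_exponent (cc t) (X t) e" "e \<noteq> 1 - lam" for X cc e
    unfolding abrupt_change_def using dec0 that by blast
  consider "Ma > l" | "Ma = l" | "- l \<le> Ma" "Ma < l" | "Ma < - l" by linarith
  then show ?thesis
  proof cases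
    case 1
    then have "u_plus > l * c_plus" using u assms(6) by simp
    then obtain U S where p: "vacuum_profile 0 {} U S u_plus c_plus (1 + 1 / ((k - 1) * l))"
      using expansion_profile[OF assms(6)] by blast
    define X where "X = (\<lambda>t::real. t powr k * 0)"
    have m: "euler_solution a \<gamma> u0 c0 X (similarity_flow k U) (similarity_flow k S)"
      "self_similar lam X (similarity_flow k U) (similarity_flow k S) (\<lambda>\<xi>. - (1 / k) * U \<xi> / \<xi>)
          (\<lambda>\<xi>. - (1 / k) * S \<xi> / \<xi>)"
      "discontinuities X (similarity_flow k U) (similarity_flow k S) = {}"
      "\<forall>t>0. decay_exponent (similarity_flow k S t) (X t) (1 + 1 / ((k - 1) * l))"
      using main[OF p] unfolding X_def by auto
    have X0: "\<forall>t>0. X t = 0" by (simp add: X_def)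
    have cf: "continuous_flow X (similarity_flow k U) (similarity_flow k S)" by (rule cont[OF m(3)])
    have "(k - 1) * l > 0" using lam l by simp
    then have "1 / ((k - 1) * l) > 0" by simp
    then have e: "1 + 1 / ((k - 1) * l) > 1" "1 + 1 / ((k - 1) * l) \<noteq> 1 - lam" using assms(4)
        by linarith+
    have C1: "\<forall>t>0. C1_decay (similarity_flow k S t) (X t)" unfolding C1_decay_def using m(4) e(1)
        by blast
    have ab: "abrupt_change c0 X (similarity_flow k S)" by (rule abrupt[OF m(4) e(2)])
    show ?thesis
      using m(1,2) X0 cf C1 ab 1 l unfolding l_def
      by (intro exI[of _ X] exI[of _ "similarity_flow k U"] exI[of _ "similarity_flow k S"]
         exI[of _ "\<lambda>\<xi>. - (1 / k) * U \<xi> / \<xi>"] exI[of _ "\<lambda>\<xi>. - (1 / k) * S \<xi> / \<xi>"]) auto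
  next
    case 2
    then have "u_plus = l * c_plus" using u by simp
    then obtain U S where p: "vacuum_profile 0 {} U S u_plus c_plus 1"
      using simple_profile[OF assms(6)] by auto
    define X where "X = (\<lambda>t::real. t powr k * 0)"
    have m: "euler_solution a \<gamma> u0 c0 X (similarity_flow k U) (similarity_flow k S)"
      "self_similar lam X (similarity_flow k U) (similarity_flow k S) (\<lambda>\<xi>. - (1 / k) * U \<xi> / \<xi>)
          (\<lambda>\<xi>. - (1 / k) * S \<xi> / \<xi>)"
      "discontinuities X (similarity_flow k U) (similarity_flow k S) = {}"
      "\<forall>t>0. decay_exponent (similarity_flow k S t) (X t) 1"
      using main[OF p] unfolding X_def by auto
    have X0: "\<forall>t>0. X t = 0" by (simp add: X_def)
    have cf: "continuous_flow X (similarity_flow k U) (similarity_flow k S)" by (rule cont[OF m(3)])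
    have ab: "abrupt_change c0 X (similarity_flow k S)" by (rule abrupt[OF m(4)]) (use assms(4) in simp)
    show ?thesis
      using m(1,2,4) X0 cf ab 2 l unfolding l_def Lipschitz_decay_def
      by (intro exI[of _ X] exI[of _ "similarity_flow k U"] exI[of _ "similarity_flow k S"]
         exI[of _ "\<lambda>\<xi>. - (1 / k) * U \<xi> / \<xi>"] exI[of _ "\<lambda>\<xi>. - (1 / k) * S \<xi> / \<xi>"]) auto
  next
    case 3
    have "- l * c_plus \<le> u_plus" "u_plus < l * c_plus"
      unfolding u using 3 assms(6) mult_right_mono[of "- l" Ma c_plus] by auto
    then obtain \<xi>v z U S where p: "\<xi>v < z" "z < 0" "vacuum_profile \<xi>v {z} U S u_plus c_plus (1 / 2)"
        "isCont U z" "isCont S z"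
      using rarefaction_profile[OF assms(6)] by blast
    define X where "X = (\<lambda>t. t powr k * \<xi>v)"
    have m: "euler_solution a \<gamma> u0 c0 X (similarity_flow k U) (similarity_flow k S)"
      "self_similar lam X (similarity_flow k U) (similarity_flow k S) (\<lambda>\<xi>. - (1 / k) * U \<xi> / \<xi>)
          (\<lambda>\<xi>. - (1 / k) * S \<xi> / \<xi>)"
      "discontinuities X (similarity_flow k U) (similarity_flow k S) = {}"
      "\<forall>t>0. decay_exponent (similarity_flow k S t) (X t) (1 / 2)"
      using main[OF p(3)] p(4,5) unfolding X_def by auto
    have Xv: "\<exists>\<xi>v<0. \<forall>t>0. X t = t powr (1 / lam) * \<xi>v"
      using p(1,2) by (intro exI[of _ \<xi>v]) (auto simp: X_def k_def)
    have ab: "lam \<noteq> 1 / 2 \<longrightarrow> abrupt_change c0 X (similarity_flow k S)"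
      using abrupt[OF m(4)] by auto
    have cf: "continuous_flow X (similarity_flow k U) (similarity_flow k S)" by (rule cont[OF m(3)])
    show ?thesis
      using m Xv ab cf 3 unfolding l_def physical_singularity_def
      by (intro exI[of _ X] exI[of _ "similarity_flow k U"] exI[of _ "similarity_flow k S"]
         exI[of _ "\<lambda>\<xi>. - (1 / k) * U \<xi> / \<xi>"] exI[of _ "\<lambda>\<xi>. - (1 / k) * S \<xi> / \<xi>"]) auto
  next
    case 4
    have "u_plus < - l * c_plus"
      unfolding u using 4 assms(6) by (intro mult_strict_right_mono) auto
    then obtain \<xi>v z U S where p: "\<xi>v < z" "z < 0" "vacuum_profile \<xi>v {z} U S u_plus c_plus (1 / 2)"
      and sh: "profile_shock \<gamma> (k * z) U S z"
      using compression_profile[OF assms(6)] unfolding \<gamma>l by blast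
    define X where "X = (\<lambda>t. t powr k * \<xi>v)"
    have m0: "euler_solution a \<gamma> u0 c0 X (similarity_flow k U) (similarity_flow k S)"
      "self_similar lam X (similarity_flow k U) (similarity_flow k S) (\<lambda>\<xi>. - (1 / k) * U \<xi> / \<xi>)
          (\<lambda>\<xi>. - (1 / k) * S \<xi> / \<xi>)"
      "discontinuities X (similarity_flow k U) (similarity_flow k S) = {(t, t powr k * z')
          | t z'. t > 0 \<and> z' \<in> {z} \<and> \<not> (isCont U z' \<and> isCont S z')}"
      "\<forall>t>0. decay_exponent (similarity_flow k S t) (X t) (1 / 2)"
      using main[OF p(3)] sh unfolding X_def by auto
    have s2: "\<forall>t>0. shock2 a \<gamma> (similarity_flow k U) (similarity_flow k S) (\<lambda>\<tau>. \<tau> powr k * z) t"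
      using shock2_similarity_flow(1)[OF assms(1,2) _ sh] by blast
    have "\<not> (isCont U z \<and> isCont S z)"
      using shock2_similarity_flow(2)[OF assms(1,2) zero_less_one sh]
        similarity_flow_isCont[where t=1 and U=U and k=k and x="1 powr k * z"]
        similarity_flow_isCont[where t=1 and U=S and k=k and x="1 powr k * z"] by auto
    then have m3: "discontinuities X (similarity_flow k U) (similarity_flow k S) = {(t,
        t powr k * z) | t. t > 0}"
      unfolding m0(3) by auto
    have ab: "lam \<noteq> 1 / 2 \<longrightarrow> abrupt_change c0 X (similarity_flow k S)"
      using abrupt[OF m0(4)] by auto
    have c: "\<exists>\<xi>v \<xi>s. \<xi>v < \<xi>s \<and> \<xi>s < 0 \<and> (\<forall>t>0. X t = t powr (1 / lam) * \<xi>v) \<and>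
          discontinuities X (similarity_flow k U) (similarity_flow k S) = {(t, t powr (1 / lam)
              * \<xi>s) | t. t > 0} \<and>
          (\<forall>t>0. shock2 a \<gamma> (similarity_flow k U) (similarity_flow k S) (\<lambda>\<tau>. \<tau> powr (1 / lam) * \<xi>s) t)"
      using p(1,2) m3 s2 unfolding k_def[symmetric] by (intro exI[of _ \<xi>v] exI[of _ z]) (auto simp:
          X_def)
    show ?thesis
      using m0(1,2,4) ab c 4 l unfolding l_def physical_singularity_def
      by (intro exI[of _ X] exI[of _ "similarity_flow k U"] exI[of _ "similarity_flow k S"]
         exI[of _ "\<lambda>\<xi>. - (1 / k) * U \<xi> / \<xi>"] exI[of _ "\<lambda>\<xi>. - (1 / k) * S \<xi> / \<xi>"]) auto
  qed
qed

end
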